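(* (1) Let $K$ be a number field. For any integers $u\ge3$ and $t\ge1$ there exists an extension $L/K$ of degree $ut$ with $t_K(L)=t$. (2) Let $K=\mathbb Q$. For every even positive integer $t$ there exists an extension $L/K$ of degree $2t$ with $t_K(L)=t$.
   Context: For a finite extension $L/K$ (inside a fixed algebraic closure), the ascending index $t_K(L)=[F:K]$, where $F$ is the unique subfield of $L$ that is Galois over $K$ of maximum possible degree. *)

theory Defs
  imports Complex_Main "HOL-Computational_Algebra.Polynomial"
begin

text \<open>All fields live inside the fixed algebraically closed field of complex numbers.\<close>

definition subfield_C :: "complex set \<Rightarrow> bool" where
  "subfield_C S \<longleftrightarrow> 0 \<in> S \<and> 1 \<in> S \<and>
     (\<forall>x\<in>S. \<forall>y\<in>S. x + y \<in> S \<and> x * y \<in> S) \<and>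
     (\<forall>x\<in>S. - x \<in> S) \<and> (\<forall>x\<in>S. x \<noteq> 0 \<longrightarrow> inverse x \<in> S)"

definition basis_over :: "complex set \<Rightarrow> complex set \<Rightarrow> complex set \<Rightarrow> bool" where
  "basis_over K L B \<longleftrightarrow> finite B \<and> B \<subseteq> L \<and>
     (\<forall>c. (\<forall>b\<in>B. c b \<in> K) \<longrightarrow> (\<Sum>b\<in>B. c b * b) = 0 \<longrightarrow> (\<forall>b\<in>B. c b = 0)) \<and>
     L = {(\<Sum>b\<in>B. c b * b) | c. \<forall>b\<in>B. c b \<in> K}"

definition ext_degree :: "complex set \<Rightarrow> complex set \<Rightarrow> nat \<Rightarrow> bool" where
  "ext_degree K L n \<longleftrightarrow> (\<exists>B. basis_over K L B \<and> card B = n)"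

definition number_field :: "complex set \<Rightarrow> bool" where
  "number_field K \<longleftrightarrow> subfield_C K \<and> (\<exists>n. ext_degree \<rat> K n)"

definition poly_over :: "complex set \<Rightarrow> complex poly \<Rightarrow> bool" where
  "poly_over K p \<longleftrightarrow> (\<forall>i. coeff p i \<in> K)"

definition irreducible_over :: "complex set \<Rightarrow> complex poly \<Rightarrow> bool" where
  "irreducible_over K p \<longleftrightarrow> poly_over K p \<and> degree p \<ge> 1 \<and>
     \<not> (\<exists>q r. poly_over K q \<and> poly_over K r \<and> degree q \<ge> 1 \<and> degree r \<ge> 1 \<and> p = q * r)"

definition galois_over :: "complex set \<Rightarrow> complex set \<Rightarrow> bool" where
  "galois_over K F \<longleftrightarrow> (\<forall>p. irreducible_over K p \<longrightarrow> (\<exists>x\<in>F. poly p x = 0) \<longrightarrow>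
       rsquarefree p \<and> (\<forall>x. poly p x = 0 \<longrightarrow> x \<in> F))"

text \<open>Ascending index t_K(L): degree over K of the largest subfield of L Galois over K.\<close>
definition asc_index :: "complex set \<Rightarrow> complex set \<Rightarrow> nat" where
  "asc_index K L = Max {d. \<exists>F. subfield_C F \<and> K \<subseteq> F \<and> F \<subseteq> L \<and> galois_over K F \<and> ext_degree K F d}"

end

theory Submission
  imports Defs "HOL-Computational_Algebra.Fundamental_Theorem_Algebra" "HOL-Number_Theory.Residue_Primitive_Roots"
begin

text \<open>For part (1), take \<open>F/K\<close> cyclic of degree \<open>t\<close> inside \<open>K(\<zeta>\<^sub>p)\<close>, where \<open>p \<equiv> 1\<close> modulo \<open>t\<close> is
  unramified in \<open>K\<close>, and \<open>L = F(\<alpha>)\<close> with \<open>\<alpha>\<close> of degree \<open>u\<close> over \<open>F\<close> such that the remaining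
  conjugates of \<open>\<alpha>\<close> are still conjugate over \<open>L\<close>; this forces all subfields of \<open>L\<close> that are Galois
  over \<open>K\<close> into \<open>F\<close>. Both irreducibilities are Eisenstein arguments for places of degree one of \<open>F\<close>; such
  places exist over infinitely many primes because the minimal polynomial of a primitive element has roots
  modulo infinitely many primes.

  For part (2), take \<open>F/\<rat>\<close> cyclic of degree \<open>t\<close> and real, and \<open>L = F(\<surd>\<beta>)\<close> with \<open>\<beta> > 0\<close> having a negative
  conjugate. Then \<open>L\<close> is real, but every Galois extension of \<open>\<rat>\<close> containing \<open>\<surd>\<beta>\<close> is not.\<close>

hide_const (open) Module.smult UnivPoly.monom UnivPoly.coeff

section \<open>Polynomials over subfields of the complex numbers\<close>

text \<open>For \<open>u = 2\<close> the cofactor of \<open>X - \<alpha>\<close> is linear and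
  \<open>L\<close> is always Galois over \<open>F\<close>, so the irreducible-cofactor argument of
  part (1) starts at \<open>u = 3\<close>. Part (2) replaces it by an archimedean obstruction, which
  needs a real \<open>F\<close> and hence a real base field.

  A place of degree one has the integers as residues and the rational prime itself as uniformizer.
  It restricts to subfields and extends along a simple root modulo the place. A valuation can
  therefore be kept as a bare integer-valued function on a subfield of the complex numbers, without
  ideals, rings of integers or completions; the extension to \<open>F(\<alpha>)\<close> reads off
  values along Newton approximations lying in \<open>F\<close>.

  The cyclic field is the fixed field of \<open>\<sigma> ^^ t\<close>, where \<open>\<sigma>\<close>
  sends \<open>\<zeta>\<close> to \<open>\<zeta> ^ g\<close> for a primitive root \<open>g\<close>.
  Powers of \<open>\<zeta>\<close> ordered along powers of \<open>g\<close> form a basis that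
  \<open>\<sigma>\<close> shifts, so Gaussian periods give the degree directly. Asking for
  \<open>2 * t dvd p - 1\<close> rather than \<open>t dvd p - 1\<close> makes complex conjugation a
  power of \<open>\<sigma> ^^ t\<close>, which is why \<open>F\<close> is real when \<open>K\<close>
  is.\<close>

definition subring_C :: "complex set \<Rightarrow> bool" where
  "subring_C S \<longleftrightarrow> 0 \<in> S \<and> 1 \<in> S \<and> (\<forall>x\<in>S. \<forall>y\<in>S. x + y \<in> S \<and> x * y \<in> S) \<and> (\<forall>x\<in>S. - x \<in> S)"

lemma subfield_subring: "subfield_C K \<Longrightarrow> subring_C K"
  by (auto simp: subfield_C_def subring_C_def)

text \<open>Inverses are left out on purpose: these closure facts serve subfields, the integers and
  valuation rings alike.\<close>

context
  fixes S assumes S: "subring_C S"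
begin

lemma subring_closed:
  shows subring_0: "0 \<in> S" and subring_1: "1 \<in> S"
    and subring_add: "x \<in> S \<Longrightarrow> y \<in> S \<Longrightarrow> x + y \<in> S"
    and subring_mult: "x \<in> S \<Longrightarrow> y \<in> S \<Longrightarrow> x * y \<in> S"
    and subring_uminus: "x \<in> S \<Longrightarrow> - x \<in> S"
  using S by (auto simp: subring_C_def)

lemma subring_diff: "x \<in> S \<Longrightarrow> y \<in> S \<Longrightarrow> x - y \<in> S"
  using subring_add[of x "- y"] subring_uminus[of y] by simp

lemma subring_sum: "(\<And>i. i \<in> I \<Longrightarrow> f i \<in> S) \<Longrightarrow> sum f I \<in> S"
  by (induction I rule: infinite_finite_induct) (auto intro: subring_0 subring_add)

lemma subring_power: "x \<in> S \<Longrightarrow> x ^ n \<in> S"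
  by (induction n) (auto intro: subring_1 subring_mult)

lemma subring_of_nat: "of_nat n \<in> S"
  by (induction n) (auto intro: subring_0 subring_1 subring_add)

lemma subring_of_int: "of_int n \<in> S"
  by (cases n rule: int_cases2) (auto intro: subring_of_nat subring_uminus)

lemma poly_over_0: "poly_over S 0"
  and poly_over_pCons: "x \<in> S \<Longrightarrow> poly_over S p \<Longrightarrow> poly_over S (pCons x p)"
  and poly_over_add: "poly_over S p \<Longrightarrow> poly_over S q \<Longrightarrow> poly_over S (p + q)"
  and poly_over_diff: "poly_over S p \<Longrightarrow> poly_over S q \<Longrightarrow> poly_over S (p - q)"
  and poly_over_smult: "x \<in> S \<Longrightarrow> poly_over S p \<Longrightarrow> poly_over S (smult x p)"
  and poly_over_monom: "x \<in> S \<Longrightarrow> poly_over S (monom x n)"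
  by (auto simp: poly_over_def coeff_pCons subring_0 subring_add subring_diff subring_mult split: nat.splits)

lemma poly_over_1: "poly_over S 1"
  using poly_over_monom[OF subring_1, of 0] by (simp add: monom_0 one_pCons)

lemma poly_over_mult: "poly_over S p \<Longrightarrow> poly_over S q \<Longrightarrow> poly_over S (p * q)"
  by (auto simp: poly_over_def coeff_mult intro!: subring_sum subring_mult)

lemma poly_over_sum: "(\<And>i. i \<in> I \<Longrightarrow> poly_over S (f i)) \<Longrightarrow> poly_over S (sum f I)"
  by (induction I rule: infinite_finite_induct) (auto intro: poly_over_0 poly_over_add)

lemma poly_over_pcompose:
  assumes "poly_over S p" "poly_over S q"
  shows "poly_over S (pcompose p q)"
  using assms(1)
proof (induction p)
  case (pCons a p)
  then have "a \<in> S" "poly_over S p"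
    unfolding poly_over_def by (metis coeff_pCons_0, metis coeff_pCons_Suc)
  with pCons assms(2) show ?case
    by (auto simp: pcompose_pCons intro!: poly_over_add poly_over_mult poly_over_pCons poly_over_0)
qed (simp add: poly_over_0)

lemma poly_over_pderiv: "poly_over S p \<Longrightarrow> poly_over S (pderiv p)"
  unfolding poly_over_def coeff_pderiv by (blast intro: subring_mult subring_of_nat)

lemma poly_over_poly:
  assumes "poly_over S p" "x \<in> S"
  shows "poly p x \<in> S"
  unfolding poly_altdef using assms
  by (auto simp: poly_over_def intro!: subring_sum subring_mult subring_power)

end

lemma poly_over_mono: "poly_over K p \<Longrightarrow> K \<subseteq> L \<Longrightarrow> poly_over L p"
  by (auto simp: poly_over_def)

lemma subfield_inverse: "subfield_C K \<Longrightarrow> x \<in> K \<Longrightarrow> inverse x \<in> K"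
  by (cases "x = 0") (auto simp: subfield_C_def)

lemma subfield_divide: "subfield_C K \<Longrightarrow> x \<in> K \<Longrightarrow> y \<in> K \<Longrightarrow> x / y \<in> K"
  unfolding divide_inverse by (blast intro: subring_mult subfield_subring subfield_inverse)

lemma Rats_subset_subfield: "subfield_C K \<Longrightarrow> \<rat> \<subseteq> K"
  by (auto elim!: Rats_cases' intro!: subfield_divide subring_of_int subfield_subring)

lemma subfield_Rats: "subfield_C \<rat>"
  by (auto simp: subfield_C_def)

subsection \<open>Division with remainder, minimal polynomials\<close>

text \<open>The usual cancellation of leading terms, carried out by hand to see that quotient and
  remainder keep their coefficients in \<open>K\<close>.\<close>

lemma poly_over_division:
  assumes K: "subfield_C K" and g: "poly_over K g" "g \<noteq> 0" and "poly_over K p"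
  shows "\<exists>q r. poly_over K q \<and> poly_over K r \<and> p = q * g + r \<and> (r = 0 \<or> degree r < degree g)"
  using assms(4)
proof (induction "degree p" arbitrary: p rule: less_induct)
  case less
  note R = subfield_subring[OF K]
  show ?case
  proof (cases "p = 0 \<or> degree p < degree g")
    case True
    then show ?thesis using less.prems poly_over_0[OF R]
      by (intro exI[of _ 0] exI[of _ p]) auto
  next
    case False
    define m where "m = monom (lead_coeff p / lead_coeff g) (degree p - degree g)"
    define p' where "p' = p - m * g"
    have m: "poly_over K m" unfolding m_def
      using less.prems g by (intro poly_over_monom R subfield_divide K) (auto simp: poly_over_def)
    have p': "poly_over K p'" unfolding p'_def
      by (intro poly_over_diff poly_over_mult R less.prems m g)
    have "degree (m * g) = degree p"
      using False g by (simp add: m_def degree_mult_eq degree_monom_eq)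
    moreover have "lead_coeff (m * g) = lead_coeff p"
      using g unfolding m_def lead_coeff_mult lead_coeff_monom by simp
    ultimately have "degree p' \<le> degree p" "coeff p' (degree p) = 0"
      by (auto simp: p'_def intro!: degree_diff_le)
    from eq_zero_or_degree_less[OF this] have "p' = 0 \<or> degree p' < degree p" .
    then show ?thesis
    proof
      assume "p' = 0"
      then show ?thesis using m poly_over_0[OF R] unfolding p'_def
        by (intro exI[of _ m] exI[of _ 0]) auto
    next
      assume "degree p' < degree p"
      from less.hyps[OF this p'] obtain q r where "poly_over K q" "poly_over K r"
        "p' = q * g + r" "r = 0 \<or> degree r < degree g" by blast
      then show ?thesis using m unfolding p'_def
        by (intro exI[of _ "q + m"] exI[of _ r]) (auto simp: algebra_simps intro!: poly_over_add R)
    qed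
  qed
qed

text \<open>A nonzero element of least degree generates, since remainders stay in the ideal. It is
  used for the polynomials vanishing at a point and for the combinations of two polynomials.\<close>

lemma poly_ideal_principal:
  assumes K: "subfield_C K" and I: "\<And>p. p \<in> I \<Longrightarrow> poly_over K p" "p0 \<in> I" "p0 \<noteq> 0"
    "\<And>p q. p \<in> I \<Longrightarrow> q \<in> I \<Longrightarrow> p - q \<in> I" "\<And>p q. p \<in> I \<Longrightarrow> poly_over K q \<Longrightarrow> q * p \<in> I"
  shows "\<exists>d\<in>I. d \<noteq> 0 \<and> (\<forall>p\<in>I. \<exists>q. poly_over K q \<and> p = q * d)"
proof -
  obtain d where d: "d \<in> I" "d \<noteq> 0" and min: "\<And>p. p \<in> I \<and> p \<noteq> 0 \<Longrightarrow> degree d \<le> degree p"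
    using ex_has_least_nat[of "\<lambda>p. p \<in> I \<and> p \<noteq> 0" p0 degree] I(2,3) by auto
  show ?thesis
  proof (intro bexI[OF _ d(1)] conjI d(2) ballI)
    fix p assume p: "p \<in> I"
    obtain q r where q: "poly_over K q" and pq: "p = q * d + r" and r: "r = 0 \<or> degree r < degree d"
      using poly_over_division[OF K I(1)[OF d(1)] d(2) I(1)[OF p]] by blast
    have "p - q * d \<in> I" using p q d I by blast
    then have "r = 0" using min[of r] r pq by force
    then show "\<exists>q. poly_over K q \<and> p = q * d" using q pq by auto
  qed
qed

lemma irreducible_over_degree_factor:
  assumes "irreducible_over K f" "poly_over K q" "poly_over K r" "f = q * r"
  shows "degree q = 0 \<or> degree r = 0"
  using assms unfolding irreducible_over_def by (metis One_nat_def Suc_leI neq0_conv)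

text \<open>The generator \<open>d\<close> of the ideal of polynomials vanishing at \<open>x\<close>
  is not constant and divides \<open>f\<close>, so irreducibility makes \<open>f\<close> a constant
  multiple of \<open>d\<close>.\<close>

lemma irreducible_over_dvd:
  assumes K: "subfield_C K" and f: "irreducible_over K f" "poly f x = 0"
    and h: "poly_over K h" "poly h x = 0"
  obtains q where "poly_over K q" "h = q * f"
proof -
  note R = subfield_subring[OF K]
  have fK: "poly_over K f" "f \<noteq> 0" using f by (auto simp: irreducible_over_def)
  have "\<exists>d\<in>{h. poly_over K h \<and> poly h x = 0}. d \<noteq> 0 \<and>
      (\<forall>p\<in>{h. poly_over K h \<and> poly h x = 0}. \<exists>q. poly_over K q \<and> p = q * d)"
    by (rule poly_ideal_principal[OF K, of _ f])
       (use fK f(2) in \<open>auto intro: poly_over_diff poly_over_mult R\<close>)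
  then obtain d where d: "d \<in> {h. poly_over K h \<and> poly h x = 0}" "d \<noteq> 0"
    and gen: "\<And>p. p \<in> {h. poly_over K h \<and> poly h x = 0} \<Longrightarrow> \<exists>q. poly_over K q \<and> p = q * d"
    by meson
  obtain q where q: "poly_over K q" "f = q * d" using gen[of f] fK f(2) by auto
  have "degree d \<ge> 1"
  proof (rule ccontr)
    assume "\<not> degree d \<ge> 1"
    then obtain c where "d = [:c:]" using degree_eq_zeroE[of d] by auto
    then show False using d by auto
  qed
  then have "degree q = 0" using irreducible_over_degree_factor[OF f(1) q(1) _ q(2)] d by auto
  then obtain c where c: "q = [:c:]" using degree_eq_zeroE by blast
  have c0: "c \<noteq> 0" using c q fK by auto
  have cK: "c \<in> K" using q(1) c unfolding poly_over_def by (metis coeff_pCons_0)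
  obtain r where r: "poly_over K r" "h = r * d" using gen[of h] h by auto
  show thesis
  proof
    show "poly_over K (smult (inverse c) r)" by (intro poly_over_smult R subfield_inverse K cK r)
    show "h = smult (inverse c) r * f" using r q c c0 by simp
  qed
qed

lemma irreducible_over_root_degree:
  assumes K: "subfield_C K" and f: "irreducible_over K f" "poly f x = 0"
    and h: "poly_over K h" "poly h x = 0" "degree h < degree f"
  shows "h = 0"
proof -
  obtain q where "h = q * f" using irreducible_over_dvd[OF K f h(1,2)] by blast
  then show ?thesis using h(3) by (cases "q = 0 \<or> f = 0") (auto simp: degree_mult_eq)
qed

lemma irreducible_over_exists:
  assumes K: "subfield_C K" and h: "poly_over K h" "h \<noteq> 0" "poly h x = 0"
  obtains f where "irreducible_over K f" "poly f x = 0"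
proof -
  note R = subfield_subring[OF K]
  obtain d where d: "poly_over K d \<and> d \<noteq> 0 \<and> poly d x = 0"
    and min: "\<And>p. poly_over K p \<and> p \<noteq> 0 \<and> poly p x = 0 \<Longrightarrow> degree d \<le> degree p"
    using ex_has_least_nat[of "\<lambda>p. poly_over K p \<and> p \<noteq> 0 \<and> poly p x = 0" h degree] h by auto
  have "degree d \<ge> 1"
  proof (rule ccontr)
    assume "\<not> degree d \<ge> 1"
    then obtain c where "d = [:c:]" using degree_eq_zeroE[of d] by auto
    then show False using d by auto
  qed
  moreover have False if "poly_over K q" "poly_over K r" "degree q \<ge> 1" "degree r \<ge> 1" "d = q * r" for q r
  proof -
    have nz: "q \<noteq> 0" "r \<noteq> 0" using that by auto
    have "poly q x = 0 \<or> poly r x = 0" using d that by auto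
    then have "degree d \<le> degree q \<or> degree d \<le> degree r" using min nz that by blast
    moreover have "degree d = degree q + degree r" using nz that degree_mult_eq by blast
    ultimately show False using that by linarith
  qed
  ultimately have "irreducible_over K d" using d unfolding irreducible_over_def by blast
  then show thesis using that d by blast
qed

lemma poly_over_gcd:
  assumes K: "subfield_C K" and p: "poly_over K p" and q: "poly_over K q" "q \<noteq> 0"
  shows "\<exists>d a b p' q'. (poly_over K d \<and> poly_over K a \<and> poly_over K b \<and> poly_over K p' \<and> poly_over K q') \<and>
    d = a * p + b * q \<and> p = p' * d \<and> q = q' * d"
proof -
  note R = subfield_subring[OF K]
  let ?I = "{a * p + b * q | a b. poly_over K a \<and> poly_over K b}"
  have q_in: "q \<in> ?I"
    by (rule CollectI, rule exI[of _ 0], rule exI[of _ 1]) (auto intro: poly_over_0 poly_over_1 R)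
  have p_in: "p \<in> ?I"
    by (rule CollectI, rule exI[of _ 1], rule exI[of _ 0]) (auto intro: poly_over_0 poly_over_1 R)
  have over: "poly_over K r" if "r \<in> ?I" for r
    using that p q by (auto intro!: poly_over_add poly_over_mult R)
  have "\<exists>d\<in>?I. d \<noteq> 0 \<and> (\<forall>p\<in>?I. \<exists>q. poly_over K q \<and> p = q * d)"
  proof (rule poly_ideal_principal[OF K over q_in q(2)])
    show "r - s \<in> ?I" if "r \<in> ?I" "s \<in> ?I" for r s
    proof -
      from that obtain a b a' b' where *: "poly_over K a" "poly_over K b" "poly_over K a'" "poly_over K b'"
        "r = a * p + b * q" "s = a' * p + b' * q" by blast
      then have "r - s = (a - a') * p + (b - b') * q" by (simp add: algebra_simps)
      then show ?thesis using * poly_over_diff[OF R] by blast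
    qed
    show "s * r \<in> ?I" if "r \<in> ?I" "poly_over K s" for r s
    proof -
      from that obtain a b where *: "poly_over K a" "poly_over K b" "r = a * p + b * q" by blast
      then have "s * r = (s * a) * p + (s * b) * q" by (simp add: algebra_simps)
      then show ?thesis using * that poly_over_mult[OF R] by blast
    qed
  qed
  then obtain d where d: "d \<in> ?I" "d \<noteq> 0"
    and gen: "\<And>p. p \<in> ?I \<Longrightarrow> \<exists>q. poly_over K q \<and> p = q * d" by meson
  from d(1) obtain a b where ab: "d = a * p + b * q" "poly_over K a" "poly_over K b" by blast
  show ?thesis using gen[OF p_in] gen[OF q_in] over[OF d(1)] ab by blast
qed

text \<open>If the gcd of \<open>h\<close> and \<open>f\<close> were not constant, it would be
  proportional to \<open>f\<close> and so vanish at \<open>x\<close>, forcing \<open>h\<close> to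
  vanish there too.\<close>

lemma irreducible_over_bezout:
  assumes K: "subfield_C K" and f: "irreducible_over K f" "poly f x = 0"
    and h: "poly_over K h" "poly h x \<noteq> 0"
  obtains a b where "poly_over K a" "poly_over K b" "a * h + b * f = 1"
proof -
  note R = subfield_subring[OF K]
  have fK: "poly_over K f" "f \<noteq> 0" using f by (auto simp: irreducible_over_def)
  obtain d a b r q where ab: "poly_over K a" "poly_over K b" "d = a * h + b * f"
    and d: "poly_over K d" "poly_over K q" "f = q * d" "h = r * d"
    using poly_over_gcd[OF K h(1) fK] by blast
  have "degree d = 0"
  proof (rule ccontr)
    assume "degree d \<noteq> 0"
    then have "degree q = 0" using irreducible_over_degree_factor[OF f(1) d(2,1,3)] by simp
    then obtain c where c: "q = [:c:]" using degree_eq_zeroE by blast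
    then have "poly d x = 0" using d f(2) fK by auto
    then show False using d h by auto
  qed
  then obtain c where c: "d = [:c:]" using degree_eq_zeroE by blast
  have c0: "c \<noteq> 0" using c d fK by auto
  have cK: "inverse c \<in> K" using d(1) c unfolding poly_over_def by (metis K subfield_inverse coeff_pCons_0)
  show thesis
  proof (rule that)
    show "poly_over K (smult (inverse c) a)" "poly_over K (smult (inverse c) b)"
      by (intro poly_over_smult R cK ab)+
    have "smult (inverse c) a * h + smult (inverse c) b * f = smult (inverse c) d"
      unfolding ab(3) by (simp add: smult_add_right)
    also have "\<dots> = 1" using c c0 by (simp add: one_pCons)
    finally show "smult (inverse c) a * h + smult (inverse c) b * f = 1" .
  qed
qed

text \<open>Characteristic zero: the derivative is nonzero and of smaller degree, so it cannot share
  a root with \<open>f\<close>.\<close>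

lemma irreducible_over_rsquarefree:
  assumes K: "subfield_C K" and f: "irreducible_over K f"
  shows "rsquarefree f"
  unfolding rsquarefree_roots
proof (intro allI notI)
  fix a assume a: "poly f a = 0 \<and> poly (pderiv f) a = 0"
  have d: "degree f \<ge> 1" "poly_over K f" using f by (auto simp: irreducible_over_def)
  then have "pderiv f = 0"
    using irreducible_over_root_degree[OF K f, of a "pderiv f"] a poly_over_pderiv[OF subfield_subring[OF K]]
    by (auto simp: degree_pderiv)
  then show False using d by (simp add: pderiv_eq_0_iff)
qed

subsection \<open>Simple extensions\<close>

text \<open>This is the ring \<open>K[x]\<close>; it coincides with the field \<open>K(x)\<close>
  once \<open>x\<close> is algebraic over \<open>K\<close>.\<close>

definition adjoin :: "complex set \<Rightarrow> complex \<Rightarrow> complex set" where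
  "adjoin K x = {poly h x | h. poly_over K h}"

lemma adjoin_memI: "poly_over K h \<Longrightarrow> poly h x \<in> adjoin K x"
  by (auto simp: adjoin_def)

lemma subset_adjoin: assumes "subfield_C K" shows "K \<subseteq> adjoin K x"
proof
  fix c assume "c \<in> K"
  then have "poly_over K [:c:]" by (intro poly_over_pCons poly_over_0 subfield_subring assms)
  from adjoin_memI[OF this, of x] show "c \<in> adjoin K x" by simp
qed

lemma generator_in_adjoin: assumes "subfield_C K" shows "x \<in> adjoin K x"
proof -
  note R = subfield_subring[OF assms]
  have "poly_over K [:0, 1:]" by (intro poly_over_pCons poly_over_0 subring_0 subring_1 R)
  from adjoin_memI[OF this, of x] show "x \<in> adjoin K x" by simp
qed

lemma adjoin_subset:
  assumes "subfield_C L" "K \<subseteq> L" "x \<in> L"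
  shows "adjoin K x \<subseteq> L"
  using poly_over_poly[OF subfield_subring[OF assms(1)] poly_over_mono[OF _ assms(2)] assms(3)]
  by (auto simp: adjoin_def)

lemma subfield_adjoin:
  assumes K: "subfield_C K" and f: "irreducible_over K f" "poly f x = 0"
  shows "subfield_C (adjoin K x)"
  unfolding subfield_C_def
proof (intro conjI ballI impI)
  note R = subfield_subring[OF K]
  show "0 \<in> adjoin K x" "1 \<in> adjoin K x"
    using subset_adjoin[OF K] subring_0[OF R] subring_1[OF R] by auto
  fix y assume "y \<in> adjoin K x"
  then obtain p where p: "poly_over K p" "y = poly p x" by (auto simp: adjoin_def)
  show "- y \<in> adjoin K x"
    using adjoin_memI[OF poly_over_diff[OF R poly_over_0[OF R] p(1)], of x] p(2) by simp
  { fix z assume "z \<in> adjoin K x"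
    then obtain q where q: "poly_over K q" "z = poly q x" by (auto simp: adjoin_def)
    show "y + z \<in> adjoin K x"
      using adjoin_memI[OF poly_over_add[OF R p(1) q(1)], of x] p(2) q(2) by simp
    show "y * z \<in> adjoin K x"
      using adjoin_memI[OF poly_over_mult[OF R p(1) q(1)], of x] p(2) q(2) by simp }
  assume "y \<noteq> 0"
  then obtain a b where ab: "poly_over K a" "a * p + b * f = 1"
    using irreducible_over_bezout[OF K f p(1)] p(2) by metis
  have "poly a x * y = 1" using arg_cong[OF ab(2), of "\<lambda>p. poly p x"] f(2) p(2) by simp
  then have "inverse y = poly a x" by (metis inverse_unique mult.commute)
  then show "inverse y \<in> adjoin K x" using adjoin_memI[OF ab(1)] by simp
qed

lemma adjoin_reduced:
  assumes K: "subfield_C K" and f: "irreducible_over K f" "poly f x = 0" and y: "y \<in> adjoin K x"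
  obtains h where "poly_over K h" "y = poly h x" "degree h < degree f"
proof -
  obtain p where p: "poly_over K p" "y = poly p x" using y by (auto simp: adjoin_def)
  have fK: "poly_over K f" "f \<noteq> 0" "degree f > 0" using f by (auto simp: irreducible_over_def)
  obtain q r where qr: "poly_over K r" "p = q * f + r" "r = 0 \<or> degree r < degree f"
    using poly_over_division[OF K fK(1,2) p(1)] by blast
  have "y = poly r x" using p qr f(2) by simp
  moreover have "degree r < degree f" using qr(3) fK(3) by auto
  ultimately show thesis using that[of r] qr(1) by blast
qed

text \<open>Replacing \<open>x\<close> by \<open>y\<close> in a representing polynomial is well
  defined: two representatives differ by a multiple of \<open>f\<close>, which vanishes at
  \<open>y\<close> as well.\<close>

lemma adjoin_hom:
  assumes K: "subfield_C K" and f: "irreducible_over K f" "poly f x = 0" "poly f y = 0"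
  obtains \<sigma> where "\<And>h. poly_over K h \<Longrightarrow> \<sigma> (poly h x) = poly h y"
    "\<And>a b. a \<in> adjoin K x \<Longrightarrow> b \<in> adjoin K x \<Longrightarrow> \<sigma> (a + b) = \<sigma> a + \<sigma> b"
    "\<And>a b. a \<in> adjoin K x \<Longrightarrow> b \<in> adjoin K x \<Longrightarrow> \<sigma> (a * b) = \<sigma> a * \<sigma> b"
    "\<And>a. a \<in> K \<Longrightarrow> \<sigma> a = a"
proof -
  note R = subfield_subring[OF K]
  define \<sigma> where "\<sigma> z = poly (SOME h. poly_over K h \<and> poly h x = z) y" for z
  have \<sigma>: "\<sigma> (poly h x) = poly h y" if h: "poly_over K h" for h
  proof -
    define g where "g = (SOME g. poly_over K g \<and> poly g x = poly h x)"
    have g: "poly_over K g \<and> poly g x = poly h x"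
      unfolding g_def by (rule someI[of _ h]) (use h in auto)
    then obtain q where "g - h = q * f"
      using irreducible_over_dvd[OF K f(1,2), of "g - h"] h poly_over_diff[OF R, of g h] by auto
    then have "poly g y = poly h y" using f(3) by (metis eq_iff_diff_eq_0 mult_zero_right poly_diff poly_mult)
    then show "\<sigma> (poly h x) = poly h y" by (simp add: \<sigma>_def g_def)
  qed
  show thesis
  proof (rule that)
    show "\<sigma> (poly h x) = poly h y" if "poly_over K h" for h by (rule \<sigma>[OF that])
    fix a assume "a \<in> K"
    then have "poly_over K [:a:]" by (intro poly_over_pCons poly_over_0 R)
    from \<sigma>[OF this] show "\<sigma> a = a" by simp
  next
    fix a b assume "a \<in> adjoin K x" "b \<in> adjoin K x"
    then obtain g h where gh: "poly_over K g" "a = poly g x" "poly_over K h" "b = poly h x"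
      by (auto simp: adjoin_def)
    show "\<sigma> (a + b) = \<sigma> a + \<sigma> b" using \<sigma>[OF poly_over_add[OF R gh(1,3)]] gh \<sigma> by simp
    show "\<sigma> (a * b) = \<sigma> a * \<sigma> b" using \<sigma>[OF poly_over_mult[OF R gh(1,3)]] gh \<sigma> by simp
  qed
qed

subsection \<open>Degrees of extensions\<close>

text \<open>Families instead of sets, so that powers, products and Gaussian periods can be indexed
  by numbers or pairs; \<open>ext_degreeI\<close> returns to the set-based
  \<open>basis_over\<close>.\<close>

definition lin_indep :: "complex set \<Rightarrow> 'i set \<Rightarrow> ('i \<Rightarrow> complex) \<Rightarrow> bool" where
  "lin_indep K I b \<longleftrightarrow> finite I \<and>
     (\<forall>c. (\<forall>i\<in>I. c i \<in> K) \<longrightarrow> (\<Sum>i\<in>I. c i * b i) = 0 \<longrightarrow> (\<forall>i\<in>I. c i = 0))"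

lemma lin_indepD:
  "lin_indep K I b \<Longrightarrow> (\<And>i. i \<in> I \<Longrightarrow> c i \<in> K) \<Longrightarrow> (\<Sum>i\<in>I. c i * b i) = 0 \<Longrightarrow> i \<in> I \<Longrightarrow> c i = 0"
  unfolding lin_indep_def by blast

lemma ext_degreeE:
  assumes "ext_degree K L n"
  obtains B where "lin_indep K B (\<lambda>x. x)" "card B = n" "B \<subseteq> L"
    "L = {(\<Sum>b\<in>B. c b * b) | c. \<forall>b\<in>B. c b \<in> K}"
  using assms unfolding ext_degree_def basis_over_def lin_indep_def by blast

lemma ext_degreeI:
  assumes K: "subfield_C K" and I: "lin_indep K I b" "card I = n"
    and L: "\<And>x. x \<in> L \<longleftrightarrow> (\<exists>c. (\<forall>i\<in>I. c i \<in> K) \<and> x = (\<Sum>i\<in>I. c i * b i))"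
  shows "ext_degree K L n"
proof -
  note R = subfield_subring[OF K]
  have fin: "finite I" using I by (simp add: lin_indep_def)
  have delta: "(\<Sum>i\<in>I. (if i = j then x else 0) * b i) = x * b j" if "j \<in> I" for x j
    using fin that by (simp add: if_distrib[of "\<lambda>x. x * _"] cong: if_cong)
  have inj: "inj_on b I"
  proof (rule inj_onI, rule ccontr)
    fix i j assume ij: "i \<in> I" "j \<in> I" "b i = b j" "i \<noteq> j"
    \<comment> \<open>Two equal members of the family would satisfy the relation with coefficients 1
      and -1.\<close>
    let ?c = "\<lambda>k. (if k = i then 1 else 0) + (if k = j then - 1 else 0 :: complex)"
    have "(\<Sum>k\<in>I. ?c k * b k) = 0"
      unfolding distrib_right sum.distrib delta[OF ij(1)] delta[OF ij(2)] using ij by simp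
    moreover have "?c k \<in> K" for k
      using subring_0[OF R] subring_1[OF R] subring_uminus[OF R] by simp
    ultimately have "?c i = 0" using lin_indepD[OF I(1), of ?c] ij by blast
    then show False using ij by simp
  qed
  have "b ` I \<subseteq> L"
  proof
    fix x assume "x \<in> b ` I"
    then obtain j where j: "j \<in> I" "x = b j" by blast
    then show "x \<in> L" unfolding L using delta[of j 1] subring_0[OF R] subring_1[OF R]
      by (intro exI[of _ "\<lambda>i. if i = j then 1 else 0"]) auto
  qed
  moreover have "c x = 0" if "\<forall>x\<in>b ` I. c x \<in> K" "(\<Sum>x\<in>b ` I. c x * x) = 0" "x \<in> b ` I" for c x
    using lin_indepD[OF I(1), of "c \<circ> b"] that by (auto simp: sum.reindex[OF inj])
  moreover have "L = {(\<Sum>x\<in>b ` I. c x * x) | c. \<forall>x\<in>b ` I. c x \<in> K}"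
  proof (intro Set.set_eqI iffI)
    fix x assume "x \<in> L"
    then obtain c where c: "\<forall>i\<in>I. c i \<in> K" "x = (\<Sum>i\<in>I. c i * b i)" using L by blast
    have "(\<Sum>y\<in>b ` I. c (inv_into I b y) * y) = x"
      unfolding sum.reindex[OF inj] c(2) by (intro sum.cong) (simp_all add: inv_into_f_f[OF inj])
    then show "x \<in> {(\<Sum>x\<in>b ` I. c x * x) | c. \<forall>x\<in>b ` I. c x \<in> K}"
      using c(1) inv_into_f_f[OF inj] by (intro CollectI exI[of _ "\<lambda>y. c (inv_into I b y)"]) auto
  next
    fix x assume "x \<in> {(\<Sum>x\<in>b ` I. c x * x) | c. \<forall>x\<in>b ` I. c x \<in> K}"
    then obtain c where "\<forall>x\<in>b ` I. c x \<in> K" "x = (\<Sum>x\<in>b ` I. c x * x)" by blast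
    then show "x \<in> L" unfolding L sum.reindex[OF inj]
      by (intro exI[of _ "c \<circ> b"]) auto
  qed
  ultimately have "basis_over K L (b ` I)" using fin by (auto simp: basis_over_def)
  moreover have "card (b ` I) = n" using card_image[OF inj] I(2) by simp
  ultimately show ?thesis unfolding ext_degree_def by blast
qed

text \<open>Gaussian elimination with unknowns indexed by \<open>I\<close> and equations by
  \<open>J\<close>: an equation with a nonzero coefficient is solved for one unknown, which is
  substituted into the others.\<close>

lemma homogeneous_system_nontrivial:
  assumes K: "subfield_C K" and "finite J" "finite I" "card J < card I"
    and "\<And>i j. i \<in> I \<Longrightarrow> j \<in> J \<Longrightarrow> a i j \<in> K"
  shows "\<exists>c. (\<forall>i\<in>I. c i \<in> K) \<and> (\<exists>i\<in>I. c i \<noteq> 0) \<and> (\<forall>j\<in>J. (\<Sum>i\<in>I. c i * a i j) = (0::complex))"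
  using assms(2-)
proof (induction J arbitrary: I a rule: finite_induct)
  case empty
  then have "I \<noteq> {}" by auto
  then show ?case using subring_1[OF subfield_subring[OF K]] by (intro exI[of _ "\<lambda>_. 1"]) auto
next
  case (insert j J)
  note R = subfield_subring[OF K]
  show ?case
  proof (cases "\<forall>i\<in>I. a i j = 0")
    case True
    have "card J < card I" using insert by simp
    with insert.IH[of I a] insert.prems
    obtain c where "\<forall>i\<in>I. c i \<in> K" "\<exists>i\<in>I. c i \<noteq> 0" "\<forall>j\<in>J. (\<Sum>i\<in>I. c i * a i j) = 0" by auto
    then show ?thesis using True by (intro exI[of _ c]) auto
  next
    case False
    then obtain i0 where i0: "i0 \<in> I" "a i0 j \<noteq> 0" by blast
    define I' where "I' = I - {i0}"
    \<comment> \<open>The system left after eliminating the unknown \<open>i0\<close> by means of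
      equation \<open>j\<close>.\<close>
    define a' where "a' i k = a i k - a i j / a i0 j * a i0 k" for i k
    have I': "finite I'" "card J < card I'" "I = insert i0 I'" "i0 \<notin> I'"
      using insert i0 by (auto simp: I'_def)
    have a'K: "a' i k \<in> K" if "i \<in> I'" "k \<in> J" for i k
      unfolding a'_def using that insert.prems(3) i0 I'
      by (intro subring_diff subring_mult subfield_divide R K) auto
    from insert.IH[of I' a', OF I'(1,2) a'K] obtain c where c: "\<forall>i\<in>I'. c i \<in> K" "\<exists>i\<in>I'. c i \<noteq> 0"
      "\<forall>k\<in>J. (\<Sum>i\<in>I'. c i * a' i k) = 0" by blast
    define s where "s = (\<Sum>i\<in>I'. c i * a i j)"
    define c' where "c' = c(i0 := - s / a i0 j)"
    have s: "s \<in> K" unfolding s_def using c(1) insert.prems(3) I' by (intro subring_sum subring_mult R) auto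
    have sum_eq: "(\<Sum>i\<in>I. c' i * a i k) = (\<Sum>i\<in>I'. c i * a i k) - s / a i0 j * a i0 k" for k
    proof -
      have "(\<Sum>i\<in>I'. c' i * a i k) = (\<Sum>i\<in>I'. c i * a i k)"
        using I'(4) by (intro sum.cong) (auto simp: c'_def)
      then show ?thesis unfolding I'(3) using I'(1,4) by (simp add: c'_def)
    qed
    have "(\<Sum>i\<in>I'. c i * a i k) - s / a i0 j * a i0 k = (\<Sum>i\<in>I'. c i * a' i k)" for k
      unfolding s_def a'_def sum_divide_distrib sum_distrib_right right_diff_distrib sum_subtractf
      by (simp add: mult.assoc)
    then have "(\<Sum>i\<in>I. c' i * a i k) = 0" if "k \<in> J" for k using sum_eq c(3) that by simp
    moreover have "(\<Sum>i\<in>I. c' i * a i j) = 0" unfolding sum_eq using i0 by (simp add: s_def)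
    moreover have "c' i \<in> K" if "i \<in> I" for i
      using that c(1) s insert.prems(3)[OF i0(1), of j] I'
      by (auto simp: c'_def intro!: subfield_divide subring_uminus R K)
    moreover have "\<exists>i\<in>I. c' i \<noteq> 0" using c(2) I' by (auto simp: c'_def)
    ultimately show ?thesis by (intro exI[of _ c']) auto
  qed
qed

text \<open>With more vectors than \<open>n\<close>, the coordinates in a basis give a homogeneous
  system with more unknowns than equations.\<close>

lemma lin_indep_card_le:
  assumes K: "subfield_C K" and I: "lin_indep K I b" "b ` I \<subseteq> L" and L: "ext_degree K L n"
  shows "card I \<le> n"
proof (rule ccontr)
  assume "\<not> card I \<le> n"
  obtain B where B: "lin_indep K B (\<lambda>x. x)" "card B = n" "B \<subseteq> L"
    "L = {(\<Sum>b\<in>B. c b * b) | c. \<forall>b\<in>B. c b \<in> K}"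
    using L by (rule ext_degreeE)
  have fin: "finite I" "finite B" using I B by (auto simp: lin_indep_def)
  have "\<exists>c. (\<forall>x\<in>B. c x \<in> K) \<and> b i = (\<Sum>x\<in>B. c x * x)" if "i \<in> I" for i
  proof -
    have "b i \<in> L" using I(2) that by blast
    then show ?thesis using B(4) by auto
  qed
  then obtain a where a: "\<And>i x. i \<in> I \<Longrightarrow> x \<in> B \<Longrightarrow> a i x \<in> K"
    "\<And>i. i \<in> I \<Longrightarrow> b i = (\<Sum>x\<in>B. a i x * x)" by metis
  obtain c where c: "\<forall>i\<in>I. c i \<in> K" "\<exists>i\<in>I. c i \<noteq> 0" "\<forall>j\<in>B. (\<Sum>i\<in>I. c i * a i j) = 0"
    using homogeneous_system_nontrivial[of K B I a, OF K fin(2,1) _ a(1)] B(2) \<open>\<not> card I \<le> n\<close> by auto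
  have "(\<Sum>i\<in>I. c i * b i) = (\<Sum>i\<in>I. \<Sum>x\<in>B. c i * a i x * x)"
    by (intro sum.cong) (auto simp: a(2) sum_distrib_left mult.assoc)
  also have "\<dots> = (\<Sum>x\<in>B. \<Sum>i\<in>I. c i * a i x * x)" by (rule sum.swap)
  also have "\<dots> = (\<Sum>x\<in>B. (\<Sum>i\<in>I. c i * a i x) * x)" by (simp add: sum_distrib_right)
  also have "\<dots> = 0" using c(3) by simp
  finally show False using lin_indepD[OF I(1), of c] c by blast
qed

lemma ext_degree_mono:
  assumes "subfield_C K" "ext_degree K E d" "ext_degree K L n" "E \<subseteq> L"
  shows "d \<le> n"
proof -
  obtain B where B: "lin_indep K B (\<lambda>x. x)" "card B = d" "B \<subseteq> E"
    using assms(2) by (rule ext_degreeE)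
  then show ?thesis using lin_indep_card_le[OF assms(1) B(1) _ assms(3)] assms(4) by auto
qed

lemma ext_degree_tower:
  assumes K: "subfield_C K" and KF: "ext_degree K F t" and FL: "ext_degree F L u"
  shows "ext_degree K L (u * t)"
proof -
  obtain B where B: "lin_indep K B (\<lambda>x. x)" "card B = t" "B \<subseteq> F"
    "F = {(\<Sum>b\<in>B. c b * b) | c. \<forall>b\<in>B. c b \<in> K}" using KF by (rule ext_degreeE)
  obtain C where C: "lin_indep F C (\<lambda>x. x)" "card C = u" "C \<subseteq> L"
    "L = {(\<Sum>b\<in>C. c b * b) | c. \<forall>b\<in>C. c b \<in> F}" using FL by (rule ext_degreeE)
  have fin: "finite B" "finite C" using B C by (auto simp: lin_indep_def)
  have sum_eq: "(\<Sum>i\<in>C\<times>B. c i * (fst i * snd i)) = (\<Sum>y\<in>C. (\<Sum>x\<in>B. c (y, x) * x) * y)" for c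
  proof -
    have "(\<Sum>y\<in>C. (\<Sum>x\<in>B. c (y, x) * x) * y) = (\<Sum>y\<in>C. \<Sum>x\<in>B. c (y, x) * (y * x))"
      unfolding sum_distrib_right by (simp add: mult_ac)
    then show ?thesis by (simp add: sum.cartesian_product case_prod_unfold)
  qed
  have inF: "(\<Sum>x\<in>B. c x * x) \<in> F" if "\<forall>x\<in>B. c x \<in> K" for c using that B(4) by blast
  have F_iff: "z \<in> F \<longleftrightarrow> (\<exists>c. (\<forall>x\<in>B. c x \<in> K) \<and> z = (\<Sum>x\<in>B. c x * x))" for z
    by (subst B(4)) blast
  show ?thesis
  proof (rule ext_degreeI[OF K])
    show "card (C \<times> B) = u * t" using B C by (simp add: card_cartesian_product)
    show "lin_indep K (C \<times> B) (\<lambda>i. fst i * snd i)"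
      unfolding lin_indep_def
    proof (intro conjI allI impI ballI)
      show "finite (C \<times> B)" using fin by simp
      fix c i assume c: "\<forall>i\<in>C\<times>B. c i \<in> K" "(\<Sum>i\<in>C\<times>B. c i * (fst i * snd i)) = 0" and i: "i \<in> C \<times> B"
      obtain y x where yx: "i = (y, x)" "y \<in> C" "x \<in> B" using i by auto
      have "(\<Sum>x\<in>B. c (y, x) * x) = 0"
      proof (rule lin_indepD[OF C(1), of "\<lambda>y. \<Sum>x\<in>B. c (y, x) * x", OF _ _ yx(2)])
        show "(\<Sum>x\<in>B. c (y', x) * x) \<in> F" if "y' \<in> C" for y' using that c(1) by (intro inF) auto
        show "(\<Sum>y\<in>C. (\<Sum>x\<in>B. c (y, x) * x) * y) = 0" using c(2) unfolding sum_eq .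
      qed
      moreover have "c (y, x') \<in> K" if "x' \<in> B" for x' using c(1) yx(2) that by auto
      ultimately show "c i = 0" unfolding yx(1)
        by (intro lin_indepD[OF B(1), of "\<lambda>x. c (y, x)", OF _ _ yx(3)])
    qed
    show "x \<in> L \<longleftrightarrow> (\<exists>c. (\<forall>i\<in>C\<times>B. c i \<in> K) \<and> x = (\<Sum>i\<in>C\<times>B. c i * (fst i * snd i)))" for x
    proof
      assume "x \<in> L"
      then obtain d where d: "\<forall>y\<in>C. d y \<in> F" "x = (\<Sum>y\<in>C. d y * y)" using C(4) by blast
      have "\<forall>y\<in>C. \<exists>c. (\<forall>x\<in>B. c x \<in> K) \<and> d y = (\<Sum>x\<in>B. c x * x)"
        using d(1) unfolding F_iff .
      from bchoice[OF this] obtain c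
        where c: "\<And>y. y \<in> C \<Longrightarrow> (\<forall>x\<in>B. c y x \<in> K) \<and> d y = (\<Sum>x\<in>B. c y x * x)" by blast
      have "x = (\<Sum>i\<in>C\<times>B. c (fst i) (snd i) * (fst i * snd i))"
        unfolding d(2) sum_eq[of "\<lambda>i. c (fst i) (snd i)"] using c by simp
      then show "\<exists>c. (\<forall>i\<in>C\<times>B. c i \<in> K) \<and> x = (\<Sum>i\<in>C\<times>B. c i * (fst i * snd i))"
        using c by (intro exI[of _ "\<lambda>i. c (fst i) (snd i)"]) auto
    next
      assume "\<exists>c. (\<forall>i\<in>C\<times>B. c i \<in> K) \<and> x = (\<Sum>i\<in>C\<times>B. c i * (fst i * snd i))"
      then obtain c where c: "\<forall>i\<in>C\<times>B. c i \<in> K" "x = (\<Sum>y\<in>C. (\<Sum>x\<in>B. c (y, x) * x) * y)"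
        unfolding sum_eq by blast
      then show "x \<in> L" unfolding C(4)
        by (intro CollectI exI[of _ "\<lambda>y. \<Sum>x\<in>B. c (y, x) * x"]) (auto intro!: inF)
    qed
  qed
qed

lemma poly_eq_sum_lessThan:
  "degree h < n \<Longrightarrow> poly h (x :: complex) = (\<Sum>i<n. coeff h i * x ^ i)"
  unfolding poly_altdef by (intro sum.mono_neutral_left) (auto simp: coeff_eq_0)

lemma lin_indep_powers:
  assumes K: "subfield_C K"
    and "\<And>h. poly_over K h \<Longrightarrow> poly h x = 0 \<Longrightarrow> degree h < n \<Longrightarrow> h = 0"
  shows "lin_indep K {..<n} (\<lambda>i. x ^ i)"
  unfolding lin_indep_def
proof (intro conjI allI impI ballI)
  fix c i assume c: "\<forall>i\<in>{..<n}. c i \<in> K" "(\<Sum>i<n. c i * x ^ i) = 0" and i: "i \<in> {..<n}"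
  define h where "h = (\<Sum>i<n. monom (c i) i)"
  have "coeff h j = (if j < n then c j else 0)" for j
    by (simp add: h_def coeff_sum)
  note coeff_h = this
  have "poly_over K h" unfolding h_def using c
    by (intro poly_over_sum poly_over_monom subfield_subring K) auto
  moreover have "degree h < n" using i coeff_h by (intro degree_lessI) auto
  moreover from this have "poly h x = 0" using poly_eq_sum_lessThan[of h n x] c coeff_h by simp
  ultimately have "h = 0" using assms(2) by blast
  then show "c i = 0" using coeff_h[of i] i by simp
qed simp

lemma ext_degree_adjoin:
  assumes K: "subfield_C K" and f: "irreducible_over K f" "poly f x = 0"
  shows "ext_degree K (adjoin K x) (degree f)"
proof (rule ext_degreeI[OF K])
  show "lin_indep K {..<degree f} (\<lambda>i. x ^ i)"
    by (rule lin_indep_powers[OF K]) (rule irreducible_over_root_degree[OF K f])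
  show "y \<in> adjoin K x \<longleftrightarrow> (\<exists>c. (\<forall>i\<in>{..<degree f}. c i \<in> K) \<and> y = (\<Sum>i<degree f. c i * x ^ i))" for y
  proof
    assume "y \<in> adjoin K x"
    from adjoin_reduced[OF K f this] obtain h
      where "poly_over K h" "y = poly h x" "degree h < degree f" .
    then show "\<exists>c. (\<forall>i\<in>{..<degree f}. c i \<in> K) \<and> y = (\<Sum>i<degree f. c i * x ^ i)"
      by (intro exI[of _ "coeff h"]) (simp add: poly_over_def poly_eq_sum_lessThan)
  next
    assume "\<exists>c. (\<forall>i\<in>{..<degree f}. c i \<in> K) \<and> y = (\<Sum>i<degree f. c i * x ^ i)"
    then obtain c where c: "\<forall>i\<in>{..<degree f}. c i \<in> K" "y = (\<Sum>i<degree f. c i * x ^ i)" by blast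
    then have "poly_over K (\<Sum>i<degree f. monom (c i) i)"
      by (intro poly_over_sum poly_over_monom subfield_subring K) auto
    from adjoin_memI[OF this, of x] show "y \<in> adjoin K x"
      by (simp add: c(2) poly_sum poly_monom)
  qed
qed simp

text \<open>The \<open>n + 1\<close> powers of \<open>x\<close> from exponent 0 to \<open>n\<close>
  are too many to be independent, so \<open>x\<close> is algebraic.\<close>

lemma irreducible_over_exists_ext_degree:
  assumes K: "subfield_C K" and L: "subfield_C L" "ext_degree K L n" and x: "x \<in> L"
  obtains f where "irreducible_over K f" "poly f x = 0"
proof -
  have "\<not> lin_indep K {..<Suc n} (\<lambda>i. x ^ i)"
    using lin_indep_card_le[OF K _ _ L(2), of "{..<Suc n}" "\<lambda>i. x ^ i"]
      subring_power[OF subfield_subring[OF L(1)] x] by auto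
  then obtain h where "poly_over K h" "poly h x = 0" "h \<noteq> 0"
    using lin_indep_powers[OF K, of x "Suc n"] by blast
  then show thesis using irreducible_over_exists[OF K] that by metis
qed

lemma irreducible_over_degree_le:
  assumes K: "subfield_C K" and L: "subfield_C L" "K \<subseteq> L" "ext_degree K L n"
    and f: "irreducible_over K f" "poly f x = 0" "x \<in> L"
  shows "degree f \<le> n"
  using ext_degree_mono[OF K ext_degree_adjoin[OF K f(1,2)] L(3) adjoin_subset[OF L(1,2) f(3)]] .

lemma number_field_ext:
  assumes "number_field K" "subfield_C L" "ext_degree K L n"
  shows "number_field L"
  using assms ext_degree_tower[OF subfield_Rats] unfolding number_field_def by blast

lemma lin_indep_spans:
  assumes K: "subfield_C K" and I: "lin_indep K I b" "b ` I \<subseteq> L" and L: "ext_degree K L n" "n \<le> card I"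
    and x: "x \<in> L"
  shows "\<exists>c. (\<forall>i\<in>I. c i \<in> K) \<and> x = (\<Sum>i\<in>I. c i * b i)"
proof (rule ccontr)
  assume not_span: "\<nexists>c. (\<forall>i\<in>I. c i \<in> K) \<and> x = (\<Sum>i\<in>I. c i * b i)"
  note R = subfield_subring[OF K]
  have fin: "finite I" using I by (simp add: lin_indep_def)
  \<comment> \<open>The extra index \<open>None\<close> carries \<open>x\<close>: outside the span,
    \<open>x\<close> would enlarge the family to more than \<open>n\<close> independent
    elements.\<close>
  let ?I = "insert None (Some ` I)"
  have "lin_indep K ?I (case_option x b)"
    unfolding lin_indep_def
  proof (intro conjI allI impI)
    fix c assume c: "\<forall>i\<in>?I. c i \<in> K" "(\<Sum>i\<in>?I. c i * case_option x b i) = 0"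
    have s: "c None * x + (\<Sum>i\<in>I. c (Some i) * b i) = 0"
      using c(2) fin by (simp add: sum.reindex)
    have cK: "c None \<in> K" "\<And>i. i \<in> I \<Longrightarrow> c (Some i) \<in> K" using c(1) by auto
    have c0: "c None = 0"
    proof (rule ccontr)
      assume nz: "c None \<noteq> 0"
      then have "x = - (\<Sum>i\<in>I. c (Some i) * b i) / c None" using s by (simp add: field_simps add_eq_0_iff)
      also have "\<dots> = (\<Sum>i\<in>I. (- c (Some i) / c None) * b i)"
        by (simp add: sum_divide_distrib sum_negf)
      finally have eq: "x = (\<Sum>i\<in>I. (- c (Some i) / c None) * b i)" .
      have inK: "- c (Some i) / c None \<in> K" if "i \<in> I" for i
        by (intro subfield_divide[OF K] subring_uminus[OF R] cK that)
      show False
        by (rule notE[OF not_span], rule exI[of _ "\<lambda>i. - c (Some i) / c None"]) (use inK eq in blast)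
    qed
    have "c (Some i) = 0" if "i \<in> I" for i
      using lin_indepD[OF I(1), of "\<lambda>i. c (Some i)", OF cK(2) _ that] s c0 by simp
    then show "\<forall>i\<in>?I. c i = 0" using c0 by auto
  qed (use fin in simp)
  moreover have "case_option x b ` ?I \<subseteq> L" using I(2) x by (auto simp: image_subset_iff)
  ultimately have "card ?I \<le> n" using lin_indep_card_le[OF K _ _ L(1)] by blast
  moreover have "card ?I = Suc (card I)" using fin by (simp add: card_image)
  ultimately show False using L(2) by simp
qed

lemma ext_degree_eq_imp_eq:
  assumes K: "subfield_C K" and M: "subfield_C M" "M \<subseteq> L" "ext_degree K M m" "ext_degree K L n" "n \<le> m"
    and KM: "K \<subseteq> M"
  shows "M = L"
proof -
  obtain B where B: "lin_indep K B (\<lambda>x. x)" "card B = m" "B \<subseteq> M" using M(3) by (rule ext_degreeE)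
  have "x \<in> M" if x: "x \<in> L" for x
  proof -
    have "\<exists>c. (\<forall>i\<in>B. c i \<in> K) \<and> x = (\<Sum>i\<in>B. c i * i)"
      by (rule lin_indep_spans[OF K B(1) _ M(4) _ x]) (use B M in auto)
    then obtain c where c: "\<forall>i\<in>B. c i \<in> K" "x = (\<Sum>i\<in>B. c i * i)" by blast
    show "x \<in> M" unfolding c(2)
      by (intro subring_sum subring_mult subfield_subring M(1)) (use c(1) KM B(3) in auto)
  qed
  then show ?thesis using M(2) by blast
qed

text \<open>Choose \<open>\<theta>\<close> of maximal degree over \<open>K\<close>. For every
  \<open>\<beta>\<close>, a suitable \<open>\<theta> + c * \<beta>\<close> generates a field
  containing both \<open>\<theta>\<close> and \<open>\<beta>\<close>; by maximality that field is no
  larger than \<open>K(\<theta>)\<close>.\<close>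

lemma primitive_element:
  assumes K: "subfield_C K" and L: "subfield_C L" "K \<subseteq> L" "ext_degree K L n"
  obtains \<theta> where "\<theta> \<in> L" "L = adjoin K \<theta>"
proof -
  let ?P = "\<lambda>m. \<exists>\<theta> f. \<theta> \<in> L \<and> irreducible_over K f \<and> poly f \<theta> = 0 \<and> degree f = m"
  obtain f0 where "irreducible_over K f0" "poly f0 0 = 0"
    using irreducible_over_exists_ext_degree[OF K L(1,3)] subring_0[OF subfield_subring[OF L(1)]] by blast
  then have "?P (degree f0)" using subring_0[OF subfield_subring[OF L(1)]] by blast
  moreover have "m \<le> n" if "?P m" for m using that irreducible_over_degree_le[OF K L] by blast
  ultimately obtain m where "?P m" and max: "\<And>k. ?P k \<Longrightarrow> k \<le> m"
    using Nat.ex_has_greatest_nat[of ?P "degree f0" n] by blast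
  then obtain \<theta> f where \<theta>: "\<theta> \<in> L" and f: "irreducible_over K f" "poly f \<theta> = 0" and m: "degree f = m" by blast
  note KR = subfield_subring[OF K] and LR = subfield_subring[OF L(1)]
  have "\<beta> \<in> adjoin K \<theta>" if \<beta>: "\<beta> \<in> L" for \<beta>
  proof -
    obtain g where g: "irreducible_over K g" "poly g \<beta> = 0"
      using irreducible_over_exists_ext_degree[OF K L(1,3) \<beta>] by blast
    have fg: "poly_over K f" "f \<noteq> 0" "poly_over K g" "g \<noteq> 0"
      using f g by (auto simp: irreducible_over_def)
    \<comment> \<open>The values of \<open>c\<close> for which
      \<open>\<theta> + c * \<beta> = a + c * b\<close> for roots \<open>a\<close> of
      \<open>f\<close> and \<open>b \<noteq> \<beta>\<close> of \<open>g\<close>. The pairs with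
      \<open>b = \<beta>\<close> contribute only 0, by division by zero, which is harmless.\<close>
    let ?bad = "(\<lambda>(a, b). (a - \<theta>) / (\<beta> - b)) ` ({a. poly f a = 0} \<times> {b. poly g b = 0})"
    have "finite ?bad" using poly_roots_finite fg by blast
    then have "finite (of_nat -` ?bad :: nat set)" by (intro finite_vimageI) (auto simp: inj_on_def)
    then obtain N :: nat where "N \<notin> of_nat -` ?bad" using ex_new_if_finite[OF infinite_UNIV_nat] by blast
    then have N: "of_nat N \<noteq> (a - \<theta>) / (\<beta> - b)" if "poly f a = 0" "poly g b = 0" for a b
      using that by auto
    define c where "c = (of_nat N :: complex)"
    define \<gamma> where "\<gamma> = \<theta> + c * \<beta>"
    have cK: "c \<in> K" unfolding c_def by (rule subring_of_nat[OF KR])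
    have \<gamma>: "\<gamma> \<in> L" unfolding \<gamma>_def using \<theta> \<beta> cK L(2) by (intro subring_add subring_mult LR) auto
    obtain h where h: "irreducible_over K h" "poly h \<gamma> = 0"
      using irreducible_over_exists_ext_degree[OF K L(1,3) \<gamma>] by blast
    define M where "M = adjoin K \<gamma>"
    have M: "subfield_C M" unfolding M_def by (rule subfield_adjoin[OF K h])
    have KM: "K \<subseteq> M" unfolding M_def by (rule subset_adjoin[OF K])
    have \<gamma>M: "\<gamma> \<in> M" unfolding M_def by (rule generator_in_adjoin[OF K])
    note MR = subfield_subring[OF M]
    \<comment> \<open>Both \<open>k\<close> and \<open>g\<close> vanish at \<open>\<beta>\<close>,
      and the choice of \<open>c\<close> leaves no other common root. As \<open>g\<close> has simple
      roots, their gcd over \<open>K(\<gamma>)\<close> is linear and reveals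
      \<open>\<beta>\<close>.\<close>
    define k where "k = pcompose f [:\<gamma>, - c:]"
    have "poly_over M [:\<gamma>, - c:]" using \<gamma>M cK KM
      by (intro poly_over_pCons poly_over_0 subring_uminus MR) auto
    then have kM: "poly_over M k" unfolding k_def
      by (intro poly_over_pcompose MR poly_over_mono[OF fg(1) KM])
    have "poly_over M g" by (rule poly_over_mono[OF fg(3) KM])
    from poly_over_gcd[OF M kM this fg(4)] obtain d a b p q
      where d: "poly_over M d" "d = a * k + b * g" "k = p * d" "g = q * d" by blast
    have d_root: "y = \<beta>" if "poly d y = 0" for y
    proof (rule ccontr)
      assume "y \<noteq> \<beta>"
      have "poly g y = 0" by (subst d(4)) (simp add: that)
      moreover have "poly k y = 0" by (subst d(3)) (simp add: that)
      moreover have "poly k y = poly f (\<gamma> - c * y)" by (simp add: k_def poly_pcompose algebra_simps)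
      ultimately have "c \<noteq> (\<gamma> - c * y - \<theta>) / (\<beta> - y)" using N unfolding c_def by metis
      then show False using \<open>y \<noteq> \<beta>\<close> by (simp add: \<gamma>_def field_simps)
    qed
    have "poly k \<beta> = 0" using f(2) by (simp add: k_def poly_pcompose \<gamma>_def algebra_simps)
    then have "poly d \<beta> = 0" using g(2) by (subst d(2)) simp
    then obtain e where e: "d = [:- \<beta>, 1:] * e" using poly_eq_0_iff_dvd by (metis dvdE)
    have "constant (poly e)"
    proof (rule ccontr)
      assume "\<not> constant (poly e)"
      then obtain z where z: "poly e z = 0" using fundamental_theorem_of_algebra by blast
      then have "z = \<beta>" using d_root[of z] e by simp
      then obtain e' where "e = [:- \<beta>, 1:] * e'" using z poly_eq_0_iff_dvd by (metis dvdE)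
      then have "g = [:- \<beta>, 1:] * ([:- \<beta>, 1:] * (e' * q))" using d(4) e by (metis mult.assoc mult.commute)
      then have "poly (pderiv g) \<beta> = 0"
        by (simp only: pderiv_mult poly_add poly_mult poly_pCons) simp
      then show False using irreducible_over_rsquarefree[OF K g(1)] g(2) by (auto simp: rsquarefree_roots)
    qed
    then obtain r where r: "e = [:r:]" using constant_degree degree_eq_zeroE by metis
    have "r \<noteq> 0" using r e d(4) fg by auto
    have "d = [:- \<beta> * r, r:]" by (simp add: e r)
    then have "- \<beta> * r = coeff d 0" "r = coeff d 1" by simp_all
    then have "- \<beta> * r \<in> M" "r \<in> M" using d(1) by (auto simp: poly_over_def)
    then have \<beta>M: "\<beta> \<in> M"
      using subfield_divide[OF M, of "- \<beta> * r" r] subring_uminus[OF MR, of "- \<beta>"] \<open>r \<noteq> 0\<close> by simp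
    have "\<theta> = \<gamma> - c * \<beta>" by (simp add: \<gamma>_def)
    then have "\<theta> \<in> M" using \<gamma>M \<beta>M cK KM by (auto intro!: subring_diff subring_mult MR)
    then have "adjoin K \<theta> \<subseteq> M" by (rule adjoin_subset[OF M KM])
    moreover have "degree h \<le> m" using max \<gamma> h by blast
    ultimately have "adjoin K \<theta> = M"
      using ext_degree_eq_imp_eq[OF K subfield_adjoin[OF K f] _ ext_degree_adjoin[OF K f] _ _ subset_adjoin[OF K]]
        ext_degree_adjoin[OF K h] m unfolding M_def by blast
    then show ?thesis using \<beta>M by simp
  qed
  then show thesis using that[OF \<theta>] adjoin_subset[OF L(1,2) \<theta>] by blast
qed

section \<open>Discrete valuations\<close>

text \<open>The value \<open>v 0\<close> is irrelevant; \<open>vge v k x\<close> encodes \<open>v x \<ge> k\<close> with \<open>v 0 = \<infinity>\<close>.\<close>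

definition vge :: "(complex \<Rightarrow> int) \<Rightarrow> int \<Rightarrow> complex \<Rightarrow> bool" where
  "vge v k x \<longleftrightarrow> x = 0 \<or> k \<le> v x"

lemma vge_0 [simp]: "vge v k 0" by (simp add: vge_def)

lemma vge_mono: "vge v k x \<Longrightarrow> l \<le> k \<Longrightarrow> vge v l x" by (auto simp: vge_def)

text \<open>Nothing is said about values outside \<open>F\<close>, and the trivial valuation is
  allowed; normalisation comes with \<open>padic_field\<close>. Stating the ultrametric inequality
  through \<open>vge\<close> covers sums that vanish.\<close>

locale discrete_val =
  fixes F :: "complex set" and v :: "complex \<Rightarrow> int"
  assumes F: "subfield_C F"
    and v_mult: "\<lbrakk>x \<in> F; y \<in> F; x \<noteq> 0; y \<noteq> 0\<rbrakk> \<Longrightarrow> v (x * y) = v x + v y"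
    and vge_add: "\<lbrakk>x \<in> F; y \<in> F; vge v k x; vge v k y\<rbrakk> \<Longrightarrow> vge v k (x + y)"
begin

lemmas R = subfield_subring[OF F]

lemma v_1: "v 1 = 0"
  using v_mult[of 1 1] subring_1[OF R] by simp

lemma v_uminus: "x \<in> F \<Longrightarrow> v (- x) = v x"
proof (cases "x = 0")
  case False
  assume x: "x \<in> F"
  have "- 1 \<in> F" using subring_1[OF R] subring_uminus[OF R] by blast
  then have "v (- 1) = 0" using v_mult[of "- 1" "- 1"] v_1 by simp
  then show ?thesis using v_mult[of "- 1" x] x \<open>- 1 \<in> F\<close> False by simp
qed simp

lemma vge_uminus: "x \<in> F \<Longrightarrow> vge v k x \<Longrightarrow> vge v k (- x)"
  by (simp add: vge_def v_uminus)

lemma vge_diff: "x \<in> F \<Longrightarrow> y \<in> F \<Longrightarrow> vge v k x \<Longrightarrow> vge v k y \<Longrightarrow> vge v k (x - y)"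
  using vge_add[of x "- y" k] vge_uminus subring_uminus[OF R] by simp

lemma vge_mult: "x \<in> F \<Longrightarrow> y \<in> F \<Longrightarrow> vge v k x \<Longrightarrow> vge v l y \<Longrightarrow> vge v (k + l) (x * y)"
  using v_mult[of x y] by (cases "x = 0 \<or> y = 0") (auto simp: vge_def)

lemma vge_sum:
  "(\<And>i. i \<in> I \<Longrightarrow> f i \<in> F) \<Longrightarrow> (\<And>i. i \<in> I \<Longrightarrow> vge v k (f i)) \<Longrightarrow> vge v k (sum f I)"
  by (induction I rule: infinite_finite_induct) (auto intro!: vge_add subring_sum R)

lemma v_power: "x \<in> F \<Longrightarrow> x \<noteq> 0 \<Longrightarrow> v (x ^ n) = int n * v x"
  by (induction n) (auto simp: v_1 v_mult subring_power[OF R] algebra_simps)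

lemma v_inverse: "x \<in> F \<Longrightarrow> x \<noteq> 0 \<Longrightarrow> v (inverse x) = - v x"
  using v_mult[of x "inverse x"] v_1 subfield_inverse[OF F, of x] by simp

lemma v_divide: "x \<in> F \<Longrightarrow> y \<in> F \<Longrightarrow> x \<noteq> 0 \<Longrightarrow> y \<noteq> 0 \<Longrightarrow> v (x / y) = v x - v y"
  unfolding divide_inverse using v_mult[of x "inverse y"] v_inverse[of y] subfield_inverse[OF F, of y] by simp

text \<open>If the sum had larger value than \<open>x\<close>, then so would
  \<open>x = (x + y) - y\<close>.\<close>

lemma v_add_dominant:
  assumes "x \<in> F" "y \<in> F" "x \<noteq> 0" "vge v (v x + 1) y"
  shows "x + y \<noteq> 0" "v (x + y) = v x"
proof -
  show nz: "x + y \<noteq> 0"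
  proof
    assume "x + y = 0"
    then have "y = - x" by (simp add: add_eq_0_iff)
    then show False using assms v_uminus[of x] by (simp add: vge_def)
  qed
  have "vge v (v x) (x + y)"
    using assms by (intro vge_add vge_mono[OF assms(4)]) (auto simp: vge_def)
  moreover have "\<not> vge v (v x + 1) (x + y)"
  proof
    assume "vge v (v x + 1) (x + y)"
    then have "vge v (v x + 1) (x + y - y)" using assms by (intro vge_diff subring_add R) auto
    then show False using assms(3) by (simp add: vge_def)
  qed
  ultimately show "v (x + y) = v x" using nz by (auto simp: vge_def)
qed

lemma vge_0_of_int: "vge v 0 (of_int n)"
proof -
  have nat: "vge v 0 (of_nat m)" for m
  proof (induction m)
    case (Suc m)
    then show ?case using vge_add[of 1 "of_nat m" 0] subring_of_nat[OF R] subring_1[OF R] v_1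
      by (simp add: vge_def)
  qed simp
  show ?thesis
  proof (cases n rule: int_cases2)
    case (nonpos m)
    then show ?thesis using vge_uminus[OF subring_of_nat[OF R] nat, of m] by simp
  qed (simp add: nat)
qed

lemma valuation_ring: "subring_C {x \<in> F. vge v 0 x}"
proof -
  have "vge v 0 1" by (simp add: vge_def v_1)
  then show ?thesis using vge_mult[of _ _ 0 0]
    by (auto simp: subring_C_def vge_add vge_uminus subring_closed[OF R])
qed

text \<open>Taking the first index of minimal weight is the device of Gauss's lemma: in a product of
  two polynomials, exactly one term at the sum of the two indices then has minimal weight.\<close>

lemma minimal_weight_exists:
  fixes n :: nat
  assumes a: "a \<noteq> 0"
  obtains i m where "coeff a i \<noteq> 0" "m = int n * v (coeff a i) + int i"
    "\<And>j. coeff a j \<noteq> 0 \<Longrightarrow> m \<le> int n * v (coeff a j) + int j"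
    "\<And>j. coeff a j \<noteq> 0 \<Longrightarrow> j < i \<Longrightarrow> m < int n * v (coeff a j) + int j"
proof -
  define w where "w j = int n * v (coeff a j) + int j" for j
  define S where "S = {j. coeff a j \<noteq> 0}"
  define m where "m = Min (w ` S)"
  have fin: "finite S" unfolding S_def using MOST_coeff_eq_0[of a] by (simp add: MOST_iff_cofinite)
  moreover have "S \<noteq> {}" using a leading_coeff_0_iff[of a] unfolding S_def by blast
  ultimately have "m \<in> w ` S" unfolding m_def by (intro Min_in) auto
  then have ex: "\<exists>j. j \<in> S \<and> w j = m" by auto
  define i where "i = (LEAST j. j \<in> S \<and> w j = m)"
  have i: "i \<in> S \<and> w i = m" unfolding i_def by (rule LeastI_ex[OF ex])
  have min: "m \<le> w j" if "j \<in> S" for j unfolding m_def using fin that by (intro Min_le) auto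
  have "m < w j" if "j \<in> S" "j < i" for j
    using not_less_Least[of j "\<lambda>j. j \<in> S \<and> w j = m"] that min[of j] unfolding i_def by force
  then show thesis using that[of i m] i min by (auto simp: S_def w_def)
qed

text \<open>Weighting \<open>X\<^sup>i\<close> by \<open>i\<close> and \<open>F\<close> by \<open>n v\<close>, the minimal weights of factors add up.
  In an Eisenstein polynomial the constant and the leading term both have minimal weight, hence so
  they do in each factor, which makes the degrees of the factors multiples of \<open>n\<close>.\<close>

theorem eisenstein:
  assumes g: "poly_over F g" "degree g = n" "n \<ge> 1" "v (lead_coeff g) = 0"
    and g0: "coeff g 0 \<noteq> 0" "v (coeff g 0) = 1" and gi: "\<And>i. i < n \<Longrightarrow> vge v 1 (coeff g i)"
  shows "irreducible_over F g"
  unfolding irreducible_over_def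
proof (intro conjI notI g)
  show "1 \<le> degree g" using g by simp
  assume "\<exists>a b. poly_over F a \<and> poly_over F b \<and> 1 \<le> degree a \<and> 1 \<le> degree b \<and> g = a * b"
  then obtain a b where ab: "poly_over F a" "poly_over F b" "1 \<le> degree a" "1 \<le> degree b" and gab: "g = a * b"
    by blast
  have nz: "a \<noteq> 0" "b \<noteq> 0" using ab by auto
  have deg: "n = degree a + degree b" using g(2) gab nz by (simp add: degree_mult_eq)
  have aF: "coeff a i \<in> F" and bF: "coeff b i \<in> F" for i using ab by (auto simp: poly_over_def)
  obtain i0 ma where i0: "coeff a i0 \<noteq> 0" "ma = int n * v (coeff a i0) + int i0"
    and mina: "\<And>j. coeff a j \<noteq> 0 \<Longrightarrow> ma \<le> int n * v (coeff a j) + int j"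
    and mina': "\<And>j. coeff a j \<noteq> 0 \<Longrightarrow> j < i0 \<Longrightarrow> ma < int n * v (coeff a j) + int j"
    using minimal_weight_exists[OF nz(1), of n] by blast
  obtain j0 mb where j0: "coeff b j0 \<noteq> 0" "mb = int n * v (coeff b j0) + int j0"
    and minb: "\<And>j. coeff b j \<noteq> 0 \<Longrightarrow> mb \<le> int n * v (coeff b j) + int j"
    and minb': "\<And>j. coeff b j \<noteq> 0 \<Longrightarrow> j < j0 \<Longrightarrow> mb < int n * v (coeff b j) + int j"
    using minimal_weight_exists[OF nz(2), of n] by blast
  define k where "k = i0 + j0"
  define x where "x = coeff a i0 * coeff b j0"
  define y where "y = (\<Sum>i\<in>{..k} - {i0}. coeff a i * coeff b (k - i))"
  have xF: "x \<in> F" unfolding x_def by (intro subring_mult R aF bF)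
  have x0: "x \<noteq> 0" using i0 j0 by (simp add: x_def)
  have vx: "v x = v (coeff a i0) + v (coeff b j0)" unfolding x_def by (intro v_mult aF bF i0 j0)
  have "coeff g k = x + y"
    unfolding gab coeff_mult x_def y_def by (subst sum.remove[of _ i0]) (auto simp: k_def)
  moreover have "y \<in> F" unfolding y_def by (intro subring_sum subring_mult R aF bF)
  moreover have "vge v (v x + 1) y"
    unfolding y_def
  proof (intro vge_sum subring_mult R aF bF)
    fix i assume i: "i \<in> {..k} - {i0}"
    show "vge v (v x + 1) (coeff a i * coeff b (k - i))"
    proof (cases "coeff a i = 0 \<or> coeff b (k - i) = 0")
      case False
      \<comment> \<open>Another pair with index sum \<open>k\<close> has one index before its first
        minimiser, so its weight is strictly larger. The index parts agree, hence the excess lies in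
        the valuation.\<close>
      have "i < i0 \<or> k - i < j0" using i by (auto simp: k_def)
      then have "ma + mb < int n * v (coeff a i) + int i + (int n * v (coeff b (k - i)) + int (k - i))"
        using mina[of i] minb[of "k - i"] mina'[of i] minb'[of "k - i"] False by force
      moreover have "int i + int (k - i) = int i0 + int j0" using i by (auto simp: k_def)
      ultimately have "int n * (v (coeff a i0) + v (coeff b j0)) < int n * (v (coeff a i) + v (coeff b (k - i)))"
        using i0(2) j0(2) by (simp add: algebra_simps)
      then have "v x < v (coeff a i) + v (coeff b (k - i))" unfolding vx
        by (metis mult_less_cancel_left_disj of_nat_0_le_iff not_less)
      then show ?thesis using False by (simp add: vge_def v_mult[OF aF bF])
    qed auto
  qed
  ultimately have gk: "coeff g k \<noteq> 0" "v (coeff g k) = v x" using v_add_dominant[OF xF _ x0] by auto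
  \<comment> \<open>All weights in \<open>g\<close> are at least \<open>n\<close>: below the top
    because the value is at least 1, at the top because the index is \<open>n\<close>.\<close>
  have "int n \<le> int n * v (coeff g k) + int k"
  proof (cases "k < n")
    case True
    then have "int n * 1 \<le> int n * v (coeff g k)" using gi[OF True] gk(1) by (intro mult_left_mono) (auto simp: vge_def)
    then show ?thesis by simp
  next
    case False
    then have "k = n" using gk(1) g(2) le_degree[of g k] by simp
    then show ?thesis using g by simp
  qed
  then have ge: "int n \<le> ma + mb" using i0(2) j0(2) gk(2) vx by (simp add: k_def algebra_simps)
  have "coeff g 0 = coeff a 0 * coeff b 0" by (simp add: gab coeff_mult)
  then have a0: "coeff a 0 \<noteq> 0" "coeff b 0 \<noteq> 0" and "v (coeff a 0) + v (coeff b 0) = 1"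
    using g0 v_mult[OF aF bF, of 0 0] by auto
  then have "int n * v (coeff a 0) + int n * v (coeff b 0) = int n" by (metis distrib_left mult.right_neutral)
  \<comment> \<open>The constant terms have total weight \<open>n\<close>, which is at most
    \<open>ma + mb\<close>, so each attains its minimum. The leading terms are treated in the same
    way.\<close>
  then have 1: "ma = int n * v (coeff a 0)" using mina[OF a0(1)] minb[OF a0(2)] ge by simp
  have "v (lead_coeff a) + v (lead_coeff b) = 0"
    using g(4) v_mult[OF aF bF, of "degree a" "degree b"] nz unfolding gab lead_coeff_mult by simp
  then have "int n * v (lead_coeff a) + int n * v (lead_coeff b) = 0" by (metis distrib_left mult_zero_right)
  then have 2: "ma = int n * v (lead_coeff a) + int (degree a)"
    using mina[of "degree a"] minb[of "degree b"] ge nz deg by simp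
  have "int (degree a) = int n * (v (coeff a 0) - v (lead_coeff a))" using 1 2 by (simp add: algebra_simps)
  then have "int n dvd int (degree a)" by (rule dvdI)
  then have "n dvd degree a" by simp
  then show False using deg ab(3,4) dvd_imp_le[of n "degree a"] by simp
qed

text \<open>Coefficients of \<open>h\<close> need not be integral; \<open>C\<close> absorbs their
  denominators.\<close>

lemma poly_bounded:
  assumes "poly_over F h"
  shows "\<exists>C. \<forall>x\<in>F. vge v 0 x \<longrightarrow> vge v (- C) (poly h x)"
  using assms
proof (induction h)
  case (pCons c h)
  then have cF: "c \<in> F" and hF: "poly_over F h"
    unfolding poly_over_def by (metis coeff_pCons_0, metis coeff_pCons_Suc)
  with pCons obtain C where C: "\<forall>x\<in>F. vge v 0 x \<longrightarrow> vge v (- C) (poly h x)" by blast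
  show ?case
  proof (intro exI[of _ "max C (- v c)"] ballI impI)
    fix x assume x: "x \<in> F" "vge v 0 x"
    have hx: "poly h x \<in> F" by (rule poly_over_poly[OF R hF x(1)])
    have "vge v (0 + (- C)) (x * poly h x)" using C x hx by (intro vge_mult) auto
    then have "vge v (- max C (- v c)) (x * poly h x)" by (rule vge_mono) simp
    moreover have "vge v (- max C (- v c)) c" by (auto simp: vge_def)
    ultimately show "vge v (- max C (- v c)) (poly (pCons c h) x)"
      using vge_add[OF cF subring_mult[OF R x(1) hx]] by simp
  qed
qed simp

lemma poly_lipschitz:
  assumes "poly_over F h"
  shows "\<exists>C. \<forall>x\<in>F. \<forall>y\<in>F. \<forall>k. vge v 0 x \<longrightarrow> vge v 0 y \<longrightarrow> vge v k (x - y) \<longrightarrow> vge v (k - C) (poly h x - poly h y)"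
  using assms
proof (induction h)
  case (pCons c h)
  then have hF: "poly_over F h"
    unfolding poly_over_def by (metis coeff_pCons_Suc)
  with pCons obtain C where C: "\<And>x y k. x \<in> F \<Longrightarrow> y \<in> F \<Longrightarrow> vge v 0 x \<Longrightarrow> vge v 0 y \<Longrightarrow> vge v k (x - y) \<Longrightarrow>
      vge v (k - C) (poly h x - poly h y)" by blast
  obtain B where B: "\<And>x. x \<in> F \<Longrightarrow> vge v 0 x \<Longrightarrow> vge v (- B) (poly h x)" using poly_bounded[OF hF] by blast
  show ?case
  proof (intro exI[of _ "max C B"] ballI allI impI)
    fix x y k assume xy: "x \<in> F" "y \<in> F" "vge v 0 x" "vge v 0 y" "vge v k (x - y)"
    have hx: "poly h z \<in> F" if "z \<in> F" for z by (rule poly_over_poly[OF R hF that])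
    have "vge v (k + - B) ((x - y) * poly h x)" using xy B by (intro vge_mult subring_diff R hx) auto
    then have 1: "vge v (k - max C B) ((x - y) * poly h x)" by (rule vge_mono) simp
    have "vge v (0 + (k - C)) (y * (poly h x - poly h y))" using xy C by (intro vge_mult subring_diff R hx) auto
    then have 2: "vge v (k - max C B) (y * (poly h x - poly h y))" by (rule vge_mono) simp
    \<comment> \<open>The discrete product rule
      \<open>x * h(x) - y * h(y) = (x - y) * h(x) + y * (h(x) - h(y))\<close>.\<close>
    have "vge v (k - max C B) ((x - y) * poly h x + y * (poly h x - poly h y))"
      using xy by (intro vge_add 1 2 subring_mult subring_diff R hx)
    then show "vge v (k - max C B) (poly (pCons c h) x - poly (pCons c h) y)" by (simp add: algebra_simps)
  qed
qed simp

end

section \<open>Newton iteration and extension of valuations along simple roots\<close>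

lemma poly_taylor2:
  assumes S: "subring_C S" and "poly_over S f" "x \<in> S" "h \<in> S"
  shows "\<exists>r\<in>S. poly f (x + h) = poly f x + h * poly (pderiv f) x + h\<^sup>2 * r"
  using assms(2)
proof (induction f)
  case 0
  then show ?case using subring_0[OF S] by (intro bexI[of _ 0]) auto
next
  case (pCons c f)
  then have fS: "poly_over S f"
    unfolding poly_over_def by (metis coeff_pCons_Suc)
  with pCons obtain r where r: "r \<in> S" "poly f (x + h) = poly f x + h * poly (pderiv f) x + h\<^sup>2 * r" by blast
  show ?case
  proof (intro bexI)
    show "poly (pCons c f) (x + h) = poly (pCons c f) x + h * poly (pderiv (pCons c f)) x
        + h\<^sup>2 * (poly (pderiv f) x + (x + h) * r)"
      unfolding poly_pCons poly_add pderiv_pCons r(2) by (simp add: power2_eq_square algebra_simps)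
    show "poly (pderiv f) x + (x + h) * r \<in> S"
      by (intro subring_add subring_mult poly_over_poly poly_over_pderiv S fS assms r)
  qed
qed

context discrete_val begin

text \<open>The correction \<open>- f(x) / f'(x)\<close> kills the linear Taylor part and leaves an
  error of value at least \<open>2 * k\<close>, of which only \<open>k + 1\<close> is recorded. It
  has positive value, so the derivative stays a unit.\<close>

lemma newton_step:
  assumes f: "poly_over {x \<in> F. vge v 0 x} f" and x: "x \<in> F" "vge v 0 x" and k: "k \<ge> 1" "vge v k (poly f x)"
    and d: "poly (pderiv f) x \<noteq> 0" "v (poly (pderiv f) x) = 0"
  obtains y where "y \<in> F" "vge v 0 y" "vge v k (y - x)" "vge v (k + 1) (poly f y)"
    "poly (pderiv f) y \<noteq> 0" "v (poly (pderiv f) y) = 0"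
proof -
  let ?O = "{x \<in> F. vge v 0 x}"
  note OR = valuation_ring
  have fx: "poly f x \<in> ?O" "poly (pderiv f) x \<in> ?O" "poly (pderiv f) x \<in> F"
    using poly_over_poly[OF OR f, of x] poly_over_poly[OF OR poly_over_pderiv[OF OR f], of x] x by auto
  define h where "h = - poly f x / poly (pderiv f) x"
  have hF: "h \<in> F" unfolding h_def using fx by (intro subfield_divide F subring_uminus R) auto
  have hk: "vge v k h"
  proof (cases "poly f x = 0")
    case False
    have "poly f x \<in> F" using fx by simp
    moreover have "v (- poly f x) = v (poly f x)" by (rule v_uminus) fact
    ultimately have "v h = v (poly f x)" unfolding h_def
      using fx(3) d False by (subst v_divide) (auto intro!: subring_uminus R)
    then show ?thesis using k(2) False by (simp add: vge_def)
  qed (simp add: h_def)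
  have hO: "h \<in> ?O" using hF vge_mono[OF hk, of 0] k by auto
  have y: "x + h \<in> ?O" using subring_add[OF OR _ hO, of x] x by auto
  obtain r where r: "r \<in> ?O" "poly f (x + h) = poly f x + h * poly (pderiv f) x + h\<^sup>2 * r"
    using poly_taylor2[OF OR f _ hO, of x] x by auto
  have "vge v (k + k + 0) (h * h * r)" using r hF by (intro vge_mult subring_mult R hk) auto
  then have "vge v (k + 1) (h * h * r)" by (rule vge_mono) (use k in simp)
  then have fy: "vge v (k + 1) (poly f (x + h))" unfolding r(2) using d by (simp add: h_def power2_eq_square)
  obtain s where s: "s \<in> ?O" "poly (pderiv f) (x + h) = poly (pderiv f) x + h * poly (pderiv (pderiv f)) x + h\<^sup>2 * s"
    using poly_taylor2[OF OR poly_over_pderiv[OF OR f] _ hO, of x] x by auto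
  define t where "t = poly (pderiv (pderiv f)) x + h * s"
  have t: "t \<in> ?O" unfolding t_def
    by (intro subring_add[OF OR] subring_mult[OF OR] poly_over_poly[OF OR] poly_over_pderiv[OF OR] f hO s(1))
       (use x in simp)
  have eq: "poly (pderiv f) (x + h) = poly (pderiv f) x + h * t"
    unfolding s(2) t_def by (simp add: power2_eq_square algebra_simps)
  have "vge v (k + 0) (h * t)" using t by (intro vge_mult hF hk) auto
  then have "vge v (v (poly (pderiv f) x) + 1) (h * t)" by (rule vge_mono) (use k d in simp)
  from v_add_dominant[OF fx(3) _ d(1) this] have "poly (pderiv f) (x + h) \<noteq> 0" "v (poly (pderiv f) (x + h)) = 0"
    using t hF d(2) subring_mult[OF R] by (auto simp: eq)
  then show thesis using that[of "x + h"] y hk fy by simp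
qed

lemma newton_sequence:
  assumes f: "poly_over {x \<in> F. vge v 0 x} f" and a: "a \<in> F" "vge v 0 a" "vge v 1 (poly f a)"
    and d: "poly (pderiv f) a \<noteq> 0" "v (poly (pderiv f) a) = 0"
  obtains X where "\<And>k. X k \<in> F" "\<And>k. vge v 0 (X k)" "\<And>k. vge v (int k + 1) (poly f (X k))"
    "\<And>k. vge v (int k + 1) (X (Suc k) - X k)" "X 0 = a"
proof -
  \<comment> \<open>The unit derivative is carried along to permit the next step, and the last
    conjunct pins the sequence to start at \<open>a\<close>.\<close>
  let ?P = "\<lambda>k x. x \<in> F \<and> vge v 0 x \<and> vge v (int k + 1) (poly f x) \<and> poly (pderiv f) x \<noteq> 0
    \<and> v (poly (pderiv f) x) = 0 \<and> (k = 0 \<longrightarrow> x = a)"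
  let ?Q = "\<lambda>k x y. vge v (int k + 1) (y - x)"
  have "\<exists>X. \<forall>k. ?P k (X k) \<and> ?Q k (X k) (X (Suc k))"
  proof (rule dependent_nat_choice)
    show "\<exists>x. ?P 0 x" using a d by auto
    fix x k assume P: "?P k x"
    then obtain y where "y \<in> F" "vge v 0 y" "vge v (int k + 1) (y - x)" "vge v (int k + 1 + 1) (poly f y)"
      "poly (pderiv f) y \<noteq> 0" "v (poly (pderiv f) y) = 0"
      using newton_step[OF f, of x "int k + 1"] by auto
    then show "\<exists>y. ?P (Suc k) y \<and> ?Q k x y" by (intro exI[of _ y]) (simp add: add_ac)
  qed
  then show thesis using that by blast
qed

lemma newton_sequence_cauchy:
  assumes X: "\<And>k. X k \<in> F" "\<And>k. vge v (int k + 1) (X (Suc k) - X k)" and "k \<le> l"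
  shows "vge v (int k + 1) (X l - X k)"
  using \<open>k \<le> l\<close>
proof (induction l rule: dec_induct)
  case (step l)
  have "vge v (int k + 1) (X (Suc l) - X l)" by (rule vge_mono[OF X(2)]) (use step in simp)
  then have "vge v (int k + 1) ((X (Suc l) - X l) + (X l - X k))"
    using step by (intro vge_add subring_diff R X(1))
  then show ?case by simp
qed simp

end

text \<open>The point \<open>\<alpha>\<close> is approximated by the \<open>v\<close>-adic Cauchy sequence \<open>X\<close> of approximate roots of its minimal
  polynomial, and the extended valuation of \<open>h(\<alpha>)\<close> is the eventual value of \<open>v (h (X k))\<close>.\<close>

locale newton_approx = discrete_val +
  fixes f :: "complex poly" and \<alpha> :: complex and X :: "nat \<Rightarrow> complex"
  assumes f: "irreducible_over F f" "poly f \<alpha> = 0"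
    and X: "\<And>k. X k \<in> F" "\<And>k. vge v 0 (X k)" "\<And>k. vge v (int k + 1) (poly f (X k))"
      "\<And>k. vge v (int k + 1) (X (Suc k) - X k)"
begin

definition eventually_val :: "complex poly \<Rightarrow> int \<Rightarrow> bool" where
  "eventually_val h c \<longleftrightarrow> (\<forall>\<^sub>F k in sequentially. poly h (X k) \<noteq> 0 \<and> v (poly h (X k)) = c)"

lemma poly_X_in: "poly_over F h \<Longrightarrow> poly h (X k) \<in> F"
  by (rule poly_over_poly[OF R _ X(1)])

lemma poly_root_small:
  assumes h: "poly_over F h" "poly h \<alpha> = 0"
  shows "\<exists>C. \<forall>k. vge v (int k - C) (poly h (X k))"
proof -
  obtain q where q: "poly_over F q" "h = q * f" using irreducible_over_dvd[OF F f h] by blast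
  have fF: "poly_over F f" using f by (simp add: irreducible_over_def)
  obtain C where C: "\<And>x. x \<in> F \<Longrightarrow> vge v 0 x \<Longrightarrow> vge v (- C) (poly q x)" using poly_bounded[OF q(1)] by blast
  have "vge v (int k - C) (poly h (X k))" for k
  proof -
    have "vge v (- C + (int k + 1)) (poly q (X k) * poly f (X k))"
      by (intro vge_mult poly_X_in q(1) fF C X)
    then show ?thesis unfolding q(2) poly_mult by (rule vge_mono) simp
  qed
  then show ?thesis by blast
qed

lemma poly_X_cauchy:
  assumes h: "poly_over F h"
  shows "\<exists>C. \<forall>k l. k \<le> l \<longrightarrow> vge v (int k - C) (poly h (X l) - poly h (X k))"
proof -
  obtain C where C: "\<forall>x\<in>F. \<forall>y\<in>F. \<forall>k. vge v 0 x \<longrightarrow> vge v 0 y \<longrightarrow> vge v k (x - y) \<longrightarrow>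
      vge v (k - C) (poly h x - poly h y)" using poly_lipschitz[OF h] by blast
  have "vge v (int k - C) (poly h (X l) - poly h (X k))" if "k \<le> l" for k l
  proof -
    have "vge v (int k + 1) (X l - X k)" by (rule newton_sequence_cauchy[of X, OF X(1,4) that])
    then have "vge v (int k + 1 - C) (poly h (X l) - poly h (X k))" using C X by blast
    then show ?thesis by (rule vge_mono) simp
  qed
  then show ?thesis by blast
qed

text \<open>In \<open>a * h + b * f = 1\<close> the second summand becomes small along
  \<open>X\<close>, so \<open>h (X k)\<close> cannot become small: its value is bounded above by
  \<open>D\<close>. Increments of larger value than \<open>D\<close> no longer change it.\<close>

lemma eventually_val_exists:
  assumes h: "poly_over F h" "poly h \<alpha> \<noteq> 0"
  shows "\<exists>c. eventually_val h c"
proof -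
  obtain a b where ab: "poly_over F a" "poly_over F b" "a * h + b * f = 1"
    using irreducible_over_bezout[OF F f h] by blast
  have fF: "poly_over F f" using f by (simp add: irreducible_over_def)
  have "poly (b * f) \<alpha> = 0" using f by simp
  then obtain C where C: "\<And>k. vge v (int k - C) (poly (b * f) (X k))"
    using poly_root_small[of "b * f"] poly_over_mult[OF R ab(2) fF] by blast
  obtain D where D: "\<And>x. x \<in> F \<Longrightarrow> vge v 0 x \<Longrightarrow> vge v (- D) (poly a x)" using poly_bounded[OF ab(1)] by blast
  obtain E where E: "\<And>k l. k \<le> l \<Longrightarrow> vge v (int k - E) (poly h (X l) - poly h (X k))"
    using poly_X_cauchy[OF h(1)] by blast
  \<comment> \<open>From \<open>C + 1\<close> on, \<open>b * f\<close> has positive value and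
    \<open>a * h\<close> is a unit; from \<open>E + D + 1\<close> on, increments of \<open>h\<close>
    have value above \<open>D\<close>.\<close>
  define K where "K = nat (max (C + 1) (E + D + 1))"
  have K: "int k \<ge> C + 1" "int k \<ge> E + D + 1" if "k \<ge> K" for k
    using that unfolding K_def by linarith+
  have small: "poly h (X k) \<noteq> 0 \<and> v (poly h (X k)) \<le> D" if "k \<ge> K" for k
  proof -
    have eq: "poly a (X k) * poly h (X k) = 1 + - poly (b * f) (X k)"
      using arg_cong[OF ab(3), of "\<lambda>p. poly p (X k)"] by (simp add: algebra_simps)
    have bf: "poly (b * f) (X k) \<in> F" by (intro poly_X_in poly_over_mult R ab fF)
    have "vge v (v 1 + 1) (- poly (b * f) (X k))"
      by (rule vge_mono[OF vge_uminus[OF bf C]]) (use K[OF that] v_1 in simp)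
    from v_add_dominant[OF subring_1[OF R] subring_uminus[OF R bf] _ this]
    have *: "poly a (X k) * poly h (X k) \<noteq> 0" "v (poly a (X k) * poly h (X k)) = 0"
      unfolding eq using v_1 by auto
    then have "v (poly a (X k)) + v (poly h (X k)) = 0"
      using v_mult[OF poly_X_in[OF ab(1)] poly_X_in[OF h(1)]] by auto
    moreover have "- D \<le> v (poly a (X k))" using D[OF X(1,2), of k] * by (simp add: vge_def)
    ultimately show ?thesis using * by auto
  qed
  have "poly h (X k) \<noteq> 0 \<and> v (poly h (X k)) = v (poly h (X K))" if "k \<ge> K" for k
  proof -
    have "vge v (v (poly h (X K)) + 1) (poly h (X k) - poly h (X K))"
      by (rule vge_mono[OF E[OF that]]) (use small[of K] K[of K] in simp)
    from v_add_dominant[OF poly_X_in[OF h(1)] _ _ this]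
    show ?thesis using small[of K] small[OF that] subring_diff[OF R poly_X_in[OF h(1)] poly_X_in[OF h(1)]] by simp
  qed
  then show ?thesis unfolding eventually_val_def eventually_sequentially by blast
qed

lemma eventually_val_unique:
  assumes "eventually_val h c" "eventually_val h d"
  shows "c = d"
proof -
  have "\<forall>\<^sub>F k in sequentially. c = d"
    using assms unfolding eventually_val_def by eventually_elim auto
  then show ?thesis by simp
qed

lemma eventually_val_cong:
  assumes g: "poly_over F g" and h: "poly_over F h" and eq: "poly g \<alpha> = poly h \<alpha>" and gc: "eventually_val g c"
  shows "eventually_val h c"
proof -
  obtain C where C: "\<And>k. vge v (int k - C) (poly (h - g) (X k))"
    using poly_root_small[OF poly_over_diff[OF R h g]] eq by auto
  have "\<forall>\<^sub>F k in sequentially. k \<ge> nat (C + c + 1)" by (rule eventually_ge_at_top)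
  with gc show ?thesis unfolding eventually_val_def
  proof eventually_elim
    case (elim k)
    have "vge v (v (poly g (X k)) + 1) (poly (h - g) (X k))"
      by (rule vge_mono[OF C]) (use elim in auto)
    from v_add_dominant[OF poly_X_in[OF g] poly_X_in[OF poly_over_diff[OF R h g]] _ this] elim
    show ?case by simp
  qed
qed

text \<open>The choice of the representing polynomial is immaterial by
  \<open>eventually_val_cong\<close>.\<close>

definition ext_val :: "complex \<Rightarrow> int" where
  "ext_val z = (SOME c. eventually_val (SOME h. poly_over F h \<and> poly h \<alpha> = z) c)"

lemma eventually_ext_val:
  assumes h: "poly_over F h" "poly h \<alpha> \<noteq> 0"
  shows "eventually_val h (ext_val (poly h \<alpha>))"
proof -
  define g where "g = (SOME g. poly_over F g \<and> poly g \<alpha> = poly h \<alpha>)"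
  have g: "poly_over F g \<and> poly g \<alpha> = poly h \<alpha>"
    unfolding g_def by (rule someI[of _ h]) (use h in auto)
  then have "\<exists>c. eventually_val g c" using eventually_val_exists[of g] h by auto
  then have "eventually_val g (ext_val (poly h \<alpha>))" unfolding ext_val_def g_def[symmetric] by (rule someI_ex)
  then show ?thesis using eventually_val_cong g h(1) by blast
qed

lemma vge_ext_val_iff:
  assumes h: "poly_over F h"
  shows "vge ext_val k (poly h \<alpha>) \<longleftrightarrow> poly h \<alpha> = 0 \<or> (\<forall>\<^sub>F n in sequentially. vge v k (poly h (X n)))"
proof (cases "poly h \<alpha> = 0")
  case False
  from eventually_ext_val[OF h this]
  have ev: "\<forall>\<^sub>F n in sequentially. vge v k (poly h (X n)) \<longleftrightarrow> k \<le> ext_val (poly h \<alpha>)"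
    unfolding eventually_val_def by eventually_elim (auto simp: vge_def)
  then have "(\<forall>\<^sub>F n in sequentially. vge v k (poly h (X n))) \<longleftrightarrow> (\<forall>\<^sub>F n in sequentially. k \<le> ext_val (poly h \<alpha>))"
    by (rule eventually_subst)
  then show ?thesis using False by (simp add: vge_def)
qed simp

lemma adjoin_vgeE:
  assumes "z \<in> adjoin F \<alpha>" "vge ext_val k z"
  obtains h where "poly_over F h" "poly h \<alpha> = z" "\<forall>\<^sub>F n in sequentially. vge v k (poly h (X n))"
proof (cases "z = 0")
  case True
  then show ?thesis using that[of 0] poly_over_0[OF R] by simp
next
  case False
  obtain h where "poly_over F h" "z = poly h \<alpha>" using assms(1) by (auto simp: adjoin_def)
  then show ?thesis using vge_ext_val_iff[of h k] assms(2) False that by blast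
qed

lemma discrete_val_ext_val: "discrete_val (adjoin F \<alpha>) ext_val"
proof
  show "subfield_C (adjoin F \<alpha>)" by (rule subfield_adjoin[OF F f])
  fix x y assume xy: "x \<in> adjoin F \<alpha>" "y \<in> adjoin F \<alpha>"
  show "ext_val (x * y) = ext_val x + ext_val y" if nz: "x \<noteq> 0" "y \<noteq> 0"
  proof -
    obtain g h where gh: "poly_over F g" "x = poly g \<alpha>" "poly_over F h" "y = poly h \<alpha>"
      using xy by (auto simp: adjoin_def)
    have "eventually_val g (ext_val x)" "eventually_val h (ext_val y)"
      using eventually_ext_val gh nz by auto
    then have "eventually_val (g * h) (ext_val x + ext_val y)"
      unfolding eventually_val_def
      by eventually_elim (simp add: v_mult[OF poly_X_in[OF gh(1)] poly_X_in[OF gh(3)]])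
    moreover have "eventually_val (g * h) (ext_val (x * y))"
      using eventually_ext_val[OF poly_over_mult[OF R gh(1,3)]] gh nz by simp
    ultimately show ?thesis using eventually_val_unique by blast
  qed
  fix k assume "vge ext_val k x" "vge ext_val k y"
  then obtain g h where g: "poly_over F g" "poly g \<alpha> = x" "\<forall>\<^sub>F n in sequentially. vge v k (poly g (X n))"
    and h: "poly_over F h" "poly h \<alpha> = y" "\<forall>\<^sub>F n in sequentially. vge v k (poly h (X n))"
    using adjoin_vgeE xy by metis
  have "\<forall>\<^sub>F n in sequentially. vge v k (poly (g + h) (X n))"
    using g(3) h(3) by eventually_elim (simp add: vge_add[OF poly_X_in[OF g(1)] poly_X_in[OF h(1)]])
  then show "vge ext_val k (x + y)"
    using vge_ext_val_iff[OF poly_over_add[OF R g(1) h(1)], of k] g(2) h(2) by simp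
qed

lemma const_poly: "x \<in> F \<Longrightarrow> poly_over F [:x:]"
  by (intro poly_over_pCons poly_over_0 R)

lemma ext_val_eq: "x \<in> F \<Longrightarrow> x \<noteq> 0 \<Longrightarrow> ext_val x = v x"
  using eventually_ext_val[OF const_poly, of x] by (simp add: eventually_val_def)

lemma ext_val_approx: "vge ext_val 1 (\<alpha> - X 0)"
proof -
  have h: "poly_over F [:- X 0, 1:]"
    by (intro poly_over_pCons poly_over_0 subring_uminus subring_1 R X)
  have "vge v 1 (X n - X 0)" for n using newton_sequence_cauchy[of X 0 n, OF X(1,4)] by simp
  then show ?thesis using vge_ext_val_iff[OF h, of 1] by simp
qed

text \<open>The residue field does not grow: \<open>y = h(\<alpha>)\<close> is approximated by a
  late value \<open>h (X M)\<close>, which lies in \<open>F\<close>.\<close>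

lemma ext_val_residue:
  assumes y: "y \<in> adjoin F \<alpha>" "vge ext_val 0 y"
  shows "\<exists>x\<in>F. vge v 0 x \<and> vge ext_val 1 (y - x)"
proof -
  obtain h where h: "poly_over F h" "poly h \<alpha> = y" "\<forall>\<^sub>F n in sequentially. vge v 0 (poly h (X n))"
    using y by (rule adjoin_vgeE)
  obtain C where C: "\<And>k l. k \<le> l \<Longrightarrow> vge v (int k - C) (poly h (X l) - poly h (X k))"
    using poly_X_cauchy[OF h(1)] by blast
  obtain N where N: "\<And>n. n \<ge> N \<Longrightarrow> vge v 0 (poly h (X n))" using h(3) by (auto simp: eventually_sequentially)
  \<comment> \<open>\<open>N\<close> makes \<open>h (X M)\<close> integral; \<open>C + 1\<close>
    makes all later values agree with it up to positive value.\<close>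
  define M where "M = max N (nat (C + 1))"
  define x where "x = poly h (X M)"
  have xF: "x \<in> F" unfolding x_def by (rule poly_X_in[OF h(1)])
  have "vge v 1 (poly (h - [:x:]) (X n))" if "n \<ge> M" for n
    using vge_mono[OF C[OF that], of 1] by (simp add: x_def M_def)
  then have "\<forall>\<^sub>F n in sequentially. vge v 1 (poly (h - [:x:]) (X n))" unfolding eventually_sequentially by blast
  then have "vge ext_val 1 (y - x)"
    using vge_ext_val_iff[OF poly_over_diff[OF R h(1) const_poly[OF xF]], of 1] h(2) by simp
  moreover have "vge v 0 x" unfolding x_def by (rule N) (simp add: M_def)
  ultimately show ?thesis using xF by blast
qed

end

text \<open>A simple root modulo the place provides an unramified extension of \<open>v\<close> with
  the same residue field, under which \<open>\<alpha>\<close> reduces to that root.\<close>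

theorem (in discrete_val) hensel_extension:
  assumes f: "irreducible_over F f" "poly f \<alpha> = 0" "\<And>i. vge v 0 (coeff f i)"
    and a: "a \<in> F" "vge v 0 a" "vge v 1 (poly f a)" "poly (pderiv f) a \<noteq> 0" "v (poly (pderiv f) a) = 0"
  obtains w where "discrete_val (adjoin F \<alpha>) w" "\<And>x. x \<in> F \<Longrightarrow> x \<noteq> 0 \<Longrightarrow> w x = v x" "vge w 1 (\<alpha> - a)"
    "\<And>y. y \<in> adjoin F \<alpha> \<Longrightarrow> vge w 0 y \<Longrightarrow> \<exists>x\<in>F. vge v 0 x \<and> vge w 1 (y - x)"
proof -
  have "poly_over {x \<in> F. vge v 0 x} f" using f by (simp add: poly_over_def irreducible_over_def)
  from newton_sequence[OF this a] obtain X where Xs: "\<And>k. X k \<in> F" "\<And>k. vge v 0 (X k)"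
    "\<And>k. vge v (int k + 1) (poly f (X k))" "\<And>k. vge v (int k + 1) (X (Suc k) - X k)" "X 0 = a" by blast
  interpret newton_approx F v f \<alpha> X by unfold_locales (use f Xs in auto)
  show thesis
    using that[OF discrete_val_ext_val ext_val_eq _ ext_val_residue] ext_val_approx Xs(5) by simp
qed

section \<open>Places of degree one\<close>

text \<open>An unramified place over \<open>p\<close> of residue degree one: \<open>p\<close> is a
  uniformizer and the integers exhaust the residue field.\<close>

definition padic_field :: "complex set \<Rightarrow> nat \<Rightarrow> (complex \<Rightarrow> int) \<Rightarrow> bool" where
  "padic_field F p v \<longleftrightarrow> discrete_val F v \<and> prime p \<and> v (of_nat p) = 1 \<and>
     (\<forall>y\<in>F. vge v 0 y \<longrightarrow> (\<exists>n::int. vge v 1 (y - of_int n)))"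

lemma padic_field_subset:
  assumes "padic_field L p v" "subfield_C K" "K \<subseteq> L"
  shows "padic_field K p v"
  using assms unfolding padic_field_def discrete_val_def by (meson subsetD)

lemma padic_vge_1_of_int_iff:
  assumes "padic_field F p v"
  shows "vge v 1 (of_int m) \<longleftrightarrow> int p dvd m"
proof -
  interpret discrete_val F v using assms by (simp add: padic_field_def)
  have p: "prime p" "v (of_nat p) = 1" using assms by (auto simp: padic_field_def)
  have vp: "vge v 1 (of_nat p)" using p by (simp add: vge_def)
  note Rint = subring_of_int[OF R] and Rnat = subring_of_nat[OF R]
  show ?thesis
  proof
    assume "int p dvd m"
    then obtain k where k: "m = int p * k" by blast
    have "vge v (1 + 0) (of_nat p * of_int k)"
      by (intro vge_mult Rint Rnat vp vge_0_of_int)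
    then show "vge v 1 (of_int m)" using k by simp
  next
    assume m: "vge v 1 (of_int m)"
    show "int p dvd m"
    proof (rule ccontr)
      assume "\<not> int p dvd m"
      then have "coprime (int p) m" using p(1) by (simp add: prime_imp_coprime)
      then obtain a b where ab: "a * int p + b * m = 1"
        by (metis bezout_int coprime_iff_gcd_eq_1 mult.commute)
      have "vge v (0 + 1) (of_int a * of_nat p)" "vge v (0 + 1) (of_int b * of_int m)"
        by (intro vge_mult Rint Rnat vp vge_0_of_int m)+
      then have "vge v 1 (of_int a * of_nat p + of_int b * of_int m)"
        by (intro vge_add subring_mult R Rint Rnat) auto
      moreover have "of_int a * of_nat p + of_int b * of_int m = (1::complex)"
        using arg_cong[OF ab, of "of_int :: int \<Rightarrow> complex"] by simp
      ultimately show False using v_1 by (simp add: vge_def)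
    qed
  qed
qed

lemma padic_v_of_int:
  assumes "padic_field F p v" "\<not> int p dvd m"
  shows "v (of_int m) = 0"
proof -
  interpret discrete_val F v using assms by (simp add: padic_field_def)
  show ?thesis using padic_vge_1_of_int_iff[OF assms(1), of m] vge_0_of_int[of m] assms(2)
    by (auto simp: vge_def)
qed

lemma padic_hensel_extension:
  assumes v: "padic_field F p v"
    and f: "irreducible_over F f" "poly f \<alpha> = 0" "\<And>i. vge v 0 (coeff f i)"
    and a: "a \<in> F" "vge v 0 a" "vge v 1 (poly f a)" "poly (pderiv f) a \<noteq> 0" "v (poly (pderiv f) a) = 0"
  obtains w where "padic_field (adjoin F \<alpha>) p w" "\<And>x. x \<in> F \<Longrightarrow> x \<noteq> 0 \<Longrightarrow> w x = v x" "vge w 1 (\<alpha> - a)"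
proof -
  interpret discrete_val F v using v by (simp add: padic_field_def)
  obtain w where w: "discrete_val (adjoin F \<alpha>) w" "\<And>x. x \<in> F \<Longrightarrow> x \<noteq> 0 \<Longrightarrow> w x = v x" "vge w 1 (\<alpha> - a)"
    and res: "\<And>y. y \<in> adjoin F \<alpha> \<Longrightarrow> vge w 0 y \<Longrightarrow> \<exists>x\<in>F. vge v 0 x \<and> vge w 1 (y - x)"
    using hensel_extension[OF f a] by blast
  interpret W: discrete_val "adjoin F \<alpha>" w by (rule w)
  have sub: "F \<subseteq> adjoin F \<alpha>" by (rule subset_adjoin[OF F])
  have "\<exists>n::int. vge w 1 (y - of_int n)" if y: "y \<in> adjoin F \<alpha>" "vge w 0 y" for y
  proof -
    obtain x where x: "x \<in> F" "vge v 0 x" "vge w 1 (y - x)" using res[OF y] by blast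
    obtain n :: int where n: "vge v 1 (x - of_int n)" using v x by (auto simp: padic_field_def)
    have xn: "x - of_int n \<in> F" using x subring_of_int[OF R] subring_diff[OF R] by blast
    have "vge w 1 (x - of_int n)" using n w(2)[OF xn] unfolding vge_def by metis
    moreover have "y - x \<in> adjoin F \<alpha>" using subring_diff[OF W.R y(1)] sub x(1) by blast
    ultimately have "vge w 1 ((y - x) + (x - of_int n))"
      using W.vge_add x(3) xn sub by blast
    then show ?thesis by auto
  qed
  moreover have "w (of_nat p) = 1"
    using v w(2)[OF subring_of_nat[OF R], of p] by (auto simp: padic_field_def prime_gt_0_nat)
  ultimately have "padic_field (adjoin F \<alpha>) p w" using v w(1) by (simp add: padic_field_def)
  then show thesis using that w by blast
qed

subsection \<open>The \<open>p\<close>-adic valuation of the rationals\<close>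

text \<open>All fractions representing \<open>x\<close> give the same difference, by
  cross-multiplication (\<open>rat_val_eq\<close>).\<close>

definition rat_val :: "nat \<Rightarrow> complex \<Rightarrow> int" where
  "rat_val p x = (SOME k. \<exists>a b. a \<noteq> 0 \<and> b \<noteq> 0 \<and> x = of_int a / of_int b \<and>
     k = int (multiplicity (int p) a) - int (multiplicity (int p) b))"

context
  fixes p :: nat assumes p: "prime p"
begin

lemma mult_mult: "a \<noteq> 0 \<Longrightarrow> b \<noteq> 0 \<Longrightarrow>
    multiplicity (int p) (a * b) = multiplicity (int p) a + multiplicity (int p) b"
  using p by (intro prime_elem_multiplicity_mult_distrib) auto

lemma rat_val_eq:
  assumes "a \<noteq> 0" "b \<noteq> 0"
  shows "rat_val p (of_int a / of_int b) = int (multiplicity (int p) a) - int (multiplicity (int p) b)"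
  unfolding rat_val_def
proof (rule someI2_ex)
  fix k assume "\<exists>a' b'. a' \<noteq> 0 \<and> b' \<noteq> 0 \<and> (of_int a / of_int b :: complex) = of_int a' / of_int b' \<and>
    k = int (multiplicity (int p) a') - int (multiplicity (int p) b')"
  then obtain a' b' where *: "a' \<noteq> 0" "b' \<noteq> 0" "(of_int a / of_int b :: complex) = of_int a' / of_int b'"
    "k = int (multiplicity (int p) a') - int (multiplicity (int p) b')" by blast
  then have "(of_int (a * b') :: complex) = of_int (a' * b)" using assms by (simp add: field_simps)
  then have "a * b' = a' * b" using of_int_eq_iff by blast
  then have "multiplicity (int p) (a * b') = multiplicity (int p) (a' * b)" by simp
  then show "k = int (multiplicity (int p) a) - int (multiplicity (int p) b)"
    using * assms by (simp add: mult_mult)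
qed (use assms in blast)

lemma vge_rat_val_iff:
  assumes "d \<noteq> 0"
  shows "vge (rat_val p) k (of_int a / of_int d) \<longleftrightarrow> int p ^ nat (k + int (multiplicity (int p) d)) dvd a"
proof (cases "a = 0")
  case False
  have "int p ^ nat (k + int (multiplicity (int p) d)) dvd a \<longleftrightarrow>
      nat (k + int (multiplicity (int p) d)) \<le> multiplicity (int p) a"
    using p False not_prime_unit[of "int p"] by (intro power_dvd_iff_le_multiplicity) auto
  then show ?thesis using False assms rat_val_eq[OF False assms] by (auto simp: vge_def)
qed simp

lemma padic_field_Rats: "padic_field \<rat> p (rat_val p)"
  unfolding padic_field_def
proof (intro conjI ballI impI p)
  have frac: "\<exists>a b. b \<noteq> 0 \<and> x = of_int a / of_int b" if "x \<in> \<rat>" for x :: complex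
    using that by (elim Rats_cases') (metis less_irrefl)
  show "discrete_val \<rat> (rat_val p)"
  proof
    show "subfield_C \<rat>" by (rule subfield_Rats)
    fix x y :: complex assume xy: "x \<in> \<rat>" "y \<in> \<rat>"
    then obtain a b c d where ab: "b \<noteq> 0" "x = of_int a / of_int b" "d \<noteq> 0" "y = of_int c / of_int d"
      using frac by metis
    { assume "x \<noteq> 0" "y \<noteq> 0"
      then have nz: "a \<noteq> 0" "c \<noteq> 0" using ab by auto
      have "x * y = of_int (a * c) / of_int (b * d)" using ab by simp
      then show "rat_val p (x * y) = rat_val p x + rat_val p y"
        using ab nz rat_val_eq[of "a * c" "b * d"] rat_val_eq[of a b] rat_val_eq[of c d] by (simp add: mult_mult) }
    fix k assume k: "vge (rat_val p) k x" "vge (rat_val p) k y"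
    define n where "n = nat (k + int (multiplicity (int p) (b * d)))"
    have bd: "b * d \<noteq> 0" using ab by simp
    have "x = of_int (a * d) / of_int (b * d)" "y = of_int (c * b) / of_int (b * d)"
      using ab by (auto simp: field_simps)
    then have "int p ^ n dvd a * d" "int p ^ n dvd c * b"
      using k vge_rat_val_iff[OF bd] unfolding n_def by metis+
    then have "int p ^ n dvd a * d + c * b" by (rule dvd_add)
    moreover have "x + y = of_int (a * d + c * b) / of_int (b * d)" using ab by (simp add: field_simps)
    ultimately show "vge (rat_val p) k (x + y)" using vge_rat_val_iff[OF bd] unfolding n_def by metis
  qed
  show "rat_val p (of_nat p) = 1"
    using rat_val_eq[of "int p" 1] p by (simp add: prime_gt_0_nat)
  fix y :: complex assume y: "y \<in> \<rat>" "vge (rat_val p) 0 y"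
  obtain a b where ab: "b > 0" "coprime a b" "y = of_int a / of_int b"
    using y(1) by (elim Rats_cases') auto
  have pr: "prime (int p)" using p by simp
  have "\<not> int p dvd b"
  proof
    assume pb: "int p dvd b"
    have "0 < multiplicity (int p) b"
      using pb pr ab by (simp add: prime_multiplicity_gt_zero_iff)
    then have "nat (int (multiplicity (int p) b)) \<noteq> 0" by simp
    moreover have "int p ^ nat (0 + int (multiplicity (int p) b)) dvd a"
      using y(2) vge_rat_val_iff[of b 0 a] ab by simp
    ultimately have "int p dvd a" by (metis add_0 dvd_power dvd_trans gr0I)
    then show False using pb ab(2) pr by (meson coprime_common_divisor not_prime_unit)
  qed
  then have "coprime b (int p)" using pr prime_imp_coprime coprime_commute by blast
  \<comment> \<open>With \<open>c\<close> an inverse of the denominator modulo \<open>p\<close>, the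
    fraction \<open>a / b\<close> is congruent to the integer \<open>a * c\<close>.\<close>
  then obtain c where c: "[b * c = 1] (mod int p)" using cong_solve_coprime_int by blast
  have "int p dvd a - a * c * b"
  proof -
    have "[a * (b * c) = a * 1] (mod int p)" using c by (rule cong_scalar_left)
    then have "int p dvd a * (b * c) - a" by (simp add: cong_iff_dvd_diff)
    then have "int p dvd - (a * (b * c) - a)" by (subst dvd_minus_iff)
    then show ?thesis by (simp add: algebra_simps)
  qed
  moreover have "multiplicity (int p) b = 0" using \<open>\<not> int p dvd b\<close> by (rule not_dvd_imp_multiplicity_0)
  ultimately have "vge (rat_val p) 1 (of_int (a - a * c * b) / of_int b)"
    using ab by (subst vge_rat_val_iff) auto
  moreover have "of_int (a - a * c * b) / of_int b = y - of_int (a * c)" using ab by (simp add: field_simps)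
  ultimately show "\<exists>n::int. vge (rat_val p) 1 (y - of_int n)" by metis
qed

end

subsection \<open>Primes with residue degree one in a number field\<close>

lemma subring_Ints: "subring_C \<int>"
  by (simp add: subring_C_def)

lemma poly_clear_denominators:
  assumes "poly_over \<rat> h"
  shows "\<exists>D>0. poly_over \<int> (smult (of_nat D) h)"
  using assms
proof (induction h)
  case 0
  then show ?case using poly_over_0[OF subring_Ints] by (intro exI[of _ 1]) simp
next
  case (pCons c h)
  then have "c \<in> \<rat>" "poly_over \<rat> h"
    unfolding poly_over_def by (metis coeff_pCons_0, metis coeff_pCons_Suc)
  with pCons obtain D where D: "D > 0" "poly_over \<int> (smult (of_nat D) h)" by blast
  obtain a b where ab: "b > 0" "c = of_int a / of_int b" using \<open>c \<in> \<rat>\<close> by (auto elim!: Rats_cases')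
  have "of_int (a * int D) = of_nat (D * nat b) * c" using ab by simp
  then have "of_nat (D * nat b) * c \<in> \<int>" by (metis Ints_of_int)
  moreover have "poly_over \<int> (smult (of_nat (nat b)) (smult (of_nat D) h))"
    by (intro poly_over_smult subring_Ints D) simp
  ultimately have "poly_over \<int> (smult (of_nat (D * nat b)) (pCons c h))"
    by (simp add: poly_over_pCons[OF subring_Ints] mult.commute)
  then show ?case using D ab by (intro exI[of _ "D * nat b"]) simp
qed

lemma irreducible_over_smult:
  assumes K: "subfield_C K" and f: "irreducible_over K f" and c: "c \<in> K" "c \<noteq> 0"
  shows "irreducible_over K (smult c f)"
  unfolding irreducible_over_def
proof (intro conjI notI)
  note R = subfield_subring[OF K]
  show "poly_over K (smult c f)" "1 \<le> degree (smult c f)"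
    using f c poly_over_smult[OF R] by (auto simp: irreducible_over_def)
  assume "\<exists>q r. poly_over K q \<and> poly_over K r \<and> 1 \<le> degree q \<and> 1 \<le> degree r \<and> smult c f = q * r"
  then obtain q r where qr: "poly_over K q" "poly_over K r" "1 \<le> degree q" "1 \<le> degree r" "smult c f = q * r" by blast
  have "f = smult (inverse c) (smult c f)" using c by simp
  also have "\<dots> = smult (inverse c) q * r" unfolding qr(5) by simp
  finally have eq: "f = smult (inverse c) q * r" .
  have "poly_over K (smult (inverse c) q)" by (rule poly_over_smult[OF R subfield_inverse[OF K c(1)] qr(1)])
  from irreducible_over_degree_factor[OF f this qr(2) eq]
  show False using qr c by simp
qed

text \<open>Euclid's argument in Schur's form. With \<open>c = f(0)\<close> and \<open>n\<close> a
  multiple of \<open>c * N!\<close>, one gets \<open>f(n) = c * u\<close> with \<open>u\<close>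
  congruent to 1 modulo \<open>N!\<close>, so every prime factor of \<open>u\<close> exceeds
  \<open>N\<close>.\<close>

lemma prime_divisor_of_value:
  assumes f: "poly_over \<int> f" "degree f \<ge> 1"
  obtains p :: nat and n m :: int where "prime p" "p > N" "int p dvd m" "poly f (of_int n) = of_int m"
proof (cases "poly f 0 = 0")
  case True
  obtain p where "prime p" "p > N" using bigger_prime by blast
  then show ?thesis using that[of p 0 0] True by simp
next
  case False
  obtain c0 q where q: "f = pCons c0 q" by (cases f)
  have "c0 \<in> \<int>" "poly_over \<int> q"
    using f(1) unfolding q poly_over_def by (metis coeff_pCons_0, metis coeff_pCons_Suc)
  then obtain c where c: "c0 = of_int c" by (auto elim: Ints_cases)
  have c0: "c \<noteq> 0" using False q c by simp
  define M where "M = int (fact N)"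
  \<comment> \<open>Arguments at which \<open>f\<close> takes the value \<open>c\<close> or
    \<open>- c\<close>, that is, where \<open>u\<close> would be a unit without prime
    factors.\<close>
  let ?bad = "{x. poly (f - [:c0:]) x = 0} \<union> {x. poly (f + [:c0:]) x = 0}"
  have "f - [:c0:] = f + [:- c0:]" by simp
  moreover have "degree [:c0:] < degree f" "degree [:- c0:] < degree f" using f(2) by auto
  ultimately have "degree (f - [:c0:]) = degree f" "degree (f + [:c0:]) = degree f"
    using degree_add_eq_left[of "[:c0:]" f] degree_add_eq_left[of "[:- c0:]" f] by metis+
  then have "f - [:c0:] \<noteq> 0" "f + [:c0:] \<noteq> 0" using f(2) by auto
  then have "finite ?bad" using poly_roots_finite by blast
  moreover have "inj (\<lambda>k::nat. of_int (c * M * int k) :: complex)"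
    using c0 by (intro injI) (auto simp: M_def simp flip: of_int_mult)
  ultimately have "finite ((\<lambda>k::nat. of_int (c * M * int k) :: complex) -` ?bad)" by (rule finite_vimageI)
  then obtain k :: nat where k: "k \<notin> (\<lambda>k::nat. of_int (c * M * int k) :: complex) -` ?bad"
    using ex_new_if_finite[OF infinite_UNIV_nat] by blast
  define n where "n = c * M * int k"
  have "poly q (of_int n) \<in> \<int>" by (rule poly_over_poly[OF subring_Ints \<open>poly_over \<int> q\<close>]) simp
  then obtain s where s: "poly q (of_int n) = of_int s" by (auto elim: Ints_cases)
  define u where "u = 1 + M * int k * s"
  have fn: "poly f (of_int n) = of_int (c * u)"
    unfolding q poly_pCons s c by (simp add: u_def n_def algebra_simps)
  have "poly f (of_int n) \<noteq> c0" "poly f (of_int n) \<noteq> - c0" using k by (auto simp: n_def add_eq_0_iff2)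
  then have "u \<noteq> 1" "u \<noteq> - 1" using fn c by auto
  then have "\<bar>u\<bar> \<noteq> 1" by linarith
  then obtain p' where p': "prime p'" "p' dvd u" using prime_factor_int by blast
  define p where "p = nat p'"
  have p: "prime p" "int p dvd u" using p' prime_ge_0_int[of p'] unfolding p_def by auto
  have "p > N"
  proof (rule ccontr)
    assume "\<not> p > N"
    then have "p dvd fact N" using p(1) by (simp add: prime_dvd_fact_iff)
    then have "int p dvd M" unfolding M_def using int_dvd_int_iff by blast
    then have "int p dvd M * int k * s" by simp
    then have "int p dvd u - M * int k * s" using p(2) by (intro dvd_diff)
    then have "int p dvd 1" by (simp add: u_def)
    then show False using p(1) by simp
  qed
  then show ?thesis using that[of p "c * u" n] p fn by simp
qed

text \<open>A large prime dividing some \<open>f(n)\<close> cannot divide \<open>f'(n)\<close>,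
  because a Bezout identity between \<open>f'\<close> and \<open>f\<close> has bounded denominators.
  So \<open>n\<close> is a simple root modulo \<open>p\<close>, and the \<open>p\<close>-adic
  valuation of the rationals extends to \<open>K\<close>.\<close>

theorem number_field_padic:
  assumes "number_field K"
  obtains p v where "p > N" "padic_field K p v"
proof -
  obtain n where K: "subfield_C K" "ext_degree \<rat> K n" using assms by (auto simp: number_field_def)
  note QK = Rats_subset_subfield[OF K(1)]
  obtain \<theta> where \<theta>: "\<theta> \<in> K" "K = adjoin \<rat> \<theta>" using primitive_element[OF subfield_Rats K(1) QK K(2)] by blast
  obtain f0 where f0: "irreducible_over \<rat> f0" "poly f0 \<theta> = 0"
    using irreducible_over_exists_ext_degree[OF subfield_Rats K \<theta>(1)] by blast
  obtain D where D: "D > 0" "poly_over \<int> (smult (of_nat D) f0)"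
    using poly_clear_denominators[of f0] f0(1) unfolding irreducible_over_def by blast
  define f where "f = smult (of_nat D) f0"
  have f: "irreducible_over \<rat> f" "poly f \<theta> = 0"
    using irreducible_over_smult[OF subfield_Rats f0(1), of "of_nat D"] D f0(2) by (auto simp: f_def)
  have fZ: "poly_over \<int> f" using D by (simp add: f_def)
  have fQ: "poly_over \<rat> f" "degree f \<ge> 1" using f by (auto simp: irreducible_over_def)
  have "poly (pderiv f) \<theta> \<noteq> 0"
    using irreducible_over_rsquarefree[OF subfield_Rats f(1)] f(2) by (auto simp: rsquarefree_roots)
  then obtain a b where ab: "poly_over \<rat> a" "poly_over \<rat> b" "a * pderiv f + b * f = 1"
    using irreducible_over_bezout[OF subfield_Rats f poly_over_pderiv[OF subfield_subring[OF subfield_Rats] fQ(1)]]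
    by blast
  obtain A where A: "A > 0" "poly_over \<int> (smult (of_nat A) a)" using poly_clear_denominators[OF ab(1)] by blast
  obtain B where B: "B > 0" "poly_over \<int> (smult (of_nat B) b)" using poly_clear_denominators[OF ab(2)] by blast
  \<comment> \<open>Beyond the requested \<open>N\<close>, the bound \<open>A * B\<close> keeps
    \<open>p\<close> away from the denominators of the Bezout identity.\<close>
  obtain p n m where p: "prime p" "p > max N (A * B)" and m: "int p dvd m" "poly f (of_int n) = of_int m"
    using prime_divisor_of_value[OF fZ fQ(2)] by blast
  have v: "padic_field \<rat> p (rat_val p)" by (rule padic_field_Rats[OF p(1)])
  interpret V: discrete_val \<rat> "rat_val p" using v by (simp add: padic_field_def)
  have int_val: "\<exists>k::int. poly h (of_int n) = of_int k" if "poly_over \<int> h" for h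
    using poly_over_poly[OF subring_Ints that, of "of_int n"] by (auto elim: Ints_cases)
  obtain d where d: "poly (pderiv f) (of_int n) = of_int d"
    using int_val[OF poly_over_pderiv[OF subring_Ints fZ]] by blast
  have "\<not> int p dvd d"
  proof
    assume pd: "int p dvd d"
    obtain a' where a': "poly (smult (of_nat A) a) (of_int n) = of_int a'" using int_val[OF A(2)] by blast
    obtain b' where b': "poly (smult (of_nat B) b) (of_int n) = of_int b'" using int_val[OF B(2)] by blast
    have "poly a (of_int n) * poly (pderiv f) (of_int n) + poly b (of_int n) * poly f (of_int n) = 1"
      using arg_cong[OF ab(3), of "\<lambda>p. poly p (of_int n)"] by simp
    then have "of_nat (A * B) * (poly a (of_int n) * of_int d + poly b (of_int n) * of_int m) = (of_nat (A * B) :: complex)"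
      using d m by simp
    also have "of_nat (A * B) * (poly a (of_int n) * of_int d + poly b (of_int n) * of_int m)
        = (of_int (int B * a' * d + int A * b' * m) :: complex)"
      using a' b' by (simp add: algebra_simps)
    finally have "int B * a' * d + int A * b' * m = int (A * B)"
      by (metis of_int_eq_iff of_int_of_nat_eq)
    moreover have "int p dvd int B * a' * d + int A * b' * m" using pd m by simp
    ultimately have "p dvd A * B" by (metis int_dvd_int_iff)
    then show False using p A B dvd_imp_le[of p "A * B"] by simp
  qed
  then have d': "poly (pderiv f) (of_int n) \<noteq> 0" "rat_val p (poly (pderiv f) (of_int n)) = 0"
    using padic_v_of_int[OF v, of d] d by auto
  have fi: "vge (rat_val p) 0 (coeff f i)" for i
  proof -
    have "coeff f i \<in> \<int>" using fZ by (simp add: poly_over_def)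
    then show ?thesis using V.vge_0_of_int by (auto elim: Ints_cases)
  qed
  have fn: "vge (rat_val p) 1 (poly f (of_int n))" using m padic_vge_1_of_int_iff[OF v] by simp
  obtain w where "padic_field (adjoin \<rat> \<theta>) p w"
    using padic_hensel_extension[OF v f fi _ V.vge_0_of_int fn d'] Rats_of_int by blast
  then show thesis using that[of p w] p \<theta> by simp
qed

section \<open>Cyclic extensions of prescribed degree\<close>

lemma primitive_root_of_unity_exists:
  assumes "n > 0"
  obtains \<omega> :: complex where "\<omega> ^ n = 1" "\<And>d. 0 < d \<Longrightarrow> d < n \<Longrightarrow> \<omega> ^ d \<noteq> 1" "norm \<omega> = 1"
proof -
  let ?f = "\<lambda>k. cis (2 * pi * real k / real n)"
  define \<omega> where "\<omega> = ?f 1"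
  have pow: "\<omega> ^ k = ?f k" for k by (simp add: \<omega>_def DeMoivre mult_ac)
  have inj: "inj_on ?f {..<n}" using bij_betw_roots_unity[OF assms] by (simp add: bij_betw_def)
  have "\<omega> ^ d \<noteq> 1" if "0 < d" "d < n" for d
  proof
    assume "\<omega> ^ d = 1"
    then have "?f d = ?f 0" unfolding pow by simp
    then show False using inj_onD[OF inj, of d 0] that by simp
  qed
  moreover have "\<omega> ^ n = 1" unfolding pow using assms by simp
  moreover have "norm \<omega> = 1" by (simp add: \<omega>_def)
  ultimately show thesis using that by blast
qed

text \<open>At a place of degree one of \<open>K(\<zeta>\<^sub>n)\<close> over \<open>p > n\<close>, the residue field \<open>\<int>/p\<close> contains a
  primitive \<open>n\<close>-th root of unity, whence \<open>n\<close> divides \<open>p - 1\<close>.\<close>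

lemma padic_prime_cong_1:
  assumes K: "number_field K" and n: "n > 0"
  obtains p v where "padic_field K p v" "n dvd p - 1" "p > 2"
proof -
  have sK: "subfield_C K" using K by (simp add: number_field_def)
  note R = subfield_subring[OF sK]
  obtain \<omega> :: complex where \<omega>: "\<omega> ^ n = 1" "\<And>d. 0 < d \<Longrightarrow> d < n \<Longrightarrow> \<omega> ^ d \<noteq> 1"
    using primitive_root_of_unity_exists[OF n] by metis
  have "poly_over K (monom 1 n - 1)" by (intro poly_over_diff poly_over_monom poly_over_1 subring_1 R)
  moreover have "poly (monom 1 n - 1) \<omega> = 0" by (simp add: poly_monom \<omega>)
  moreover have "monom 1 n - 1 \<noteq> (0 :: complex poly)"
  proof
    assume "monom 1 n - 1 = (0 :: complex poly)"
    then have "coeff (monom 1 n - 1 :: complex poly) n = 0" by simp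
    then show False using n by simp
  qed
  ultimately obtain f where f: "irreducible_over K f" "poly f \<omega> = 0"
    using irreducible_over_exists[OF sK] by blast
  define L where "L = adjoin K \<omega>"
  have L: "subfield_C L" "K \<subseteq> L" "\<omega> \<in> L" "number_field L"
    unfolding L_def using subfield_adjoin[OF sK f] subset_adjoin[OF sK] generator_in_adjoin[OF sK]
      number_field_ext[OF K _ ext_degree_adjoin[OF sK f]] by auto
  obtain p v where p: "p > max n 2" and v: "padic_field L p v" using number_field_padic[OF L(4)] by blast
  interpret discrete_val L v using v by (simp add: padic_field_def)
  note LR = subfield_subring[OF L(1)]
  have pp: "prime p" using v by (simp add: padic_field_def)
  have \<omega>0: "\<omega> \<noteq> 0" using \<omega>(1) n by (auto simp: zero_power)
  have "int n * v \<omega> = 0" using v_power[OF L(3) \<omega>0, of n] \<omega>(1) v_1 by simp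
  then have v\<omega>: "vge v 0 \<omega>" using n by (simp add: vge_def)
  then obtain a :: int where a: "vge v 1 (\<omega> - of_int a)" using v L(3) by (auto simp: padic_field_def)
  \<comment> \<open>A natural representative of the residue of \<open>\<omega>\<close>, so that the
    multiplicative order modulo \<open>p\<close> can be used.\<close>
  define b where "b = nat (a mod int p)"
  have b: "int b = a mod int p" unfolding b_def using p by simp
  have "int p dvd a - int b" unfolding b by (simp add: minus_mod_eq_mult_div)
  then have "vge v 1 (of_int (a - int b))" using padic_vge_1_of_int_iff[OF v] by blast
  then have "vge v 1 ((\<omega> - of_int a) + of_int (a - int b))"
    using a L(3) by (intro vge_add subring_diff LR subring_of_int)
  then have \<omega>b: "vge v 1 (\<omega> - of_nat b)" by simp
  have bL: "of_nat b \<in> L" by (rule subring_of_nat[OF LR])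
  have pow: "vge v 1 (\<omega> ^ k - of_nat (b ^ k))" for k
  proof (induction k)
    case (Suc k)
    have in1: "\<omega> ^ k - of_nat (b ^ k) \<in> L" "\<omega> - of_nat b \<in> L" "of_nat (b ^ k) \<in> L"
      by (intro subring_diff subring_power LR L(3) subring_of_nat)+
    have "vge v (0 + 1) (\<omega> * (\<omega> ^ k - of_nat (b ^ k)))" by (intro vge_mult L(3) in1 v\<omega> Suc.IH)
    moreover have "vge v (0 + 1) (of_nat (b ^ k) * (\<omega> - of_nat b))"
      using vge_0_of_int[of "int (b ^ k)"] by (intro vge_mult in1 \<omega>b) simp
    ultimately have "vge v 1 (\<omega> * (\<omega> ^ k - of_nat (b ^ k)) + of_nat (b ^ k) * (\<omega> - of_nat b))"
      using in1 L(3) by (intro vge_add subring_mult LR) auto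
    then show ?case by (simp add: algebra_simps)
  qed (simp)
  have cong_iff: "[b ^ k = 1] (mod p) \<longleftrightarrow> vge v 1 (\<omega> ^ k - 1)" for k
  proof -
    have "[b ^ k = 1] (mod p) \<longleftrightarrow> int p dvd int (b ^ k) - 1"
      by (metis cong_iff_dvd_diff cong_int_iff of_nat_1)
    also have "\<dots> \<longleftrightarrow> vge v 1 (of_int (int (b ^ k) - 1))"
      by (rule padic_vge_1_of_int_iff[OF v, symmetric])
    also have "of_int (int (b ^ k) - 1) = (of_nat (b ^ k) - 1 :: complex)" by simp
    also have "vge v 1 \<dots> \<longleftrightarrow> vge v 1 (\<omega> ^ k - 1)"
    proof
      have in1: "\<omega> ^ k - of_nat (b ^ k) \<in> L" "of_nat (b ^ k) - 1 \<in> L" "\<omega> ^ k - 1 \<in> L"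
        by (intro subring_diff subring_power LR L(3) subring_of_nat subring_1)+
      show "vge v 1 (\<omega> ^ k - 1)" if "vge v 1 (of_nat (b ^ k) - 1)"
        using vge_add[OF in1(1,2) pow that] by simp
      show "vge v 1 (of_nat (b ^ k) - 1)" if "vge v 1 (\<omega> ^ k - 1)"
        using vge_diff[OF in1(3,1) that pow] by simp
    qed
    finally show ?thesis .
  qed
  have bn: "[b ^ n = 1] (mod p)" unfolding cong_iff by (simp add: \<omega>)
  \<comment> \<open>If \<open>y = \<omega> ^ d\<close>, which differs from 1, were congruent to 1,
    the sum of its first \<open>n\<close> powers would be both zero and congruent to
    \<open>n\<close>, making \<open>p\<close> divide \<open>n\<close>.\<close>
  have not1: "\<not> [b ^ d = 1] (mod p)" if d: "0 < d" "d < n" for d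
  proof
    assume "[b ^ d = 1] (mod p)"
    then have y1: "vge v 1 (\<omega> ^ d - 1)" unfolding cong_iff .
    define y where "y = \<omega> ^ d"
    have yL: "y \<in> L" unfolding y_def by (intro subring_power LR L(3))
    have "y ^ n = (\<omega> ^ n) ^ d" unfolding y_def by (metis power_mult mult.commute)
    then have "y ^ n = 1" by (simp add: \<omega>(1))
    moreover have "y \<noteq> 1" unfolding y_def by (rule \<omega>(2)[OF d])
    ultimately have sum0: "(\<Sum>i<n. y ^ i) = 0" by (simp add: geometric_sum)
    have "vge v 0 (1 + (y - 1))"
      using vge_0_of_int[of 1] vge_mono[OF y1, of 0] by (intro vge_add subring_diff LR yL subring_1) (auto simp: y_def)
    then have y0: "vge v 0 y" by simp
    have "vge v 1 (y ^ i - 1)" for i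
    proof (induction i)
      case (Suc i)
      have in1: "y ^ i - 1 \<in> L" "y - 1 \<in> L" by (intro subring_diff subring_power LR yL subring_1)+
      have "vge v (0 + 1) (y * (y ^ i - 1))" by (intro vge_mult yL in1 y0 Suc.IH)
      then have "vge v 1 (y * (y ^ i - 1) + (y - 1))"
        using y1 in1 yL by (intro vge_add subring_mult LR) (auto simp: y_def)
      then show ?case by (simp add: algebra_simps)
    qed simp
    then have "vge v 1 (\<Sum>i<n. y ^ i - 1)"
      by (intro vge_sum subring_diff subring_power LR yL subring_1)
    moreover have "(\<Sum>i<n. y ^ i - 1) = of_int (- int n)" by (simp add: sum_subtractf sum0)
    ultimately have "int p dvd - int n" using padic_vge_1_of_int_iff[OF v] by metis
    then have "p dvd n" by simp
    then show False using p n dvd_imp_le[of p n] by simp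
  qed
  have "coprime p b"
  proof (rule ccontr)
    assume "\<not> coprime p b"
    then have "ord p b = 0" by simp
    then show False using bn n ord_divides[of b n p] by simp
  qed
  have "ord p b dvd n" using bn ord_divides by blast
  then have "ord p b = n"
    using not1[of "ord p b"] ord[of b p] n dvd_imp_le[of "ord p b" n] \<open>coprime p b\<close>
    by (metis dvd_0_left_iff le_neq_implies_less not_gr_zero)
  then have "n dvd p - 1" using order_divides_totient[OF \<open>coprime p b\<close>] totient_prime[OF pp] by simp
  then show thesis using that[of p v] padic_field_subset[OF v sK L(2)] p by simp
qed

section \<open>The cyclotomic field over \<open>K\<close> and its cyclic automorphism\<close>

text \<open>This is \<open>((X + 1) ^ p - 1) / X\<close>, Eisenstein at \<open>p\<close> because
  \<open>v\<close> gives \<open>p\<close> the value 1 in \<open>K\<close> and \<open>p\<close>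
  divides the inner binomial coefficients.\<close>

lemma irreducible_over_cyclotomic_shifted:
  assumes v: "padic_field K p v"
  shows "irreducible_over K (\<Sum>i<p. monom (of_nat (p choose Suc i)) i)" (is "irreducible_over K ?f")
    and "degree (\<Sum>i<p. monom (of_nat (p choose Suc i) :: complex) i) = p - 1"
proof -
  interpret discrete_val K v using v by (simp add: padic_field_def)
  have p: "prime p" "v (of_nat p) = 1" using v by (auto simp: padic_field_def)
  have p1: "p \<ge> 2" by (rule prime_ge_2_nat[OF p(1)])
  have coeff_f: "coeff ?f i = (if i < p then of_nat (p choose Suc i) else 0)" for i
    by (simp add: coeff_sum)
  have lead: "coeff ?f (p - 1) = 1" using p1 unfolding coeff_f by simp
  show deg: "degree ?f = p - 1"
  proof (rule antisym)
    show "degree ?f \<le> p - 1" by (rule degree_le) (auto simp: coeff_f)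
    show "p - 1 \<le> degree ?f" by (rule le_degree) (subst lead, simp)
  qed
  show "irreducible_over K ?f"
  proof (rule eisenstein[of _ "p - 1"])
    show "poly_over K ?f" by (intro poly_over_sum poly_over_monom R subring_of_nat)
    show "v (lead_coeff ?f) = 0" unfolding deg lead by (rule v_1)
    show "coeff ?f 0 \<noteq> 0" "v (coeff ?f 0) = 1" using p p1 unfolding coeff_f by auto
    fix i assume i: "i < p - 1"
    then have "p dvd (p choose Suc i)" using p(1) by (intro dvd_choose_prime) auto
    then have "int p dvd int (p choose Suc i)" by simp
    then have "vge v 1 (of_int (int (p choose Suc i)))" using padic_vge_1_of_int_iff[OF v] by blast
    then show "vge v 1 (coeff ?f i)" using i unfolding coeff_f by simp
  qed (use p1 deg in auto)
qed

lemma root_cyclotomic_shifted: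
  fixes x :: complex
  assumes "x \<noteq> 1" "x ^ p = 1"
  shows "poly (\<Sum>i<p. monom (of_nat (p choose Suc i)) i) (x - 1) = 0" (is "poly ?f _ = 0")
proof -
  define y where "y = x - 1"
  have "(y + 1) ^ p = (\<Sum>i\<le>p. of_nat (p choose i) * y ^ i)" by (subst binomial_ring) simp
  also have "{..p} = {..<Suc p}" by auto
  also have "(\<Sum>i<Suc p. of_nat (p choose i) * y ^ i) = 1 + (\<Sum>i<p. of_nat (p choose Suc i) * y ^ Suc i)"
    by (subst sum.lessThan_Suc_shift) simp
  also have "(\<Sum>i<p. of_nat (p choose Suc i) * y ^ Suc i) = y * poly ?f y"
    by (simp add: poly_sum poly_monom sum_distrib_left mult_ac)
  finally have "y * poly ?f y = 0" using assms by (simp add: y_def)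
  then show ?thesis using assms by (simp add: y_def)
qed

lemma lin_indep_reindex:
  assumes "lin_indep K I b" "bij_betw f J I" "\<And>j. j \<in> J \<Longrightarrow> b' j = b (f j)"
  shows "lin_indep K J b'"
  unfolding lin_indep_def
proof (intro conjI allI impI ballI)
  show "finite J" using assms(1,2) bij_betw_finite by (auto simp: lin_indep_def)
  fix c j assume c: "\<forall>j\<in>J. c j \<in> K" "(\<Sum>j\<in>J. c j * b' j) = 0" and j: "j \<in> J"
  let ?g = "inv_into J f"
  have g: "?g (f j) = j" if "j \<in> J" for j using assms(2) that by (simp add: bij_betw_def inv_into_f_f)
  have "(\<Sum>i\<in>I. c (?g i) * b i) = (\<Sum>j\<in>J. c (?g (f j)) * b (f j))"
    using sum.reindex_bij_betw[OF assms(2), of "\<lambda>i. c (?g i) * b i"] by simp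
  also have "\<dots> = (\<Sum>j\<in>J. c j * b' j)" by (intro sum.cong) (auto simp: g assms(3))
  finally have s: "(\<Sum>i\<in>I. c (?g i) * b i) = 0" using c(2) by simp
  have "c (?g i) \<in> K" if "i \<in> I" for i
    using c(1) that assms(2) bij_betwE bij_betw_inv_into by metis
  moreover have "f j \<in> I" using assms(2) j bij_betwE by metis
  ultimately have "c (?g (f j)) = 0" using lin_indepD[OF assms(1), of "\<lambda>i. c (?g i)", OF _ s] by blast
  then show "c j = 0" by (simp add: g j)
qed

lemma lin_indep_scale:
  assumes "lin_indep K I b" "x \<noteq> 0"
  shows "lin_indep K I (\<lambda>i. x * b i)"
  unfolding lin_indep_def
proof (intro conjI allI impI ballI)
  show "finite I" using assms by (simp add: lin_indep_def)
  fix c i assume c: "\<forall>i\<in>I. c i \<in> K" "(\<Sum>i\<in>I. c i * (x * b i)) = 0" and i: "i \<in> I"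
  have "x * (\<Sum>i\<in>I. c i * b i) = 0" using c(2) by (simp add: sum_distrib_left mult_ac)
  then have s: "(\<Sum>i\<in>I. c i * b i) = 0" using assms(2) by simp
  show "c i = 0" by (rule lin_indepD[OF assms(1), of c, OF _ s i]) (use c(1) in blast)
qed

locale cyclotomic =
  fixes K :: "complex set" and p :: nat and v g and \<zeta> :: complex
  assumes v: "padic_field K p v" and p2: "p > 2" and g: "residue_primroot p g"
    and \<zeta>: "\<zeta> ^ p = 1" "\<zeta> \<noteq> 1" "norm \<zeta> = 1"
begin

lemma K: "subfield_C K"
  using v by (simp add: padic_field_def discrete_val_def)

lemmas R = subfield_subring[OF K]

lemma p: "prime p"
  using v by (simp add: padic_field_def)

text \<open>The field \<open>K(\<zeta>)\<close>; the generator is \<open>\<zeta> - 1\<close> because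
  it is the shifted polynomial \<open>\<Phi>\<close> whose irreducibility is known.\<close>

definition N :: "complex set" where "N = adjoin K (\<zeta> - 1)"

abbreviation \<Phi> :: "complex poly" where "\<Phi> \<equiv> \<Sum>i<p. monom (of_nat (p choose Suc i)) i"

text \<open>Ordering the nontrivial \<open>p\<close>-th roots of unity along powers of
  \<open>g\<close> turns the automorphism \<open>\<zeta>\<close> to \<open>\<zeta> ^ g\<close> into
  an index shift.\<close>

definition z :: "nat \<Rightarrow> complex" where "z i = \<zeta> ^ (g ^ i)"

lemmas \<Phi> = irreducible_over_cyclotomic_shifted[OF v]

lemma \<Phi>_root: "poly \<Phi> (\<zeta> - 1) = 0"
  by (rule root_cyclotomic_shifted[OF \<zeta>(2,1)])

lemma N: "subfield_C N" "K \<subseteq> N" "ext_degree K N (p - 1)"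
  unfolding N_def using subfield_adjoin[OF K \<Phi>(1) \<Phi>_root] subset_adjoin[OF K]
    ext_degree_adjoin[OF K \<Phi>(1) \<Phi>_root] \<Phi>(2) by simp_all

lemmas NR = subfield_subring[OF N(1)]

lemma \<zeta>_in_N: "\<zeta> \<in> N"
  using subring_add[OF NR generator_in_adjoin[OF K, of "\<zeta> - 1", folded N_def] subring_1[OF NR]] by simp

lemma z_in_N: "z i \<in> N"
  unfolding z_def by (intro subring_power NR \<zeta>_in_N)

lemma \<zeta>_pow_mod: "\<zeta> ^ (k mod p) = \<zeta> ^ k"
proof -
  have "\<zeta> ^ k = \<zeta> ^ (p * (k div p) + k mod p)" by simp
  also have "\<dots> = \<zeta> ^ (k mod p)" unfolding power_add power_mult \<zeta>(1) by simp
  finally show ?thesis by simp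
qed

lemma \<zeta>_pow_cong: "[k = l] (mod p) \<Longrightarrow> \<zeta> ^ k = \<zeta> ^ l"
  by (metis \<zeta>_pow_mod cong_def)

lemma ord_g: "ord p g = p - 1"
  using g totient_prime[OF p] by (simp add: residue_primroot_def)

lemma z_periodic: "z (i + (p - 1)) = z i"
proof -
  have "[g ^ (p - 1) = 1] (mod p)" by (simp only: ord_divides ord_g dvd_refl)
  then have "[g ^ i * g ^ (p - 1) = g ^ i * 1] (mod p)" by (rule cong_scalar_left)
  then show ?thesis unfolding z_def by (intro \<zeta>_pow_cong) (simp add: power_add)
qed

text \<open>A normal basis: the powers of \<open>\<zeta>\<close> with exponents 0 to
  \<open>p - 2\<close> are independent by the degree of \<open>\<Phi>\<close>; multiplying by
  \<open>\<zeta>\<close> gives exponents 1 to \<open>p - 1\<close>, which \<open>g\<close>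
  permutes.\<close>

lemma lin_indep_z: "lin_indep K {..<p - 1} z"
proof -
  have "h = 0" if h: "poly_over K h" "poly h \<zeta> = 0" "degree h < p - 1" for h
  proof -
    have "poly_over K (pcompose h [:1, 1:])"
      by (intro poly_over_pcompose R h poly_over_pCons poly_over_0 subring_1)
    moreover have "poly (pcompose h [:1, 1:]) (\<zeta> - 1) = 0" using h by (simp add: poly_pcompose)
    moreover have "degree (pcompose h [:1, 1:]) < degree \<Phi>" using h \<Phi>(2) by (simp add: degree_pcompose)
    ultimately have "pcompose h [:1, 1:] = 0" by (rule irreducible_over_root_degree[OF K \<Phi>(1) \<Phi>_root])
    then show "h = 0" using pcompose_eq_0[of h "[:1, 1:]"] by simp
  qed
  then have 1: "lin_indep K {..<p - 1} (\<lambda>i. \<zeta> ^ i)" by (rule lin_indep_powers[OF K])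
  have "\<zeta> \<noteq> 0" using \<zeta>(3) by auto
  from lin_indep_scale[OF 1 this] have 2: "lin_indep K {..<p - 1} (\<lambda>i. \<zeta> * \<zeta> ^ i)" .
  have "bij_betw (\<lambda>i. i - 1) {0<..<p} {..<p - 1}"
    by (rule bij_betwI[of _ _ _ Suc]) auto
  from lin_indep_reindex[OF 2 this, of "\<lambda>i. \<zeta> ^ i"] have 3: "lin_indep K {0<..<p} (\<lambda>i. \<zeta> ^ i)"
    by (simp add: power_eq_if)
  have "bij_betw (\<lambda>i. g ^ i mod p) {..<p - 1} {0<..<p}"
    using residue_primroot_is_generator[OF prime_gt_1_nat[OF p] g] totient_prime[OF p] totatives_prime[OF p] by simp
  from lin_indep_reindex[OF 3 this] show ?thesis by (simp add: z_def \<zeta>_pow_mod)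
qed

lemma sum_z: "(\<Sum>i<p - 1. z i) = - 1"
proof -
  have "bij_betw (\<lambda>i. g ^ i mod p) {..<p - 1} {0<..<p}"
    using residue_primroot_is_generator[OF prime_gt_1_nat[OF p] g] totient_prime[OF p] totatives_prime[OF p] by simp
  from sum.reindex_bij_betw[OF this, of "\<lambda>i. \<zeta> ^ i"]
  have "(\<Sum>i<p - 1. z i) = (\<Sum>i\<in>{0<..<p}. \<zeta> ^ i)" by (simp add: z_def \<zeta>_pow_mod)
  moreover have "(\<Sum>i<p. \<zeta> ^ i) = 0" using \<zeta> by (simp add: geometric_sum)
  moreover have "{..<p} = insert 0 {0<..<p}" using p2 by auto
  ultimately show ?thesis by (simp add: add_eq_0_iff)
qed

lemma automorphism:
  obtains \<sigma> where "\<And>a b. a \<in> N \<Longrightarrow> b \<in> N \<Longrightarrow> \<sigma> (a + b) = \<sigma> a + \<sigma> b"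
    "\<And>a b. a \<in> N \<Longrightarrow> b \<in> N \<Longrightarrow> \<sigma> (a * b) = \<sigma> a * \<sigma> b"
    "\<And>a. a \<in> K \<Longrightarrow> \<sigma> a = a" "\<And>a. a \<in> N \<Longrightarrow> \<sigma> a \<in> N" "\<And>i. \<sigma> (z i) = z (Suc i)"
proof -
  \<comment> \<open>Otherwise \<open>z (p - 1)\<close> would be 1, whereas periodicity makes it
    equal to \<open>z 0 = \<zeta>\<close>.\<close>
  have "\<zeta> ^ g \<noteq> 1"
  proof
    assume "\<zeta> ^ g = 1"
    then have "z (Suc i) = 1" for i unfolding z_def by (simp add: power_mult)
    from this[of "p - 2"] have "z (0 + (p - 1)) = 1" using p2 by (simp add: numeral_2_eq_2 Suc_diff_Suc)
    then show False unfolding z_periodic using \<zeta>(2) by (simp add: z_def)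
  qed
  moreover have "(\<zeta> ^ g) ^ p = 1" by (metis \<zeta>(1) mult.commute power_mult power_one)
  ultimately have root: "poly \<Phi> (\<zeta> ^ g - 1) = 0" by (rule root_cyclotomic_shifted)
  obtain \<sigma> where \<sigma>: "\<And>h. poly_over K h \<Longrightarrow> \<sigma> (poly h (\<zeta> - 1)) = poly h (\<zeta> ^ g - 1)"
    and hom: "\<And>a b. a \<in> N \<Longrightarrow> b \<in> N \<Longrightarrow> \<sigma> (a + b) = \<sigma> a + \<sigma> b"
    "\<And>a b. a \<in> N \<Longrightarrow> b \<in> N \<Longrightarrow> \<sigma> (a * b) = \<sigma> a * \<sigma> b" "\<And>a. a \<in> K \<Longrightarrow> \<sigma> a = a"
    using adjoin_hom[OF K \<Phi>(1) \<Phi>_root root] unfolding N_def by blast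
  have "\<zeta> ^ g - 1 \<in> N" by (intro subring_diff subring_power subring_1 NR \<zeta>_in_N)
  have "\<sigma> a \<in> N" if a: "a \<in> N" for a
  proof -
    obtain h where h: "poly_over K h" "a = poly h (\<zeta> - 1)" using a by (auto simp: N_def adjoin_def)
    show ?thesis unfolding h(2) \<sigma>[OF h(1)]
      by (rule poly_over_poly[OF NR poly_over_mono[OF h(1) N(2)]]) fact
  qed
  moreover have "\<sigma> (z i) = z (Suc i)" for i
  proof -
    have "poly_over K (pcompose (monom 1 (g ^ i)) [:1, 1:])"
      by (intro poly_over_pcompose R poly_over_monom poly_over_pCons poly_over_0 subring_1)
    from \<sigma>[OF this] have "\<sigma> (\<zeta> ^ (g ^ i)) = (\<zeta> ^ g) ^ (g ^ i)" by (simp add: poly_pcompose poly_monom)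
    then show ?thesis by (simp add: z_def power_mult)
  qed
  ultimately show thesis using that[of \<sigma>] hom by blast
qed

end

locale cyclotomic_automorphism = cyclotomic +
  fixes \<sigma> :: "complex \<Rightarrow> complex"
  assumes \<sigma>_add: "\<And>a b. a \<in> N \<Longrightarrow> b \<in> N \<Longrightarrow> \<sigma> (a + b) = \<sigma> a + \<sigma> b"
    and \<sigma>_mult: "\<And>a b. a \<in> N \<Longrightarrow> b \<in> N \<Longrightarrow> \<sigma> (a * b) = \<sigma> a * \<sigma> b"
    and \<sigma>_fix: "\<And>a. a \<in> K \<Longrightarrow> \<sigma> a = a" and \<sigma>_in_N: "\<And>a. a \<in> N \<Longrightarrow> \<sigma> a \<in> N"
    and \<sigma>_z: "\<And>i. \<sigma> (z i) = z (Suc i)"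
begin

lemma pow_in_N: "a \<in> N \<Longrightarrow> (\<sigma> ^^ k) a \<in> N"
  by (induction k) (auto simp: \<sigma>_in_N)

lemma pow_add: "a \<in> N \<Longrightarrow> b \<in> N \<Longrightarrow> (\<sigma> ^^ k) (a + b) = (\<sigma> ^^ k) a + (\<sigma> ^^ k) b"
  by (induction k) (auto simp: \<sigma>_add pow_in_N)

lemma pow_mult: "a \<in> N \<Longrightarrow> b \<in> N \<Longrightarrow> (\<sigma> ^^ k) (a * b) = (\<sigma> ^^ k) a * (\<sigma> ^^ k) b"
  by (induction k) (auto simp: \<sigma>_mult pow_in_N)

lemma pow_fix: "a \<in> K \<Longrightarrow> (\<sigma> ^^ k) a = a"
  by (induction k) (auto simp: \<sigma>_fix)

lemma pow_z: "(\<sigma> ^^ k) (z i) = z (i + k)"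
  by (induction k) (auto simp: \<sigma>_z)

lemma pow_sum:
  assumes "\<And>i. i \<in> I \<Longrightarrow> c i \<in> K" "\<And>i. i \<in> I \<Longrightarrow> b i \<in> N"
  shows "(\<sigma> ^^ k) (\<Sum>i\<in>I. c i * b i) = (\<Sum>i\<in>I. c i * (\<sigma> ^^ k) (b i))"
  using assms
proof (induction I rule: infinite_finite_induct)
  case (insert i I)
  have "c i \<in> N" "b i \<in> N" using insert N(2) by auto
  moreover have "(\<Sum>i\<in>I. c i * b i) \<in> N"
    by (intro subring_sum subring_mult NR) (use insert N(2) in auto)
  ultimately show ?case using insert by (simp add: pow_add pow_mult pow_fix subring_mult[OF NR])
qed (simp_all add: pow_fix subring_0[OF R])

definition fixed_field :: "nat \<Rightarrow> complex set" where
  "fixed_field k = {x \<in> N. (\<sigma> ^^ k) x = x}"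

lemma subset_fixed_field: "K \<subseteq> fixed_field k"
  using N(2) by (auto simp: fixed_field_def pow_fix)

lemma subfield_fixed_field: "subfield_C (fixed_field k)"
  unfolding subfield_C_def
proof (intro conjI ballI impI)
  show "0 \<in> fixed_field k" "1 \<in> fixed_field k"
    using subset_fixed_field subring_0[OF R] subring_1[OF R] by auto
  fix x assume x: "x \<in> fixed_field k"
  have m1: "- 1 \<in> K" using subring_uminus[OF R subring_1[OF R]] .
  have "(\<sigma> ^^ k) (- 1 * x) = - 1 * x"
    using pow_mult[of "- 1" x k] m1 N(2) pow_fix[OF m1] x by (auto simp: fixed_field_def)
  then show "- x \<in> fixed_field k" using x subring_uminus[OF NR] by (simp add: fixed_field_def)
  { fix y assume y: "y \<in> fixed_field k"
    show "x + y \<in> fixed_field k" "x * y \<in> fixed_field k"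
      using x y pow_add pow_mult subring_add[OF NR] subring_mult[OF NR] by (auto simp: fixed_field_def) }
  assume x0: "x \<noteq> 0"
  have xN: "x \<in> N" "(\<sigma> ^^ k) x = x" "inverse x \<in> N"
    using x subfield_inverse[OF N(1)] by (auto simp: fixed_field_def)
  have "x * (\<sigma> ^^ k) (inverse x) = (\<sigma> ^^ k) (x * inverse x)" using pow_mult[OF xN(1,3)] xN(2) by simp
  also have "\<dots> = 1" using x0 pow_fix[OF subring_1[OF R]] by simp
  finally have "(\<sigma> ^^ k) (inverse x) = inverse x" by (metis inverse_unique)
  then show "inverse x \<in> fixed_field k" using xN by (simp add: fixed_field_def)
qed

section \<open>Gaussian periods and the fixed fields of powers of the automorphism\<close>

context
  fixes t m :: nat assumes tm: "t * m = p - 1"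
begin

text \<open>The pair consists of the residue modulo \<open>t\<close> of an exponent and its position
  in that class; \<open>\<sigma> ^^ t\<close> rotates the position, as \<open>shift\<close>
  records.\<close>

definition w :: "nat \<times> nat \<Rightarrow> complex" where "w i = z (fst i + t * snd i)"

definition shift :: "nat \<times> nat \<Rightarrow> nat \<times> nat" where
  "shift i = (fst i, if Suc (snd i) = m then 0 else Suc (snd i))"

text \<open>The Gaussian periods, that is, the sums over the orbits of \<open>\<sigma> ^^ t\<close>
  on the normal basis.\<close>

definition period :: "nat \<Rightarrow> complex" where "period j = (\<Sum>s<m. w (j, s))"

lemma tm_pos: "t > 0" "m > 0"
  using tm p2 by (auto intro!: gr0I)

lemma lin_indep_w: "lin_indep K ({..<t} \<times> {..<m}) w"
proof (rule lin_indep_reindex[OF lin_indep_z])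
  show "bij_betw (\<lambda>i. fst i + t * snd i) ({..<t} \<times> {..<m}) {..<p - 1}"
  proof (rule bij_betwI[of _ _ _ "\<lambda>i. (i mod t, i div t)"])
    have "j + t * s < t * m" if "j < t" "s < m" for j s
    proof -
      have "j + t * s < t * Suc s" using that by simp
      also have "\<dots> \<le> t * m" using that by (intro mult_le_mono2) simp
      finally show ?thesis .
    qed
    then show "(\<lambda>i. fst i + t * snd i) \<in> {..<t} \<times> {..<m} \<rightarrow> {..<p - 1}"
      unfolding tm[symmetric] by auto
    show "(\<lambda>i. (i mod t, i div t)) \<in> {..<p - 1} \<rightarrow> {..<t} \<times> {..<m}"
      using tm_pos unfolding tm[symmetric] by (auto simp: mult.commute less_mult_imp_div_less)
  qed (use tm_pos in auto)
qed (simp add: w_def)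

lemma bij_shift: "bij_betw shift ({..<t} \<times> {..<m}) ({..<t} \<times> {..<m})"
proof -
  have "inj_on shift ({..<t} \<times> {..<m})"
    by (auto simp: inj_on_def shift_def split: if_splits)
  moreover have "shift ` ({..<t} \<times> {..<m}) \<subseteq> {..<t} \<times> {..<m}"
    by (auto simp: shift_def)
  ultimately show ?thesis by (simp add: bij_betw_def endo_inj_surj)
qed

lemma pow_w: "(\<sigma> ^^ t) (w i) = w (shift i)"
  using z_periodic[of "fst i"] tm[symmetric] unfolding w_def pow_z
  by (auto simp: shift_def algebra_simps)

text \<open>Comparing coordinates of \<open>x\<close> and its image in the shifted basis shows that
  the coefficients are constant along each orbit.\<close>

lemma fixed_field_expansion:
  assumes x: "x \<in> fixed_field t"
  shows "\<exists>c. (\<forall>j\<in>{..<t}. c j \<in> K) \<and> x = (\<Sum>j<t. c j * period j)"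
proof -
  let ?I = "{..<t} \<times> {..<m}"
  have wN: "w i \<in> N" for i unfolding w_def by (rule z_in_N)
  have "\<exists>c. (\<forall>i\<in>?I. c i \<in> K) \<and> x = (\<Sum>i\<in>?I. c i * w i)"
    by (rule lin_indep_spans[OF K lin_indep_w _ N(3)]) (use wN x in \<open>auto simp: tm fixed_field_def\<close>)
  then obtain c where c': "(\<forall>i\<in>?I. c i \<in> K) \<and> x = (\<Sum>i\<in>?I. c i * w i)" ..
  note c = bspec[OF conjunct1[OF c']] conjunct2[OF c']
  have sI: "shift i \<in> ?I" if "i \<in> ?I" for i using bij_shift that by (rule bij_betw_apply)
  have "(\<Sum>i\<in>?I. c i * w (shift i)) = (\<sigma> ^^ t) x"
    unfolding c(2) by (subst pow_sum) (auto simp: c wN pow_w)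
  also have "\<dots> = x" using x by (simp add: fixed_field_def)
  also have "\<dots> = (\<Sum>i\<in>?I. c (shift i) * w (shift i))"
    unfolding c(2) by (rule sum.reindex_bij_betw[OF bij_shift, symmetric])
  finally have s: "(\<Sum>i\<in>?I. (c i - c (shift i)) * w (shift i)) = 0"
    by (simp add: left_diff_distrib sum_subtractf)
  have eq: "c (shift i) = c i" if i: "i \<in> ?I" for i
  proof -
    have "c i - c (shift i) = 0"
      by (rule lin_indepD[OF lin_indep_reindex[OF lin_indep_w bij_shift refl],
            of "\<lambda>i. c i - c (shift i)", OF _ s i])
         (intro subring_diff[OF R] c sI)
    then show ?thesis by simp
  qed
  have const: "c (j, s) = c (j, 0)" if "j < t" "s < m" for j s
    using that(2)
  proof (induction s)
    case (Suc s)
    then show ?case using eq[of "(j, s)"] that(1) by (simp add: shift_def)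
  qed simp
  have "x = (\<Sum>j<t. \<Sum>s<m. c (j, s) * w (j, s))"
    unfolding c(2) by (simp add: sum.cartesian_product)
  also have "\<dots> = (\<Sum>j<t. c (j, 0) * period j)"
    unfolding period_def sum_distrib_left
    by (intro sum.cong refl arg_cong2[where f = "(*)"] const) auto
  finally have "x = (\<Sum>j<t. c (j, 0) * period j)" .
  moreover have "\<forall>j\<in>{..<t}. c (j, 0) \<in> K" using c(1) tm_pos by simp
  ultimately show ?thesis by (intro exI[of _ "\<lambda>j. c (j, 0)"]) simp
qed

lemma ext_degree_fixed_field: "ext_degree K (fixed_field t) t"
proof (rule ext_degreeI[OF K])
  show "lin_indep K {..<t} period"
    unfolding lin_indep_def
  proof (intro conjI allI impI ballI)
    fix c j assume c: "\<forall>j\<in>{..<t}. c j \<in> K" "(\<Sum>j<t. c j * period j) = 0" and j: "j \<in> {..<t}"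
    have s: "(\<Sum>i\<in>{..<t} \<times> {..<m}. c (fst i) * w i) = 0"
      using c(2) unfolding period_def sum_distrib_left by (simp add: sum.cartesian_product case_prod_unfold)
    show "c j = 0"
      using lin_indepD[OF lin_indep_w, of "\<lambda>i. c (fst i)" "(j, 0)", OF _ s] c(1) j tm_pos by auto
  qed simp
  have period: "period j \<in> fixed_field t" if "j < t" for j
  proof -
    have wN: "w i \<in> N" for i unfolding w_def by (rule z_in_N)
    have bij: "bij_betw (\<lambda>s. snd (shift (j, s))) {..<m} {..<m}"
    proof -
      have "inj_on (\<lambda>s. snd (shift (j, s))) {..<m}" by (auto simp: inj_on_def shift_def split: if_splits)
      moreover have "(\<lambda>s. snd (shift (j, s))) ` {..<m} \<subseteq> {..<m}" by (auto simp: shift_def)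
      ultimately show ?thesis by (simp add: bij_betw_def endo_inj_surj)
    qed
    have "(\<sigma> ^^ t) (period j) = (\<Sum>s<m. w (shift (j, s)))"
      using pow_sum[of "{..<m}" "\<lambda>_. 1" "\<lambda>s. w (j, s)" t] subring_1[OF R] wN
      by (simp add: period_def pow_w)
    also have "\<dots> = (\<Sum>s<m. w (j, snd (shift (j, s))))" by (simp add: shift_def)
    also have "\<dots> = period j" unfolding period_def
      by (rule sum.reindex_bij_betw[OF bij, of "\<lambda>s. w (j, s)"])
    finally show ?thesis using wN by (auto simp: fixed_field_def period_def intro!: subring_sum NR)
  qed
  show "x \<in> fixed_field t \<longleftrightarrow> (\<exists>c. (\<forall>i\<in>{..<t}. c i \<in> K) \<and> x = (\<Sum>i<t. c i * period i))" for x
  proof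
    show "\<exists>c. (\<forall>i\<in>{..<t}. c i \<in> K) \<and> x = (\<Sum>i<t. c i * period i)" if "x \<in> fixed_field t"
      by (rule fixed_field_expansion[OF that])
    assume "\<exists>c. (\<forall>i\<in>{..<t}. c i \<in> K) \<and> x = (\<Sum>i<t. c i * period i)"
    then obtain c where c': "(\<forall>i\<in>{..<t}. c i \<in> K) \<and> x = (\<Sum>i<t. c i * period i)" ..
    note c = bspec[OF conjunct1[OF c']] conjunct2[OF c']
    show "x \<in> fixed_field t" unfolding c(2)
      by (intro subring_sum subring_mult subfield_subring subfield_fixed_field)
         (use c(1) subset_fixed_field period in auto)
  qed
qed simp

end

text \<open>For \<open>t = 1\<close> the only period is the sum of all nontrivial
  \<open>p\<close>-th roots of unity, which is -1.\<close>

lemma fixed_field_1: "fixed_field 1 = K"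
proof
  show "fixed_field 1 \<subseteq> K"
  proof
    fix x assume x: "x \<in> fixed_field 1"
    have tm: "1 * (p - 1) = p - 1" by simp
    from fixed_field_expansion[OF tm x] obtain c
      where "(\<forall>j\<in>{..<1}. c j \<in> K) \<and> x = (\<Sum>j<1. c j * period 1 (p - 1) j)" ..
    then have c: "c 0 \<in> K" "x = c 0 * period 1 (p - 1) 0" by simp_all
    have "period 1 (p - 1) 0 = - 1" using sum_z unfolding period_def[OF tm] w_def[OF tm] by simp
    then show "x \<in> K" using c subring_uminus[OF R] by simp
  qed
qed (rule subset_fixed_field)

lemma coeff_prod_linear:
  fixes n :: nat
  assumes y: "\<And>j. j < n \<Longrightarrow> y j \<in> N"
  shows "coeff (\<Prod>j<n. [:- y j, 1:]) i \<in> N \<and>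
    \<sigma> (coeff (\<Prod>j<n. [:- y j, 1:]) i) = coeff (\<Prod>j<n. [:- \<sigma> (y j), 1:]) i"
  using y
proof (induction n arbitrary: i)
  case 0
  then show ?case using \<sigma>_fix subring_0[OF R] subring_1[OF R] N(2)
    by (auto simp: one_pCons coeff_pCons split: nat.splits)
next
  case (Suc n)
  have m1: "- 1 \<in> K" using subring_uminus[OF R subring_1[OF R]] .
  let ?P = "\<Prod>j<n. [:- y j, 1:]"
  have IH: "coeff ?P i \<in> N" "\<sigma> (coeff ?P i) = coeff (\<Prod>j<n. [:- \<sigma> (y j), 1:]) i" for i
    using Suc by auto
  have lin: "coeff (P * [:- a, 1:]) i = (- 1) * (a * coeff P i) + (case i of 0 \<Rightarrow> 0 | Suc k \<Rightarrow> coeff P k)"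
    for P :: "complex poly" and a
    by (cases i) (simp_all add: mult_pCons_right algebra_simps)
  have yn: "y n \<in> N" using Suc by simp
  define r where "r = (case i of 0 \<Rightarrow> 0 | Suc k \<Rightarrow> coeff ?P k)"
  have r: "r \<in> N" "\<sigma> r = (case i of 0 \<Rightarrow> 0 | Suc k \<Rightarrow> coeff (\<Prod>j<n. [:- \<sigma> (y j), 1:]) k)"
    using IH \<sigma>_fix subring_0[OF R] N(2) by (auto simp: r_def split: nat.splits)
  have 1: "y n * coeff ?P i \<in> N" "- 1 * (y n * coeff ?P i) \<in> N"
    using m1 N(2) by (auto intro!: subring_mult NR yn IH subring_uminus)
  have "\<sigma> (- 1 * (y n * coeff ?P i) + r) = - 1 * (\<sigma> (y n) * \<sigma> (coeff ?P i)) + \<sigma> r"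
    using m1 N(2) \<sigma>_add[OF 1(2) r(1)] \<sigma>_mult[of "- 1" "y n * coeff ?P i"] \<sigma>_mult[OF yn IH(1)] 1 \<sigma>_fix[OF m1]
    by auto
  then show ?case
    using subring_add[OF NR 1(2) r(1)] unfolding prod.lessThan_Suc lin r_def[symmetric] r(2) IH(2) by simp
qed

text \<open>The product \<open>P\<close> of the \<open>X - \<sigma>\<^sup>j x\<close> over
  \<open>j < t\<close> is invariant under \<open>\<sigma>\<close>, hence has coefficients in
  \<open>K\<close>, and \<open>q\<close> divides it. So the roots of \<open>q\<close> are images of
  \<open>x\<close> under powers of \<open>\<sigma>\<close>, which commute with
  \<open>\<sigma> ^^ t\<close>.\<close>

theorem galois_fixed_field:
  assumes t: "t > 0"
  shows "galois_over K (fixed_field t)"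
  unfolding galois_over_def
proof (intro allI impI conjI)
  fix q assume q: "irreducible_over K q" "\<exists>x\<in>fixed_field t. poly q x = 0"
  show "rsquarefree q" by (rule irreducible_over_rsquarefree[OF K q(1)])
  obtain x where x: "x \<in> fixed_field t" "poly q x = 0" using q by blast
  then have xN: "x \<in> N" "(\<sigma> ^^ t) x = x" by (auto simp: fixed_field_def)
  define y where "y j = (\<sigma> ^^ j) x" for j
  have yN: "y j \<in> N" for j unfolding y_def by (rule pow_in_N[OF xN(1)])
  define P where "P = (\<Prod>j<t. [:- y j, 1:])"
  \<comment> \<open>Multiplying by the factor of \<open>y 0\<close> avoids rotating a product: both
    sides become the product over the indices 0 to \<open>t\<close>, and
    \<open>y t = y 0\<close>.\<close>
  have "(\<Prod>j<t. [:- \<sigma> (y j), 1:]) * [:- y 0, 1:] = (\<Prod>j<Suc t. [:- y j, 1:])"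
    by (subst prod.lessThan_Suc_shift) (simp add: y_def mult.commute)
  also have "\<dots> = P * [:- y 0, 1:]" using xN by (simp add: P_def y_def)
  finally have "(\<Prod>j<t. [:- \<sigma> (y j), 1:]) = P" by (subst (asm) mult_right_cancel) auto
  then have "coeff P i \<in> fixed_field 1" for i
    using coeff_prod_linear[of t y i] yN by (simp add: fixed_field_def P_def)
  then have "poly_over K P" unfolding fixed_field_1 by (simp add: poly_over_def)
  moreover have "poly P x = 0"
    unfolding P_def poly_prod using t by (auto simp: y_def intro!: bexI[of _ 0])
  ultimately obtain r where r: "P = r * q" using irreducible_over_dvd[OF K q(1) x(2)] by blast
  fix u assume "poly q u = 0"
  then have "poly P u = 0" by (simp add: r)
  then obtain j where "u = y j" by (auto simp: P_def poly_prod)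
  moreover have "(\<sigma> ^^ t) (y j) = y j"
  proof -
    have "(\<sigma> ^^ t) (y j) = (\<sigma> ^^ j) ((\<sigma> ^^ t) x)" unfolding y_def by (metis add.commute comp_apply funpow_add)
    then show ?thesis using xN by (simp add: y_def)
  qed
  ultimately show "u \<in> fixed_field t" using yN by (simp add: fixed_field_def)
qed

text \<open>Half of \<open>p - 1\<close> is the multiple \<open>h = t * m\<close> of
  \<open>t\<close>, and \<open>g ^ h\<close> is -1 modulo \<open>p\<close>. So
  \<open>\<sigma> ^^ h\<close> inverts every \<open>z i\<close>, that is, it acts as complex
  conjugation, while the coefficients in \<open>K\<close> are real.\<close>

lemma fixed_field_real:
  assumes tm: "t * (2 * m) = p - 1" and K_real: "K \<subseteq> \<real>"
  shows "fixed_field t \<subseteq> \<real>"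
proof
  fix x assume x: "x \<in> fixed_field t"
  have xN: "x \<in> N" "(\<sigma> ^^ t) x = x" using x by (auto simp: fixed_field_def)
  define h where "h = t * m"
  have h: "0 < h" "h < p - 1" "h + h = p - 1" using tm p2 by (auto simp: h_def intro!: gr0I)
  have "((\<sigma> ^^ t) ^^ m) x = x" by (induction m) (use xN in auto)
  then have \<sigma>x: "(\<sigma> ^^ h) x = x" by (simp add: h_def funpow_mult mult.commute)
  \<comment> \<open>Modulo \<open>p\<close>, \<open>g ^ h\<close> squares to 1 but is not 1, as
    \<open>h\<close> is below the order \<open>p - 1\<close> of \<open>g\<close>.\<close>
  have "p dvd g ^ h + 1"
  proof -
    have "[g ^ (h + h) = 1] (mod p)" unfolding h(3) by (simp only: ord_divides ord_g dvd_refl)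
    then have "int p dvd int (g ^ h) * int (g ^ h) - 1"
      by (metis cong_iff_dvd_diff cong_int_iff of_nat_1 of_nat_mult power_add)
    also have "\<dots> = (int (g ^ h) - 1) * (int (g ^ h) + 1)" by (simp add: algebra_simps)
    finally have "int p dvd int (g ^ h) - 1 \<or> int p dvd int (g ^ h) + 1"
      using p by (simp add: prime_dvd_mult_iff)
    moreover have "\<not> int p dvd int (g ^ h) - 1"
    proof
      assume "int p dvd int (g ^ h) - 1"
      then have "[g ^ h = 1] (mod p)" by (metis cong_iff_dvd_diff cong_int_iff of_nat_1)
      then have "p - 1 dvd h" using ord_divides[of g h p] ord_g by simp
      then show False using h dvd_imp_le by fastforce
    qed
    ultimately have "int p dvd int (g ^ h + 1)" by (simp add: add.commute)
    then show ?thesis by (simp only: int_dvd_int_iff)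
  qed
  then obtain k where k: "g ^ h + 1 = p * k" by blast
  have cnj_z: "cnj (z i) = z (i + h)" for i
  proof -
    have "z (i + h) * z i = \<zeta> ^ (g ^ i * (g ^ h + 1))" by (simp add: z_def power_add algebra_simps)
    also have "\<dots> = (\<zeta> ^ p) ^ (g ^ i * k)" unfolding k by (metis mult.left_commute power_mult)
    also have "\<dots> = 1" by (simp add: \<zeta>(1))
    finally have "z (i + h) * z i = 1" .
    moreover have "cnj (z i) * z i = of_real ((norm (z i))\<^sup>2)" by (metis complex_norm_square mult.commute)
    then have "cnj (z i) * z i = 1" using \<zeta>(3) by (simp add: z_def norm_power)
    ultimately show ?thesis by (metis mult_cancel_right mult_zero_right zero_neq_one)
  qed
  have "\<exists>c. (\<forall>i\<in>{..<p - 1}. c i \<in> K) \<and> x = (\<Sum>i<p - 1. c i * z i)"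
    by (rule lin_indep_spans[OF K lin_indep_z _ N(3)]) (use z_in_N xN in auto)
  then obtain c where c': "(\<forall>i\<in>{..<p - 1}. c i \<in> K) \<and> x = (\<Sum>i<p - 1. c i * z i)" ..
  note c = bspec[OF conjunct1[OF c']] conjunct2[OF c']
  have "cnj (c i) = c i" if "i < p - 1" for i using c(1)[of i] that K_real by (auto simp: complex_is_Real_iff complex_eq_iff)
  then have "cnj x = (\<Sum>i<p - 1. c i * z (i + h))" unfolding c(2) by (simp add: cnj_z)
  also have "\<dots> = (\<sigma> ^^ h) x" unfolding c(2) by (subst pow_sum) (auto simp: c(1) z_in_N pow_z)
  finally have "cnj x = x" using \<sigma>x by simp
  then show "x \<in> \<real>" using Reals_cnj_iff by blast
qed

end

theorem cyclic_extension_exists: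
  assumes K: "number_field K" and t: "t \<ge> 1"
  obtains F where "subfield_C F" "K \<subseteq> F" "galois_over K F" "ext_degree K F t" "K \<subseteq> \<real> \<Longrightarrow> F \<subseteq> \<real>"
proof -
  obtain p v where v: "padic_field K p v" "2 * t dvd p - 1" "p > 2"
    using padic_prime_cong_1[OF K, of "2 * t"] t by auto
  then obtain m where m: "p - 1 = 2 * t * m" by blast
  have pp: "prime p" using v by (simp add: padic_field_def)
  obtain g where g: "residue_primroot p g" using prime_primitive_root_exists[of p] pp v(3) by auto
  obtain \<zeta> :: complex where \<zeta>: "\<zeta> ^ p = 1" "\<And>d. 0 < d \<Longrightarrow> d < p \<Longrightarrow> \<zeta> ^ d \<noteq> 1" "norm \<zeta> = 1"
    using primitive_root_of_unity_exists[of p] v(3) by auto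
  have "\<zeta> \<noteq> 1" using \<zeta>(2)[of 1] v(3) by simp
  then interpret cyclotomic K p v g \<zeta> by unfold_locales (use v g \<zeta> in auto)
  obtain \<sigma> where "cyclotomic_automorphism K p v g \<zeta> \<sigma>"
    using automorphism cyclotomic_automorphism.intro[OF cyclotomic_axioms]
    unfolding cyclotomic_automorphism_axioms_def by metis
  then interpret cyclotomic_automorphism K p v g \<zeta> \<sigma> .
  show thesis
  proof (rule that)
    show "ext_degree K (fixed_field t) t" using ext_degree_fixed_field[of t "2 * m"] m by simp
    show "fixed_field t \<subseteq> \<real>" if "K \<subseteq> \<real>" using fixed_field_real[of t m] m that by simp
    show "galois_over K (fixed_field t)" using galois_fixed_field t by simp
  qed (rule subfield_fixed_field subset_fixed_field)+
qed

section \<open>Extensions with prescribed ascending index\<close>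

text \<open>The bound on all \<open>d\<close> also makes the set finite, without which
  \<open>Max\<close> would be meaningless.\<close>

lemma asc_index_eqI:
  assumes F: "subfield_C F" "K \<subseteq> F" "F \<subseteq> L" "galois_over K F" "ext_degree K F t"
    and le: "\<And>E d. subfield_C E \<Longrightarrow> K \<subseteq> E \<Longrightarrow> E \<subseteq> L \<Longrightarrow> galois_over K E \<Longrightarrow> ext_degree K E d \<Longrightarrow> d \<le> t"
  shows "asc_index K L = t"
  unfolding asc_index_def
proof (rule Max_eqI)
  let ?S = "{d. \<exists>F. subfield_C F \<and> K \<subseteq> F \<and> F \<subseteq> L \<and> galois_over K F \<and> ext_degree K F d}"
  show "d \<le> t" if "d \<in> ?S" for d using that le by blast
  then have "?S \<subseteq> {..t}" by blast
  then show "finite ?S" by (rule finite_subset) simp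
  show "t \<in> ?S" using F by blast
qed

lemma root_of_degree_1_in:
  assumes K: "subfield_C K" and f: "poly_over K f" "degree f = 1" "poly f x = 0"
  shows "x \<in> K"
proof -
  define a b where a_def: "a = coeff f 0" and b_def: "b = coeff f 1"
  then have ab: "f = [:a, b:]"
    using f(2) by (intro poly_eqI) (auto simp: coeff_pCons coeff_eq_0 split: nat.splits)
  then have "b \<noteq> 0" using f(2) by auto
  have "a \<in> K" "b \<in> K" using f(1) by (auto simp: poly_over_def a_def b_def)
  then have "- a / b \<in> K" by (intro subfield_divide[OF K] subring_uminus subfield_subring K)
  moreover have "x = - a / b" using f(3) \<open>b \<noteq> 0\<close> unfolding ab by (simp add: field_simps add_eq_0_iff)
  ultimately show ?thesis by simp
qed

text \<open>Over \<open>F(\<alpha>)\<close> the cofactor \<open>g\<close> of \<open>X - \<alpha>\<close> in the minimal polynomial of \<open>\<alpha>\<close> is irreducible, so for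
  \<open>\<eta> = Q(\<alpha>)\<close> in a Galois subfield it divides \<open>Q - \<eta>'\<close> for a conjugate \<open>\<eta>'\<close>, hence is proportional
  to it. But \<open>Q\<close> has coefficients in \<open>F\<close> while the two leading coefficients of \<open>g\<close>
  have a ratio outside \<open>F\<close>.\<close>

lemma galois_subfield_of_adjoin:
  assumes K: "subfield_C K" and F: "subfield_C F" "K \<subseteq> F"
    and f: "irreducible_over F f" "poly f \<alpha> = 0" "degree f = Suc (Suc n)" "n \<ge> 1"
    and g: "irreducible_over (adjoin F \<alpha>) g" "degree g = Suc n" "lead_coeff g = 1" "coeff g n \<notin> F"
      "\<And>x. poly g x = 0 \<Longrightarrow> poly f x = 0"
    and E: "subfield_C E" "E \<subseteq> adjoin F \<alpha>" "galois_over K E" "ext_degree K E d"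
  shows "E \<subseteq> F"
proof
  fix \<eta> assume \<eta>: "\<eta> \<in> E"
  let ?L = "adjoin F \<alpha>"
  note FR = subfield_subring[OF F(1)]
  have L: "subfield_C ?L" by (rule subfield_adjoin[OF F(1) f(1,2)])
  have FL: "F \<subseteq> ?L" by (rule subset_adjoin[OF F(1)])
  have fF: "poly_over F f" using f(1) by (simp add: irreducible_over_def)
  obtain Q where Q: "poly_over F Q" "\<eta> = poly Q \<alpha>" "degree Q < degree f"
    using adjoin_reduced[OF F(1) f(1,2)] \<eta> E(2) by blast
  obtain q where q: "irreducible_over K q" "poly q \<eta> = 0"
    using irreducible_over_exists_ext_degree[OF K E(1,4) \<eta>] by blast
  have "poly_over F q" using q(1) F(2) poly_over_mono unfolding irreducible_over_def by blast
  \<comment> \<open>The polynomial \<open>q(Q(X))\<close> vanishes at \<open>\<alpha>\<close>, so it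
    is a multiple of \<open>f\<close> and vanishes at every root of \<open>f\<close>. Thus
    \<open>Q\<close> carries conjugates of \<open>\<alpha>\<close> over \<open>F\<close> to roots of
    \<open>q\<close>.\<close>
  then have "poly_over F (pcompose q Q)" by (rule poly_over_pcompose[OF FR _ Q(1)])
  moreover have "poly (pcompose q Q) \<alpha> = 0" using q(2) Q(2) by (simp add: poly_pcompose)
  ultimately obtain r where r: "pcompose q Q = r * f" using irreducible_over_dvd[OF F(1) f(1,2)] by blast
  have "\<not> constant (poly g)" using g(2) by (simp add: constant_degree)
  then obtain \<beta> where \<beta>: "poly g \<beta> = 0" using fundamental_theorem_of_algebra by blast
  have "poly (pcompose q Q) \<beta> = 0" unfolding r using g(5)[OF \<beta>] by simp
  then have "poly q (poly Q \<beta>) = 0" by (simp add: poly_pcompose)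
  then have "poly Q \<beta> \<in> E" using E(3) q \<eta> unfolding galois_over_def by blast
  then have cL: "poly_over ?L [:poly Q \<beta>:]"
    using E(2) by (intro poly_over_pCons poly_over_0 subfield_subring L) auto
  define H where "H = Q - [:poly Q \<beta>:]"
  have HL: "poly_over ?L H" unfolding H_def
    by (intro poly_over_diff subfield_subring L poly_over_mono[OF Q(1) FL] cL)
  have "poly H \<beta> = 0" by (simp add: H_def)
  then obtain c where c: "H = c * g" using irreducible_over_dvd[OF L g(1) \<beta> HL] by blast
  have g0: "g \<noteq> 0" using g(2) by auto
  have "degree H \<le> Suc n" unfolding H_def using Q(3) f(3) by (intro degree_diff_le) auto
  then have "degree c = 0" using c g0 g(2) by (cases "c = 0") (auto simp: degree_mult_eq)
  then obtain c0 where c0: "c = [:c0:]" using degree_eq_zeroE by blast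
  have coeffH: "coeff H k = c0 * coeff g k" for k by (simp add: c c0)
  \<comment> \<open>Subtracting a constant touches only coefficient 0. Both \<open>n\<close> and
    \<open>n + 1\<close> must be positive indices, and \<open>n \<ge> 1\<close> is exactly what
    \<open>u \<ge> 3\<close> provides.\<close>
  have coeffQ: "coeff H k \<in> F" if "k \<ge> 1" for k
    using that Q(1) by (auto simp: H_def poly_over_def coeff_pCons split: nat.splits)
  have "c0 = 0"
  proof (rule ccontr)
    assume nz: "c0 \<noteq> 0"
    have "c0 \<in> F" using coeffQ[of "Suc n"] coeffH[of "Suc n"] g(2,3) by simp
    moreover have "c0 * coeff g n \<in> F" using coeffQ[of n] coeffH[of n] f(4) by simp
    ultimately have "c0 * coeff g n / c0 \<in> F" using subfield_divide[OF F(1)] by blast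
    then show False using nz g(4) by simp
  qed
  then have "Q = [:poly Q \<beta>:]" using c c0 by (simp add: H_def)
  then have "\<eta> = coeff Q 0" using Q(2) by (metis coeff_pCons_0 mult_zero_right poly_pCons add.right_neutral poly_0)
  then show "\<eta> \<in> F" using Q(1) by (simp add: poly_over_def)
qed

text \<open>With primes \<open>p < q\<close> having places of degree one in \<open>F\<close>, the polynomial
  \<open>X\<^sup>n\<^sup>+\<^sup>2 - p X\<^sup>n\<^sup>+\<^sup>1 + p q\<close> is Eisenstein at \<open>p\<close>, and modulo \<open>q\<close> it has the simple root \<open>p\<close>, whose
  cofactor is Eisenstein over \<open>F(\<alpha>)\<close> with respect to \<open>\<alpha> - p\<close>.\<close>

lemma adjoin_without_galois_subfields:
  assumes K: "subfield_C K" and F: "number_field F" "K \<subseteq> F" and n: "n \<ge> 1"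
  obtains \<alpha> where "subfield_C (adjoin F \<alpha>)" "ext_degree F (adjoin F \<alpha>) (Suc (Suc n))"
    "\<And>E d. subfield_C E \<Longrightarrow> E \<subseteq> adjoin F \<alpha> \<Longrightarrow> galois_over K E \<Longrightarrow> ext_degree K E d \<Longrightarrow> E \<subseteq> F"
proof -
  have sF: "subfield_C F" using F by (simp add: number_field_def)
  note R = subfield_subring[OF sF]
  obtain p v1 where v1: "padic_field F p v1" using number_field_padic[OF F(1), of 0] by blast
  obtain q v2 where q: "q > p" and v2: "padic_field F q v2" using number_field_padic[OF F(1), of p] by blast
  have primes: "prime p" "prime q" using v1 v2 by (auto simp: padic_field_def)
  have ndvd: "\<not> int p dvd int q" "\<not> int q dvd int p" using primes q primes_dvd_imp_eq by (auto simp: int_dvd_int_iff)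
  have pq0: "of_nat p \<noteq> (0 :: complex)" "of_nat q \<noteq> (0 :: complex)" using primes by auto
  have pF: "of_nat p \<in> F" and qF: "of_nat q \<in> F" by (rule subring_of_nat[OF R])+
  interpret V1: discrete_val F v1 using v1 by (simp add: padic_field_def)
  interpret V2: discrete_val F v2 using v2 by (simp add: padic_field_def)
  have val: "v1 (of_nat p) = 1" "v1 (of_nat q) = 0" "v2 (of_nat p) = 0" "v2 (of_nat q) = 1"
    using v1 v2 padic_v_of_int[OF v1 ndvd(1)] padic_v_of_int[OF v2 ndvd(2)] by (auto simp: padic_field_def)
  define f :: "complex poly" where
    "f = monom 1 (Suc (Suc n)) - monom (of_nat p) (Suc n) + [:of_nat p * of_nat q:]"
  have coeff_f: "coeff f i = (if i = Suc (Suc n) then 1 else if i = Suc n then - of_nat p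
      else if i = 0 then of_nat p * of_nat q else 0)" for i
    by (auto simp: f_def coeff_pCons split: nat.splits)
  have poly_f: "poly f x = x ^ Suc (Suc n) - of_nat p * x ^ Suc n + of_nat p * of_nat q" for x
    by (simp add: f_def poly_monom)
  have deg_f: "degree f = Suc (Suc n)"
  proof (rule antisym)
    show "degree f \<le> Suc (Suc n)" by (rule degree_le) (auto simp: coeff_f)
    show "Suc (Suc n) \<le> degree f" by (rule le_degree) (simp add: coeff_f)
  qed
  have mpF: "- of_nat p \<in> F" by (rule subring_uminus[OF R pF])
  have fF: "poly_over F f" unfolding poly_over_def coeff_f
    using pF qF mpF subring_mult[OF R] subring_0[OF R] subring_1[OF R] by auto
  have v1pq: "v1 (of_nat p * of_nat q) = 1" and v2pq: "v2 (of_nat p * of_nat q) = 1"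
    using V1.v_mult[OF pF qF pq0] V2.v_mult[OF pF qF pq0] val by simp_all
  have irr: "irreducible_over F f"
  proof (rule V1.eisenstein[OF fF deg_f])
    show "v1 (lead_coeff f) = 0" unfolding deg_f by (simp add: coeff_f V1.v_1)
    show "coeff f 0 \<noteq> 0" "v1 (coeff f 0) = 1" using pq0 v1pq by (simp_all add: coeff_f)
    show "vge v1 1 (coeff f i)" if "i < Suc (Suc n)" for i
      using that val v1pq V1.v_uminus[OF pF] by (auto simp: coeff_f vge_def)
  qed simp
  have "\<not> constant (poly f)" using deg_f by (simp add: constant_degree)
  then obtain \<alpha> where \<alpha>: "poly f \<alpha> = 0" using fundamental_theorem_of_algebra by blast
  \<comment> \<open>The terms \<open>(n + 2) * p ^ (n + 1)\<close> and
    \<open>(n + 1) * p * p ^ n\<close> leave a single power of \<open>p\<close>, a unit at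
    \<open>q\<close>; also \<open>f(p) = p * q\<close>, so \<open>p\<close> is a simple root modulo
    the place of \<open>q\<close>.\<close>
  have pd: "poly (pderiv f) (of_nat p) = of_nat p ^ Suc n"
    by (simp add: f_def pderiv_add pderiv_diff pderiv_monom pderiv_pCons poly_monom algebra_simps)
  have vge_f: "vge v2 0 (coeff f i)" for i
    using val v2pq V2.v_uminus[OF pF] V2.v_1 by (auto simp: coeff_f vge_def)
  have "vge v2 0 (of_nat p)" "vge v2 1 (poly f (of_nat p))" using val v2pq by (auto simp: vge_def poly_f)
  moreover have "poly (pderiv f) (of_nat p) \<noteq> 0" "v2 (poly (pderiv f) (of_nat p)) = 0"
    unfolding pd using pq0 V2.v_power[OF pF pq0(1), of "Suc n"] val by simp_all
  ultimately obtain w where w: "padic_field (adjoin F \<alpha>) q w" "\<And>x. x \<in> F \<Longrightarrow> x \<noteq> 0 \<Longrightarrow> w x = v2 x"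
    "vge w 1 (\<alpha> - of_nat p)"
    using padic_hensel_extension[OF v2 irr \<alpha> vge_f pF] by blast
  interpret W: discrete_val "adjoin F \<alpha>" w using w by (simp add: padic_field_def)
  have FL: "F \<subseteq> adjoin F \<alpha>" by (rule subset_adjoin[OF sF])
  have \<alpha>L: "\<alpha> \<in> adjoin F \<alpha>" by (rule generator_in_adjoin[OF sF])
  define \<pi> where "\<pi> = \<alpha> - of_nat p"
  have \<pi>L: "\<pi> \<in> adjoin F \<alpha>" unfolding \<pi>_def using \<alpha>L FL pF by (intro subring_diff W.R) auto
  have wp: "w (of_nat p) = 0" "w (of_nat p * of_nat q) = 1"
    using w(2)[OF pF] w(2)[OF subring_mult[OF R pF qF]] pq0 val v2pq by auto
  have "of_nat p + \<pi> \<noteq> 0" "w (of_nat p + \<pi>) = 0"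
    using W.v_add_dominant[of "of_nat p" \<pi>] FL pF \<pi>L pq0 wp w(3) by (auto simp: \<pi>_def)
  then have \<alpha>0: "\<alpha> \<noteq> 0" "w \<alpha> = 0" by (simp_all add: \<pi>_def)
  \<comment> \<open>The equation of \<open>\<alpha>\<close> regrouped: as \<open>\<alpha>\<close>
    reduces to the unit \<open>p\<close>, the full value 1 of \<open>p * q\<close> falls on
    \<open>\<pi>\<close>.\<close>
  have \<alpha>\<pi>: "\<alpha> ^ Suc n * \<pi> = - (of_nat p * of_nat q)"
    using \<alpha> unfolding poly_f \<pi>_def by (simp add: algebra_simps add_eq_0_iff)
  have \<pi>0: "\<pi> \<noteq> 0" using \<alpha>\<pi> pq0 by auto
  have pqL: "of_nat p * of_nat q \<in> adjoin F \<alpha>" using subring_mult[OF R pF qF] FL by blast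
  have pow: "\<alpha> ^ k \<in> adjoin F \<alpha>" "\<alpha> ^ k \<noteq> 0" "w (\<alpha> ^ k) = 0" for k
    using subring_power[OF W.R \<alpha>L] \<alpha>0 W.v_power[OF \<alpha>L] by auto
  have w\<pi>: "w \<pi> = 1"
    using W.v_mult[OF pow(1) \<pi>L pow(2) \<pi>0, of "Suc n"] W.v_uminus[OF pqL] wp(2) pow(3)[of "Suc n"]
    unfolding \<alpha>\<pi> by simp
  \<comment> \<open>The quotient of \<open>f\<close> by \<open>X - \<alpha>\<close> from synthetic
    division. Every lower coefficient is \<open>\<pi>\<close> times a power of
    \<open>\<alpha>\<close>, and coefficient \<open>n\<close> is \<open>\<pi>\<close> itself, which
    lies outside \<open>F\<close>.\<close>
  define g where "g = monom 1 (Suc n) + (\<Sum>j<Suc n. monom (\<pi> * \<alpha> ^ (Suc n - Suc j)) j)"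
  have coeff_g: "coeff g i = (if i = Suc n then 1 else if i < Suc n then \<pi> * \<alpha> ^ (Suc n - Suc i) else 0)" for i
    by (simp add: g_def coeff_sum del: sum.lessThan_Suc)
  have deg_g: "degree g = Suc n"
  proof (rule antisym)
    show "degree g \<le> Suc n" by (rule degree_le) (auto simp: coeff_g)
    show "Suc n \<le> degree g" by (rule le_degree) (simp add: coeff_g)
  qed
  have \<pi>pow: "\<pi> * \<alpha> ^ k \<in> adjoin F \<alpha>" "\<pi> * \<alpha> ^ k \<noteq> 0" "w (\<pi> * \<alpha> ^ k) = 1" for k
    using subring_mult[OF W.R \<pi>L pow(1)] \<pi>0 pow(2) W.v_mult[OF \<pi>L pow(1) \<pi>0 pow(2)] w\<pi> pow(3) by auto
  have irr_g: "irreducible_over (adjoin F \<alpha>) g"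
  proof (rule W.eisenstein[OF _ deg_g])
    show "poly_over (adjoin F \<alpha>) g" unfolding poly_over_def coeff_g
      using \<pi>pow(1) subring_0[OF W.R] subring_1[OF W.R] by auto
    show "w (lead_coeff g) = 0" unfolding deg_g by (simp add: coeff_g W.v_1)
    show "coeff g 0 \<noteq> 0" "w (coeff g 0) = 1" unfolding coeff_g using \<pi>pow(2,3) by auto
    show "vge w 1 (coeff g i)" if "i < Suc n" for i
      unfolding coeff_g vge_def using that \<pi>pow(3) by auto
  qed simp
  have g_root: "poly f x = 0" if "poly g x = 0" for x
  proof -
    define S where "S = (\<Sum>j<Suc n. \<alpha> ^ (Suc n - Suc j) * x ^ j)"
    have g_eq: "poly g x = x ^ Suc n + \<pi> * S"
      by (simp add: g_def S_def poly_sum poly_monom sum_distrib_left mult.assoc del: sum.lessThan_Suc)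
    have S_eq: "(x - \<alpha>) * S = x ^ Suc n - \<alpha> ^ Suc n"
      unfolding S_def by (rule power_diff_sumr2[symmetric])
    have "(x - \<alpha>) * poly g x = (x - \<alpha>) * x ^ Suc n + \<pi> * ((x - \<alpha>) * S)"
      unfolding g_eq by (simp add: distrib_left mult.left_commute)
    also have "\<dots> = (x - \<alpha> + \<pi>) * x ^ Suc n - \<alpha> ^ Suc n * \<pi>" unfolding S_eq by (simp add: algebra_simps)
    also have "\<dots> = poly f x" unfolding \<alpha>\<pi> poly_f by (simp add: \<pi>_def algebra_simps)
    finally show ?thesis using that by simp
  qed
  have "\<alpha> \<notin> F"
  proof
    assume "\<alpha> \<in> F"
    then have "poly_over F [:- \<alpha>, 1:]" by (intro poly_over_pCons poly_over_0 R subring_uminus subring_1)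
    from irreducible_over_root_degree[OF sF irr \<alpha> this] show False using deg_f by simp
  qed
  then have "\<pi> \<notin> F" using subring_add[OF R _ pF, of \<pi>] by (auto simp: \<pi>_def)
  then have gn: "coeff g n \<notin> F" by (simp add: coeff_g)
  have lead_g: "lead_coeff g = 1" unfolding deg_g by (simp add: coeff_g)
  show thesis
  proof (rule that)
    show "subfield_C (adjoin F \<alpha>)" by (rule W.F)
    show "ext_degree F (adjoin F \<alpha>) (Suc (Suc n))" using ext_degree_adjoin[OF sF irr \<alpha>] deg_f by simp
    show "E \<subseteq> F" if "subfield_C E" "E \<subseteq> adjoin F \<alpha>" "galois_over K E" "ext_degree K E d" for E d
      by (rule galois_subfield_of_adjoin[OF K sF F(2) irr \<alpha> deg_f n irr_g deg_g lead_g gn g_root that])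
  qed
qed

section \<open>Real quadratic extensions, for part (2)\<close>

lemma ext_degree_refl:
  assumes K: "subfield_C K"
  shows "ext_degree K K 1"
proof (rule ext_degreeI[OF K, of "{0::nat}" "\<lambda>_. 1"])
  show "x \<in> K \<longleftrightarrow> (\<exists>c. (\<forall>i\<in>{0::nat}. c i \<in> K) \<and> x = (\<Sum>i\<in>{0::nat}. c i * 1))" for x
    by (auto intro: exI[of _ "\<lambda>_. x"])
qed (simp_all add: lin_indep_def)

lemma subfield_Reals: "subfield_C \<real>"
  by (auto simp: subfield_C_def)

text \<open>Serves to form the polynomial whose value at \<open>x\<^sup>2\<close> is
  \<open>q(x) * q(-x)\<close>. Prepending a coefficient swaps the roles of the two parts.\<close>

lemma poly_even_odd_parts:
  assumes R: "subring_C S" and "poly_over S q"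
  shows "\<exists>a b. poly_over S a \<and> poly_over S b \<and> (\<forall>x. poly q x = poly a (x\<^sup>2) + x * poly b (x\<^sup>2))"
  using assms(2)
proof (induction q)
  case 0
  then show ?case using poly_over_0[OF R] by (intro exI[of _ 0]) simp
next
  case (pCons c q)
  then have cS: "c \<in> S" "poly_over S q"
    unfolding poly_over_def by (metis coeff_pCons_0, metis coeff_pCons_Suc)
  with pCons obtain a b where ab: "poly_over S a" "poly_over S b"
    "\<And>x. poly q x = poly a (x\<^sup>2) + x * poly b (x\<^sup>2)" by blast
  show ?case
  proof (rule exI[of _ "pCons c b"], rule exI[of _ a], intro conjI allI)
    show "poly_over S (pCons c b)" using cS ab by (intro poly_over_pCons R)
    show "poly (pCons c q) x = poly (pCons c b) (x\<^sup>2) + x * poly a (x\<^sup>2)" for x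
      by (simp add: ab(3) power2_eq_square algebra_simps)
  qed (rule ab(1))
qed

lemma irreducible_over_two_roots:
  assumes K: "subfield_C K" and f: "irreducible_over K f" "poly f x = 0" "x \<notin> K"
  obtains y where "poly f y = 0" "y \<noteq> x"
proof -
  have d: "degree f \<ge> 1" "poly_over K f" using f by (auto simp: irreducible_over_def)
  have d2: "degree f \<ge> 2" using root_of_degree_1_in[OF K d(2) _ f(2)] f(3) d(1) by fastforce
  obtain e where e: "f = [:- x, 1:] * e" using f(2) poly_eq_0_iff_dvd by (metis dvdE)
  have "e \<noteq> 0" using e d by auto
  then have "degree f = 1 + degree e" unfolding e by (subst degree_mult_eq) auto
  then have "\<not> constant (poly e)" using d2 by (simp add: constant_degree)
  then obtain y where y: "poly e y = 0" using fundamental_theorem_of_algebra by blast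
  have "y \<noteq> x"
  proof
    assume "y = x"
    then have "poly (pderiv f) x = 0" unfolding e pderiv_mult using y by simp
    then show False using irreducible_over_rsquarefree[OF K f(1)] f(2) by (auto simp: rsquarefree_roots)
  qed
  moreover have "poly f y = 0" using y by (simp add: e)
  ultimately show thesis using that by blast
qed

text \<open>A totally real Galois extension contains no square root of an element with a negative conjugate.\<close>

lemma real_extension_without_galois_subfields:
  assumes F: "subfield_C F" "F \<subseteq> \<real>" "galois_over \<rat> F" "ext_degree \<rat> F t" and t: "t \<ge> 2"
  obtains L where "subfield_C L" "F \<subseteq> L" "ext_degree F L 2"
    "\<And>E d. subfield_C E \<Longrightarrow> E \<subseteq> L \<Longrightarrow> galois_over \<rat> E \<Longrightarrow> ext_degree \<rat> E d \<Longrightarrow> d \<le> t"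
proof -
  note Q = subfield_Rats and QR = subfield_subring[OF subfield_Rats] and FR = subfield_subring[OF F(1)]
  have QF: "\<rat> \<subseteq> F" by (rule Rats_subset_subfield[OF F(1)])
  \<comment> \<open>A degree of at least 2 supplies an irrational \<open>\<theta>\<close> with a
    second conjugate, which the sign change below requires.\<close>
  have "\<not> F \<subseteq> \<rat>"
  proof
    assume "F \<subseteq> \<rat>"
    from ext_degree_mono[OF Q F(4) ext_degree_refl[OF Q] this] show False using t by simp
  qed
  then obtain \<theta> where \<theta>: "\<theta> \<in> F" "\<theta> \<notin> \<rat>" by blast
  obtain m where m: "irreducible_over \<rat> m" "poly m \<theta> = 0"
    using irreducible_over_exists_ext_degree[OF Q F(1,4) \<theta>(1)] by blast
  obtain \<theta>' where \<theta>': "poly m \<theta>' = 0" "\<theta>' \<noteq> \<theta>" using irreducible_over_two_roots[OF Q m \<theta>(2)] by blast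
  have "\<theta>' \<in> F" using F(3) m \<theta>(1) \<theta>'(1) unfolding galois_over_def by blast
  then obtain x x' where x: "\<theta> = of_real x" "\<theta>' = of_real x'" "x \<noteq> x'"
    using F(2) \<theta>(1) \<theta>'(2) by (metis Reals_cases subsetD)
  have "min x x' < max x x'" using x(3) by auto
  from Rats_dense_in_real[OF this] obtain r where r: "r \<in> \<rat>" "min x x' < r" "r < max x x'" by blast
  \<comment> \<open>A rational \<open>r\<close> separates the two conjugates, and the sign
    \<open>s\<close> makes \<open>l = s * (X - r)\<close> positive at \<open>\<theta>\<close> and
    negative at \<open>\<theta>'\<close>; so \<open>\<gamma>\<close> is real and
    \<open>\<gamma>'\<close> is purely imaginary.\<close>
  define s :: real where "s = (if x > x' then 1 else - 1)"
  have pos: "s * (x - r) > 0" "s * (x' - r) < 0" using r x(3) by (auto simp: s_def split: if_splits)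
  define l :: "complex poly" where "l = [:- of_real (s * r), of_real s:]"
  have sQ: "s \<in> \<rat>" by (simp add: s_def)
  have lQ: "poly_over \<rat> l" unfolding l_def using sQ r(1)
    by (intro poly_over_pCons poly_over_0 QR) auto
  define \<gamma> :: complex where "\<gamma> = of_real (sqrt (s * (x - r)))"
  define \<gamma>' :: complex where "\<gamma>' = \<i> * of_real (sqrt (- (s * (x' - r))))"
  have sq: "\<gamma>\<^sup>2 = poly l \<theta>" "\<gamma>'\<^sup>2 = poly l \<theta>'"
    using pos by (simp_all add: \<gamma>_def \<gamma>'_def l_def x power_mult_distrib algebra_simps flip: of_real_power of_real_mult)
  have \<gamma>'_nonreal: "\<gamma>' \<notin> \<real>" "- \<gamma>' \<notin> \<real>" using pos by (auto simp: \<gamma>'_def complex_is_Real_iff)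
  have no_galois: "\<gamma> \<notin> E" if E: "E \<subseteq> \<real>" "galois_over \<rat> E" "subfield_C E" "ext_degree \<rat> E d" for E d
  proof
    assume "\<gamma> \<in> E"
    then obtain q where q: "irreducible_over \<rat> q" "poly q \<gamma> = 0"
      using irreducible_over_exists_ext_degree[OF Q E(3,4)] by blast
    have "poly_over \<rat> q" using q by (simp add: irreducible_over_def)
    then obtain a b where ab: "poly_over \<rat> a" "poly_over \<rat> b"
      "\<And>x. poly q x = poly a (x\<^sup>2) + x * poly b (x\<^sup>2)" using poly_even_odd_parts[OF QR] by blast
    \<comment> \<open>From \<open>q = a(X\<^sup>2) + X * b(X\<^sup>2)\<close> comes
      \<open>h(x\<^sup>2) = q(x) * q(-x)\<close>. Hence \<open>h(l(X))\<close> vanishes at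
      \<open>\<theta>\<close>, so also at its conjugate \<open>\<theta>'\<close>, and one of
      \<open>\<gamma>'\<close>, \<open>- \<gamma>'\<close> is a root of \<open>q\<close>.\<close>
    define h where "h = a * a - pCons 0 (b * b)"
    have h: "poly h (x\<^sup>2) = poly q x * poly q (- x)" for x
      by (simp add: h_def ab(3) power2_eq_square algebra_simps)
    have "poly_over \<rat> (pcompose h l)"
      unfolding h_def by (intro poly_over_pcompose QR lQ poly_over_diff poly_over_mult ab poly_over_pCons) simp
    moreover have "poly (pcompose h l) \<theta> = 0"
      unfolding poly_pcompose sq(1)[symmetric] h by (simp add: q(2))
    ultimately obtain k where k: "pcompose h l = k * m" using irreducible_over_dvd[OF Q m] by blast
    have "poly (pcompose h l) \<theta>' = 0" unfolding k by (simp add: \<theta>'(1))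
    then have "poly q \<gamma>' * poly q (- \<gamma>') = 0" unfolding poly_pcompose sq(2)[symmetric] h .
    then have "\<gamma>' \<in> E \<or> - \<gamma>' \<in> E" using E(2) q \<open>\<gamma> \<in> E\<close> unfolding galois_over_def by auto
    then show False using \<gamma>'_nonreal E(1) by blast
  qed
  have \<gamma>F: "\<gamma> \<notin> F" by (rule no_galois[OF F(2,3,1,4)])
  have "poly l \<theta> \<in> F" by (rule poly_over_poly[OF FR poly_over_mono[OF lQ QF] \<theta>(1)])
  then have quadF: "poly_over F [:- \<gamma>\<^sup>2, 0, 1:]" unfolding sq
    by (intro poly_over_pCons poly_over_0 FR subring_uminus subring_0 subring_1)
  have quad0: "poly [:- \<gamma>\<^sup>2, 0, 1:] \<gamma> = 0" by (simp add: power2_eq_square)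
  obtain f where f: "irreducible_over F f" "poly f \<gamma> = 0"
    using irreducible_over_exists[OF F(1) quadF _ quad0] by auto
  obtain k where k: "[:- \<gamma>\<^sup>2, 0, 1:] = k * f" using irreducible_over_dvd[OF F(1) f quadF quad0] by blast
  then have "degree (k * f) = 2" by (metis degree_pCons_eq_if numeral_2_eq_2 one_neq_zero pCons_eq_0_iff)
  moreover have "k \<noteq> 0" "f \<noteq> 0" using k by auto
  ultimately have "degree f \<le> 2" by (simp add: degree_mult_eq)
  moreover have "degree f \<ge> 1" "poly_over F f" using f by (auto simp: irreducible_over_def)
  moreover have "degree f \<noteq> 1" using root_of_degree_1_in[OF F(1) \<open>poly_over F f\<close> _ f(2)] \<gamma>F by blast
  ultimately have deg2: "degree f = 2" by linarith
  define L where "L = adjoin F \<gamma>"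
  have L: "subfield_C L" "F \<subseteq> L" "ext_degree F L 2" "\<gamma> \<in> L"
    unfolding L_def using subfield_adjoin[OF F(1) f] subset_adjoin[OF F(1)]
      ext_degree_adjoin[OF F(1) f] deg2 generator_in_adjoin[OF F(1)] by simp_all
  have L_real: "L \<subseteq> \<real>" unfolding L_def
    by (rule adjoin_subset[OF subfield_Reals F(2)]) (simp add: \<gamma>_def)
  have QL: "ext_degree \<rat> L (2 * t)" by (rule ext_degree_tower[OF Q F(4) L(3)])
  show thesis
  proof (rule that[OF L(1-3)])
    fix E d assume E: "subfield_C E" "E \<subseteq> L" "galois_over \<rat> E" "ext_degree \<rat> E d"
    \<comment> \<open>Since \<open>\<gamma>\<close> is missing from \<open>E\<close>, the field
      \<open>E(\<gamma>)\<close> inside \<open>L\<close> has degree at least \<open>2 * d\<close>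
      over the rationals, while \<open>L\<close> has degree \<open>2 * t\<close>. No inclusion of
      \<open>E\<close> in \<open>F\<close> is required.\<close>
    have \<gamma>E: "\<gamma> \<notin> E" by (rule no_galois[OF _ E(3,1,4)]) (use E(2) L_real in blast)
    obtain q where q: "irreducible_over \<rat> q" "poly q \<gamma> = 0"
      using irreducible_over_exists_ext_degree[OF Q L(1) QL L(4)] by blast
    have "poly_over E q" "q \<noteq> 0"
      using q(1) poly_over_mono Rats_subset_subfield[OF E(1)] by (auto simp: irreducible_over_def)
    then obtain e where e: "irreducible_over E e" "poly e \<gamma> = 0"
      using irreducible_over_exists[OF E(1) _ _ q(2)] by blast
    have "degree e \<ge> 1" "poly_over E e" using e by (auto simp: irreducible_over_def)
    moreover have "degree e \<noteq> 1" using root_of_degree_1_in[OF E(1) \<open>poly_over E e\<close> _ e(2)] \<gamma>E by blast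
    ultimately have "2 \<le> degree e" by simp
    moreover have "degree e * d \<le> 2 * t"
      by (rule ext_degree_mono[OF Q ext_degree_tower[OF Q E(4) ext_degree_adjoin[OF E(1) e]] QL])
         (rule adjoin_subset[OF L(1) E(2) L(4)])
    ultimately have "2 * d \<le> 2 * t" by (meson mult_le_mono1 order_trans)
    then show "d \<le> t" by simp
  qed
qed

theorem theorem9p7:
  shows "(\<forall>K (u::nat) (t::nat). number_field K \<and> u \<ge> 3 \<and> t \<ge> 1 \<longrightarrow>
            (\<exists>L. subfield_C L \<and> K \<subseteq> L \<and> ext_degree K L (u * t) \<and> asc_index K L = t))
       \<and> (\<forall>t::nat. even t \<and> t > 0 \<longrightarrow>
            (\<exists>L. subfield_C L \<and> \<rat> \<subseteq> L \<and> ext_degree \<rat> L (2 * t) \<and> asc_index \<rat> L = t))"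
proof (intro conjI allI impI)
  fix K :: "complex set" and u t :: nat
  assume asm: "number_field K \<and> u \<ge> 3 \<and> t \<ge> 1"
  then have sK: "subfield_C K" by (simp add: number_field_def)
  obtain F where F: "subfield_C F" "K \<subseteq> F" "galois_over K F" "ext_degree K F t"
    using cyclic_extension_exists[of K t] asm by blast
  have nF: "number_field F" using number_field_ext[OF _ F(1,4)] asm by blast
  have "u = Suc (Suc (u - 2))" "u - 2 \<ge> 1" using asm by auto
  then obtain n where n: "u = Suc (Suc n)" "n \<ge> 1" by blast
  obtain \<alpha> where \<alpha>: "subfield_C (adjoin F \<alpha>)" "ext_degree F (adjoin F \<alpha>) (Suc (Suc n))"
    and gal: "\<And>E d. subfield_C E \<Longrightarrow> E \<subseteq> adjoin F \<alpha> \<Longrightarrow> galois_over K E \<Longrightarrow> ext_degree K E d \<Longrightarrow> E \<subseteq> F"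
    using adjoin_without_galois_subfields[OF sK nF F(2) n(2)] by blast
  have FL: "F \<subseteq> adjoin F \<alpha>" by (rule subset_adjoin[OF F(1)])
  have "asc_index K (adjoin F \<alpha>) = t"
  proof (rule asc_index_eqI[OF F(1,2) FL F(3,4)])
    fix E d assume E: "subfield_C E" "E \<subseteq> adjoin F \<alpha>" "galois_over K E" "ext_degree K E d"
    show "d \<le> t" by (rule ext_degree_mono[OF sK E(4) F(4) gal[OF E]])
  qed
  moreover have "ext_degree K (adjoin F \<alpha>) (u * t)" using ext_degree_tower[OF sK F(4) \<alpha>(2)] n by simp
  ultimately show "\<exists>L. subfield_C L \<and> K \<subseteq> L \<and> ext_degree K L (u * t) \<and> asc_index K L = t"
    using \<alpha>(1) F(2) FL by blast
next
  fix t :: nat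
  assume t: "even t \<and> t > 0"
  then have t2: "t \<ge> 2" by (auto elim!: evenE)
  have "number_field \<rat>" using ext_degree_refl[OF subfield_Rats] subfield_Rats by (auto simp: number_field_def)
  then obtain F where F: "subfield_C F" "\<rat> \<subseteq> F" "galois_over \<rat> F" "ext_degree \<rat> F t" "F \<subseteq> \<real>"
    using cyclic_extension_exists[of \<rat> t] t2 by (metis One_nat_def Rats_subset_subfield Suc_leD numeral_2_eq_2 subfield_Reals)
  obtain L where L: "subfield_C L" "F \<subseteq> L" "ext_degree F L 2"
    "\<And>E d. subfield_C E \<Longrightarrow> E \<subseteq> L \<Longrightarrow> galois_over \<rat> E \<Longrightarrow> ext_degree \<rat> E d \<Longrightarrow> d \<le> t"
    using real_extension_without_galois_subfields[OF F(1,5,3,4) t2] by blast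
  have "asc_index \<rat> L = t" using asc_index_eqI[OF F(1,2) L(2) F(3,4) L(4)] .
  moreover have "ext_degree \<rat> L (2 * t)" by (rule ext_degree_tower[OF subfield_Rats F(4) L(3)])
  ultimately show "\<exists>L. subfield_C L \<and> \<rat> \<subseteq> L \<and> ext_degree \<rat> L (2 * t) \<and> asc_index \<rat> L = t"
    using L(1,2) F(2) by blast
qed

end
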